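(* Let $R$ be a commutative ring, let $S$ be a free quadratic $R$-algebra, and let $I,I'$ be pseudoregular $S$-modules, free of rank $2$ over $R$. Let $\alpha,e_1,e_2$ and $\alpha',e_1',e_2'$ be good frames for $S,I$ and $S,I'$ respectively, with $\alpha'=\alpha+r$ for some $r\in R$, and let $a,b,c,a',b',c'\in R$ be such that $\alpha e_1=be_1-ae_2$, $\alpha e_2=ce_1$, $\alpha'e_1'=b'e_1'-a'e_2'$, $\alpha'e_2'=c'e_1'$. Suppose that $\langle a,a',b+r\rangle=R$, and let $s,s',t\in R$ be such that $$sa+s'a'+t(b+r)=1.$$ Then $f_1=e_1\otimes e_1'$ and $f_2=s\,e_1\otimes e_2'+s'\,e_2\otimes e_1'+t\,e_2\otimes e_2'$ form an $R$-basis of $I\otimes_S I'$, and $\alpha+a(rs-ct),\,f_1,\,f_2$ is a good frame for $S$ and $I\otimes_S I'$, yielding $$Q''\simeq[\,aa',\ b-2a(ct-rs),\ cs'+(sb+ct)(c't+rs')+as(cs'+c's)\,],$$ where $Q''$ is the binary quadratic form associated with $I\otimes_S I'$.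
   Context: A quadratic $R$-algebra $S$ is an $R$-algebra locally free of rank $2$ as an $R$-module. An $S$-module $I$ that is free of rank $2$ over $R$ is pseudoregular if for all $\gamma\in S$ the characteristic polynomials over $R$ of multiplication by $\gamma$ on $S$ and on $I$ agree. A good frame $\alpha,e_1,e_2$ for $S$ and $I$ consists of $\alpha\in S$ such that $1,\alpha$ is an $R$-basis of $S$, and an $R$-basis $e_1,e_2$ of $I$, such that $\alpha e_2\in Re_1$. For a pseudoregular $I$ with good frame and $\alpha e_1=be_1-ae_2$, $\alpha e_2=ce_1$, one has $\alpha^2-b\alpha+ac=0$, and the associated (norm) binary quadratic form in this frame is $[a,b,c]$, i.e. $Q(x_1e_1+x_2e_2)=ax_1^2+bx_1x_2+cx_2^2$, where $\alpha x\wedge x=Q(x)\,(e_1\wedge e_2)$. The relation $\alpha'=\alpha+r$ gives $b'=b+2r$ and $a'c'=ac+br+r^2$. The form $Q''$ is the form associated in this way to the pseudoregular $S$-module $I\otimes_S I'$ (well defined up to similarity). *)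

theory Defs
  imports "HOL-Algebra.UnivPoly" "HOL-Algebra.Free_Abelian_Groups" "HOL-Algebra.Chinese_Remainder"
begin

section \<open>Free modules of rank two and characteristic polynomials\<close>

definition is_basis2 :: "'r ring \<Rightarrow> ('r, 'm) module \<Rightarrow> 'm \<Rightarrow> 'm \<Rightarrow> bool" where
  "is_basis2 R M e1 e2 \<longleftrightarrow>
     e1 \<in> carrier M \<and> e2 \<in> carrier M \<and>
     (\<forall>x \<in> carrier M. \<exists>!p. p \<in> carrier R \<times> carrier R \<and>
        x = (fst p \<odot>\<^bsub>M\<^esub> e1) \<oplus>\<^bsub>M\<^esub> (snd p \<odot>\<^bsub>M\<^esub> e2))"

definition free_rank2 :: "'r ring \<Rightarrow> ('r, 'm) module \<Rightarrow> bool" where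
  "free_rank2 R M \<longleftrightarrow> module R M \<and> (\<exists>e1 e2. is_basis2 R M e1 e2)"

definition det2 :: "('a, 'k) ring_scheme \<Rightarrow> 'a \<Rightarrow> 'a \<Rightarrow> 'a \<Rightarrow> 'a \<Rightarrow> 'a" where
  "det2 P p q u v = (p \<otimes>\<^bsub>P\<^esub> v) \<ominus>\<^bsub>P\<^esub> (q \<otimes>\<^bsub>P\<^esub> u)"

text \<open>The determinant of \<open>X \<cdot> 1 - A\<close> over the polynomial ring, for the matrix \<open>A\<close> with rows
  \<open>(m11, m12)\<close> and \<open>(m21, m22)\<close>.\<close>

definition char_poly_matrix2 :: "'r ring \<Rightarrow> 'r \<Rightarrow> 'r \<Rightarrow> 'r \<Rightarrow> 'r \<Rightarrow> nat \<Rightarrow> 'r" where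
  "char_poly_matrix2 R m11 m12 m21 m22 =
     (let P = UP R; x = up_ring.monom P \<one>\<^bsub>R\<^esub> 1; k = (\<lambda>m. up_ring.monom P m 0) in
      det2 P (x \<ominus>\<^bsub>P\<^esub> k m11) (\<ominus>\<^bsub>P\<^esub> k m12) (\<ominus>\<^bsub>P\<^esub> k m21) (x \<ominus>\<^bsub>P\<^esub> k m22))"

text \<open>The columns of the matrix of \<open>\<phi>\<close> are the coordinates of the images of the basis vectors.
  The lemma \<open>char_poly2_eq\<close> below shows that the definite description
  is independent of the basis.\<close>

definition char_poly2 :: "'r ring \<Rightarrow> ('r, 'm) module \<Rightarrow> ('m \<Rightarrow> 'm) \<Rightarrow> nat \<Rightarrow> 'r" where
  "char_poly2 R M \<phi> = (THE p. \<exists>e1 e2 m11 m12 m21 m22.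
     is_basis2 R M e1 e2 \<and> {m11, m12, m21, m22} \<subseteq> carrier R \<and>
     \<phi> e1 = (m11 \<odot>\<^bsub>M\<^esub> e1) \<oplus>\<^bsub>M\<^esub> (m21 \<odot>\<^bsub>M\<^esub> e2) \<and>
     \<phi> e2 = (m12 \<odot>\<^bsub>M\<^esub> e1) \<oplus>\<^bsub>M\<^esub> (m22 \<odot>\<^bsub>M\<^esub> e2) \<and>
     p = char_poly_matrix2 R m11 m12 m21 m22)"

lemma char_poly_matrix2_alt:
  assumes "cring R" and "{m11, m12, m21, m22} \<subseteq> carrier R"
  shows "char_poly_matrix2 R m11 m12 m21 m22 =
    (let P = UP R; x = up_ring.monom P \<one>\<^bsub>R\<^esub> 1 in
      ((x \<otimes>\<^bsub>P\<^esub> x) \<ominus>\<^bsub>P\<^esub> (up_ring.monom P (m11 \<oplus>\<^bsub>R\<^esub> m22) 0 \<otimes>\<^bsub>P\<^esub> x)) \<oplus>\<^bsub>P\<^esub>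
      up_ring.monom P (det2 R m11 m12 m21 m22) 0)"
proof -
  define P where "P = UP R"
  interpret UP_cring R P
    by (intro UP_cring.intro assms(1)) (simp add: P_def)
  have m: "m11 \<in> carrier R" "m12 \<in> carrier R" "m21 \<in> carrier R" "m22 \<in> carrier R"
    using assms(2) by auto
  let ?x = "up_ring.monom P \<one>\<^bsub>R\<^esub> 1"
  let ?k = "\<lambda>m. up_ring.monom P m 0"
  have c: "?x \<in> carrier P" "?k m11 \<in> carrier P" "?k m12 \<in> carrier P"
          "?k m21 \<in> carrier P" "?k m22 \<in> carrier P"
    using m by (auto intro!: monom_closed)
  have mm: "?k (u \<otimes>\<^bsub>R\<^esub> v) = ?k u \<otimes>\<^bsub>P\<^esub> ?k v" if "u \<in> carrier R" "v \<in> carrier R" for u v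
    using monom_mult[OF that, of 0 0] by simp
  have d: "?k (det2 R m11 m12 m21 m22) = (?k m11 \<otimes>\<^bsub>P\<^esub> ?k m22) \<ominus>\<^bsub>P\<^esub> (?k m12 \<otimes>\<^bsub>P\<^esub> ?k m21)"
    using m by (simp add: det2_def a_minus_def mm)
  have a: "?k (m11 \<oplus>\<^bsub>R\<^esub> m22) = ?k m11 \<oplus>\<^bsub>P\<^esub> ?k m22"
    using m by simp
  have gen: "(x \<ominus>\<^bsub>P\<^esub> p) \<otimes>\<^bsub>P\<^esub> (x \<ominus>\<^bsub>P\<^esub> v) \<ominus>\<^bsub>P\<^esub> (\<ominus>\<^bsub>P\<^esub> q) \<otimes>\<^bsub>P\<^esub> (\<ominus>\<^bsub>P\<^esub> u) =
     ((x \<otimes>\<^bsub>P\<^esub> x) \<ominus>\<^bsub>P\<^esub> ((p \<oplus>\<^bsub>P\<^esub> v) \<otimes>\<^bsub>P\<^esub> x)) \<oplus>\<^bsub>P\<^esub> ((p \<otimes>\<^bsub>P\<^esub> v) \<ominus>\<^bsub>P\<^esub> (q \<otimes>\<^bsub>P\<^esub> u))"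
    if "x \<in> carrier P" "p \<in> carrier P" "q \<in> carrier P" "u \<in> carrier P" "v \<in> carrier P" for x p q u v
    using that by algebra
  show ?thesis
    unfolding char_poly_matrix2_def Let_def P_def[symmetric] d a
    unfolding det2_def by (rule gen[OF c(1) c(2) c(3) c(4) c(5)])
qed

lemma (in cring) conj2_invariants:
  assumes car: "{a11, a12, a21, a22, b11, b12, b21, b22, p11, p12, p21, p22, q11, q12, q21, q22} \<subseteq> carrier R"
    and QP: "q11 \<otimes> p11 \<oplus> q12 \<otimes> p21 = \<one>" "q11 \<otimes> p12 \<oplus> q12 \<otimes> p22 = \<zero>"
            "q21 \<otimes> p11 \<oplus> q22 \<otimes> p21 = \<zero>" "q21 \<otimes> p12 \<oplus> q22 \<otimes> p22 = \<one>"
    and PQ: "p11 \<otimes> q11 \<oplus> p12 \<otimes> q21 = \<one>" "p11 \<otimes> q12 \<oplus> p12 \<otimes> q22 = \<zero>"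
            "p21 \<otimes> q11 \<oplus> p22 \<otimes> q21 = \<zero>" "p21 \<otimes> q12 \<oplus> p22 \<otimes> q22 = \<one>"
    and AP: "a11 \<otimes> p11 \<oplus> a12 \<otimes> p21 = p11 \<otimes> b11 \<oplus> p12 \<otimes> b21"
            "a11 \<otimes> p12 \<oplus> a12 \<otimes> p22 = p11 \<otimes> b12 \<oplus> p12 \<otimes> b22"
            "a21 \<otimes> p11 \<oplus> a22 \<otimes> p21 = p21 \<otimes> b11 \<oplus> p22 \<otimes> b21"
            "a21 \<otimes> p12 \<oplus> a22 \<otimes> p22 = p21 \<otimes> b12 \<oplus> p22 \<otimes> b22"
  shows "a11 \<oplus> a22 = b11 \<oplus> b22" and "det2 R a11 a12 a21 a22 = det2 R b11 b12 b21 b22"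
proof -
  have c: "a11 \<in> carrier R" "a12 \<in> carrier R" "a21 \<in> carrier R" "a22 \<in> carrier R"
     "b11 \<in> carrier R" "b12 \<in> carrier R" "b21 \<in> carrier R" "b22 \<in> carrier R"
     "p11 \<in> carrier R" "p12 \<in> carrier R" "p21 \<in> carrier R" "p22 \<in> carrier R"
     "q11 \<in> carrier R" "q12 \<in> carrier R" "q21 \<in> carrier R" "q22 \<in> carrier R"
    using car by auto
  have "a11 \<oplus> a22 = a11 \<otimes> (p11 \<otimes> q11 \<oplus> p12 \<otimes> q21) \<oplus> a12 \<otimes> (p21 \<otimes> q11 \<oplus> p22 \<otimes> q21)
      \<oplus> a21 \<otimes> (p11 \<otimes> q12 \<oplus> p12 \<otimes> q22) \<oplus> a22 \<otimes> (p21 \<otimes> q12 \<oplus> p22 \<otimes> q22)"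
    unfolding PQ using c by simp
  also have "\<dots> = q11 \<otimes> (a11 \<otimes> p11 \<oplus> a12 \<otimes> p21) \<oplus> q12 \<otimes> (a21 \<otimes> p11 \<oplus> a22 \<otimes> p21)
      \<oplus> q21 \<otimes> (a11 \<otimes> p12 \<oplus> a12 \<otimes> p22) \<oplus> q22 \<otimes> (a21 \<otimes> p12 \<oplus> a22 \<otimes> p22)"
    using c by algebra
  also have "\<dots> = (q11 \<otimes> p11 \<oplus> q12 \<otimes> p21) \<otimes> b11 \<oplus> (q11 \<otimes> p12 \<oplus> q12 \<otimes> p22) \<otimes> b21
      \<oplus> (q21 \<otimes> p11 \<oplus> q22 \<otimes> p21) \<otimes> b12 \<oplus> (q21 \<otimes> p12 \<oplus> q22 \<otimes> p22) \<otimes> b22"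
    unfolding AP using c by algebra
  also have "\<dots> = b11 \<oplus> b22"
    unfolding QP using c by simp
  finally show "a11 \<oplus> a22 = b11 \<oplus> b22" .
  have mult: "det2 R (x11 \<otimes> y11 \<oplus> x12 \<otimes> y21) (x11 \<otimes> y12 \<oplus> x12 \<otimes> y22)
                     (x21 \<otimes> y11 \<oplus> x22 \<otimes> y21) (x21 \<otimes> y12 \<oplus> x22 \<otimes> y22)
              = det2 R x11 x12 x21 x22 \<otimes> det2 R y11 y12 y21 y22"
    if "x11 \<in> carrier R" "x12 \<in> carrier R" "x21 \<in> carrier R" "x22 \<in> carrier R"
       "y11 \<in> carrier R" "y12 \<in> carrier R" "y21 \<in> carrier R" "y22 \<in> carrier R"
    for x11 x12 x21 x22 y11 y12 y21 y22
    unfolding det2_def using that by algebra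
  have dc: "det2 R w x y z \<in> carrier R"
    if "w \<in> carrier R" "x \<in> carrier R" "y \<in> carrier R" "z \<in> carrier R" for w x y z
    using that by (simp add: det2_def)
  let ?A = "det2 R a11 a12 a21 a22" and ?B = "det2 R b11 b12 b21 b22"
  let ?P = "det2 R p11 p12 p21 p22" and ?Q = "det2 R q11 q12 q21 q22"
  have dcs: "?A \<in> carrier R" "?B \<in> carrier R" "?P \<in> carrier R" "?Q \<in> carrier R"
    using c by (auto intro: dc)
  have QP1: "?Q \<otimes> ?P = \<one>"
  proof -
    have "?Q \<otimes> ?P = det2 R \<one> \<zero> \<zero> \<one>"
      using mult[of q11 q12 q21 q22 p11 p12 p21 p22] c by (simp add: QP)
    then show ?thesis by (simp add: det2_def a_minus_def)
  qed
  have "?A \<otimes> ?P = ?P \<otimes> ?B"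
    using mult[of a11 a12 a21 a22 p11 p12 p21 p22] mult[of p11 p12 p21 p22 b11 b12 b21 b22] c
    by (simp add: AP)
  then have "?Q \<otimes> ?P \<otimes> ?A = ?Q \<otimes> ?P \<otimes> ?B"
    using dcs by (metis m_assoc m_comm)
  then show "?A = ?B"
    using dcs by (simp add: QP1)
qed

lemma is_basis2_unique:
  assumes "is_basis2 R M e1 e2" "module R M"
    and "x \<in> carrier R" "y \<in> carrier R" "x' \<in> carrier R" "y' \<in> carrier R"
    and "(x \<odot>\<^bsub>M\<^esub> e1) \<oplus>\<^bsub>M\<^esub> (y \<odot>\<^bsub>M\<^esub> e2) = (x' \<odot>\<^bsub>M\<^esub> e1) \<oplus>\<^bsub>M\<^esub> (y' \<odot>\<^bsub>M\<^esub> e2)"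
  shows "x = x'" and "y = y'"
proof -
  interpret module R M by fact
  have "(x \<odot>\<^bsub>M\<^esub> e1) \<oplus>\<^bsub>M\<^esub> (y \<odot>\<^bsub>M\<^esub> e2) \<in> carrier M"
    using assms by (auto simp: is_basis2_def)
  then have "\<exists>!p. p \<in> carrier R \<times> carrier R \<and>
      (x \<odot>\<^bsub>M\<^esub> e1) \<oplus>\<^bsub>M\<^esub> (y \<odot>\<^bsub>M\<^esub> e2) = (fst p \<odot>\<^bsub>M\<^esub> e1) \<oplus>\<^bsub>M\<^esub> (snd p \<odot>\<^bsub>M\<^esub> e2)"
    using assms(1) unfolding is_basis2_def by blast
  then have "(x, y) = (x', y')"
    by (rule ex1E) (use assms in \<open>metis (mono_tags, lifting) SigmaI fst_conv snd_conv\<close>)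
  then show "x = x'" "y = y'" by auto
qed

lemma is_basis2_coords:
  assumes "is_basis2 R M e1 e2" "z \<in> carrier M"
  obtains x y where "x \<in> carrier R" "y \<in> carrier R"
    "z = (x \<odot>\<^bsub>M\<^esub> e1) \<oplus>\<^bsub>M\<^esub> (y \<odot>\<^bsub>M\<^esub> e2)"
proof -
  obtain p where "p \<in> carrier R \<times> carrier R" "z = (fst p \<odot>\<^bsub>M\<^esub> e1) \<oplus>\<^bsub>M\<^esub> (snd p \<odot>\<^bsub>M\<^esub> e2)"
    using assms unfolding is_basis2_def by blast
  then show ?thesis using that[of "fst p" "snd p"] by auto
qed

lemma (in module) lin_comb2:
  assumes "{x, y, m11, m12, m21, m22} \<subseteq> carrier R" "e1 \<in> carrier M" "e2 \<in> carrier M"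
  shows "(x \<odot>\<^bsub>M\<^esub> ((m11 \<odot>\<^bsub>M\<^esub> e1) \<oplus>\<^bsub>M\<^esub> (m21 \<odot>\<^bsub>M\<^esub> e2))) \<oplus>\<^bsub>M\<^esub> (y \<odot>\<^bsub>M\<^esub> ((m12 \<odot>\<^bsub>M\<^esub> e1) \<oplus>\<^bsub>M\<^esub> (m22 \<odot>\<^bsub>M\<^esub> e2)))
     = ((m11 \<otimes> x \<oplus> m12 \<otimes> y) \<odot>\<^bsub>M\<^esub> e1) \<oplus>\<^bsub>M\<^esub> ((m21 \<otimes> x \<oplus> m22 \<otimes> y) \<odot>\<^bsub>M\<^esub> e2)"
  using assms by (simp add: smult_r_distr smult_l_distr smult_assoc1[symmetric] m_comm M.add.m_ac)

lemma char_poly_matrix2_unique: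
  fixes R (structure)
  assumes M: "module R M"
    and add: "\<And>x y. x \<in> carrier M \<Longrightarrow> y \<in> carrier M \<Longrightarrow> \<phi> (x \<oplus>\<^bsub>M\<^esub> y) = \<phi> x \<oplus>\<^bsub>M\<^esub> \<phi> y"
    and smult: "\<And>r x. r \<in> carrier R \<Longrightarrow> x \<in> carrier M \<Longrightarrow> \<phi> (r \<odot>\<^bsub>M\<^esub> x) = r \<odot>\<^bsub>M\<^esub> \<phi> x"
    and e: "is_basis2 R M e1 e2" and a: "{a11, a12, a21, a22} \<subseteq> carrier R"
    and phi_e: "\<phi> e1 = (a11 \<odot>\<^bsub>M\<^esub> e1) \<oplus>\<^bsub>M\<^esub> (a21 \<odot>\<^bsub>M\<^esub> e2)"
               "\<phi> e2 = (a12 \<odot>\<^bsub>M\<^esub> e1) \<oplus>\<^bsub>M\<^esub> (a22 \<odot>\<^bsub>M\<^esub> e2)"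
    and g: "is_basis2 R M g1 g2" and b: "{b11, b12, b21, b22} \<subseteq> carrier R"
    and phi_g: "\<phi> g1 = (b11 \<odot>\<^bsub>M\<^esub> g1) \<oplus>\<^bsub>M\<^esub> (b21 \<odot>\<^bsub>M\<^esub> g2)"
               "\<phi> g2 = (b12 \<odot>\<^bsub>M\<^esub> g1) \<oplus>\<^bsub>M\<^esub> (b22 \<odot>\<^bsub>M\<^esub> g2)"
  shows "char_poly_matrix2 R a11 a12 a21 a22 = char_poly_matrix2 R b11 b12 b21 b22"
proof -
  interpret module R M by fact
  have ec: "e1 \<in> carrier M" "e2 \<in> carrier M" and gc: "g1 \<in> carrier M" "g2 \<in> carrier M"
    using e g by (auto simp: is_basis2_def)
  obtain p11 p21 where p1: "p11 \<in> carrier R" "p21 \<in> carrier R" "g1 = (p11 \<odot>\<^bsub>M\<^esub> e1) \<oplus>\<^bsub>M\<^esub> (p21 \<odot>\<^bsub>M\<^esub> e2)"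
    by (rule is_basis2_coords[OF e gc(1)])
  obtain p12 p22 where p2: "p12 \<in> carrier R" "p22 \<in> carrier R" "g2 = (p12 \<odot>\<^bsub>M\<^esub> e1) \<oplus>\<^bsub>M\<^esub> (p22 \<odot>\<^bsub>M\<^esub> e2)"
    by (rule is_basis2_coords[OF e gc(2)])
  obtain q11 q21 where q1: "q11 \<in> carrier R" "q21 \<in> carrier R" "e1 = (q11 \<odot>\<^bsub>M\<^esub> g1) \<oplus>\<^bsub>M\<^esub> (q21 \<odot>\<^bsub>M\<^esub> g2)"
    by (rule is_basis2_coords[OF g ec(1)])
  obtain q12 q22 where q2: "q12 \<in> carrier R" "q22 \<in> carrier R" "e2 = (q12 \<odot>\<^bsub>M\<^esub> g1) \<oplus>\<^bsub>M\<^esub> (q22 \<odot>\<^bsub>M\<^esub> g2)"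
    by (rule is_basis2_coords[OF g ec(2)])
  note cR = p1(1,2) p2(1,2) q1(1,2) q2(1,2)
  have abR: "a11 \<in> carrier R" "a12 \<in> carrier R" "a21 \<in> carrier R" "a22 \<in> carrier R"
     "b11 \<in> carrier R" "b12 \<in> carrier R" "b21 \<in> carrier R" "b22 \<in> carrier R"
    using a b by auto
  have lin: "\<phi> ((x \<odot>\<^bsub>M\<^esub> u) \<oplus>\<^bsub>M\<^esub> (y \<odot>\<^bsub>M\<^esub> v)) = (x \<odot>\<^bsub>M\<^esub> \<phi> u) \<oplus>\<^bsub>M\<^esub> (y \<odot>\<^bsub>M\<^esub> \<phi> v)"
    if "x \<in> carrier R" "y \<in> carrier R" "u \<in> carrier M" "v \<in> carrier M" for x y u v
    using that by (simp add: add smult)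
  have unit: "u = (\<one> \<odot>\<^bsub>M\<^esub> u) \<oplus>\<^bsub>M\<^esub> (\<zero> \<odot>\<^bsub>M\<^esub> v)" "v = (\<zero> \<odot>\<^bsub>M\<^esub> u) \<oplus>\<^bsub>M\<^esub> (\<one> \<odot>\<^bsub>M\<^esub> v)"
    if "u \<in> carrier M" "v \<in> carrier M" for u v
    using that by simp_all
  have g1e: "(\<one> \<odot>\<^bsub>M\<^esub> g1) \<oplus>\<^bsub>M\<^esub> (\<zero> \<odot>\<^bsub>M\<^esub> g2)
      = ((q11 \<otimes> p11 \<oplus> q12 \<otimes> p21) \<odot>\<^bsub>M\<^esub> g1) \<oplus>\<^bsub>M\<^esub> ((q21 \<otimes> p11 \<oplus> q22 \<otimes> p21) \<odot>\<^bsub>M\<^esub> g2)"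
    unfolding unit(1)[OF gc, symmetric]
    using p1(3) lin_comb2[of p11 p21 q11 q12 q21 q22 g1 g2] q1(3) q2(3) cR gc by simp
  have g2e: "(\<zero> \<odot>\<^bsub>M\<^esub> g1) \<oplus>\<^bsub>M\<^esub> (\<one> \<odot>\<^bsub>M\<^esub> g2)
      = ((q11 \<otimes> p12 \<oplus> q12 \<otimes> p22) \<odot>\<^bsub>M\<^esub> g1) \<oplus>\<^bsub>M\<^esub> ((q21 \<otimes> p12 \<oplus> q22 \<otimes> p22) \<odot>\<^bsub>M\<^esub> g2)"
    unfolding unit(2)[OF gc, symmetric]
    using p2(3) lin_comb2[of p12 p22 q11 q12 q21 q22 g1 g2] q1(3) q2(3) cR gc by simp
  have e1g: "(\<one> \<odot>\<^bsub>M\<^esub> e1) \<oplus>\<^bsub>M\<^esub> (\<zero> \<odot>\<^bsub>M\<^esub> e2)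
      = ((p11 \<otimes> q11 \<oplus> p12 \<otimes> q21) \<odot>\<^bsub>M\<^esub> e1) \<oplus>\<^bsub>M\<^esub> ((p21 \<otimes> q11 \<oplus> p22 \<otimes> q21) \<odot>\<^bsub>M\<^esub> e2)"
    unfolding unit(1)[OF ec, symmetric]
    using q1(3) lin_comb2[of q11 q21 p11 p12 p21 p22 e1 e2] p1(3) p2(3) cR ec by simp
  have e2g: "(\<zero> \<odot>\<^bsub>M\<^esub> e1) \<oplus>\<^bsub>M\<^esub> (\<one> \<odot>\<^bsub>M\<^esub> e2)
      = ((p11 \<otimes> q12 \<oplus> p12 \<otimes> q22) \<odot>\<^bsub>M\<^esub> e1) \<oplus>\<^bsub>M\<^esub> ((p21 \<otimes> q12 \<oplus> p22 \<otimes> q22) \<odot>\<^bsub>M\<^esub> e2)"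
    unfolding unit(2)[OF ec, symmetric]
    using q2(3) lin_comb2[of q12 q22 p11 p12 p21 p22 e1 e2] p1(3) p2(3) cR ec by simp
  have pg1: "((a11 \<otimes> p11 \<oplus> a12 \<otimes> p21) \<odot>\<^bsub>M\<^esub> e1) \<oplus>\<^bsub>M\<^esub> ((a21 \<otimes> p11 \<oplus> a22 \<otimes> p21) \<odot>\<^bsub>M\<^esub> e2)
      = ((p11 \<otimes> b11 \<oplus> p12 \<otimes> b21) \<odot>\<^bsub>M\<^esub> e1) \<oplus>\<^bsub>M\<^esub> ((p21 \<otimes> b11 \<oplus> p22 \<otimes> b21) \<odot>\<^bsub>M\<^esub> e2)"
    using lin_comb2[of p11 p21 a11 a12 a21 a22 e1 e2] lin_comb2[of b11 b21 p11 p12 p21 p22 e1 e2]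
      lin[of p11 p21 e1 e2] phi_e phi_g(1) p1(3) p2(3) cR abR ec by simp
  have pg2: "((a11 \<otimes> p12 \<oplus> a12 \<otimes> p22) \<odot>\<^bsub>M\<^esub> e1) \<oplus>\<^bsub>M\<^esub> ((a21 \<otimes> p12 \<oplus> a22 \<otimes> p22) \<odot>\<^bsub>M\<^esub> e2)
      = ((p11 \<otimes> b12 \<oplus> p12 \<otimes> b22) \<odot>\<^bsub>M\<^esub> e1) \<oplus>\<^bsub>M\<^esub> ((p21 \<otimes> b12 \<oplus> p22 \<otimes> b22) \<odot>\<^bsub>M\<^esub> e2)"
    using lin_comb2[of p12 p22 a11 a12 a21 a22 e1 e2] lin_comb2[of b12 b22 p11 p12 p21 p22 e1 e2]
      lin[of p12 p22 e1 e2] phi_e phi_g(2) p1(3) p2(3) cR abR ec by simp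
  note ue = is_basis2_unique[OF e M _ _ _ _] and ug = is_basis2_unique[OF g M _ _ _ _]
  have inv: "a11 \<oplus> a22 = b11 \<oplus> b22" "det2 R a11 a12 a21 a22 = det2 R b11 b12 b21 b22"
    by (rule conj2_invariants[of a11 a12 a21 a22 b11 b12 b21 b22 p11 p12 p21 p22 q11 q12 q21 q22];
        (use ue[OF _ _ _ _ e1g] ue[OF _ _ _ _ e2g] ug[OF _ _ _ _ g1e] ug[OF _ _ _ _ g2e]
           ue[OF _ _ _ _ pg1] ue[OF _ _ _ _ pg2] cR abR in \<open>simp; fail\<close>))+
  show ?thesis
    by (simp only: char_poly_matrix2_alt[OF R.is_cring a] char_poly_matrix2_alt[OF R.is_cring b] inv)
qed

lemma char_poly2_eq:
  assumes "module R M"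
    and "\<And>x y. x \<in> carrier M \<Longrightarrow> y \<in> carrier M \<Longrightarrow> \<phi> (x \<oplus>\<^bsub>M\<^esub> y) = \<phi> x \<oplus>\<^bsub>M\<^esub> \<phi> y"
    and "\<And>r x. r \<in> carrier R \<Longrightarrow> x \<in> carrier M \<Longrightarrow> \<phi> (r \<odot>\<^bsub>M\<^esub> x) = r \<odot>\<^bsub>M\<^esub> \<phi> x"
    and "is_basis2 R M e1 e2" and "{m11, m12, m21, m22} \<subseteq> carrier R"
    and "\<phi> e1 = (m11 \<odot>\<^bsub>M\<^esub> e1) \<oplus>\<^bsub>M\<^esub> (m21 \<odot>\<^bsub>M\<^esub> e2)"
    and "\<phi> e2 = (m12 \<odot>\<^bsub>M\<^esub> e1) \<oplus>\<^bsub>M\<^esub> (m22 \<odot>\<^bsub>M\<^esub> e2)"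
  shows "char_poly2 R M \<phi> = char_poly_matrix2 R m11 m12 m21 m22"
  unfolding char_poly2_def
proof (rule the_equality, goal_cases)
  case 1
  then show ?case using assms(4-7) by blast
next
  case (2 p)
  then obtain g1 g2 n11 n12 n21 n22 where *: "is_basis2 R M g1 g2" "{n11, n12, n21, n22} \<subseteq> carrier R"
     "\<phi> g1 = (n11 \<odot>\<^bsub>M\<^esub> g1) \<oplus>\<^bsub>M\<^esub> (n21 \<odot>\<^bsub>M\<^esub> g2)"
     "\<phi> g2 = (n12 \<odot>\<^bsub>M\<^esub> g1) \<oplus>\<^bsub>M\<^esub> (n22 \<odot>\<^bsub>M\<^esub> g2)"
     "p = char_poly_matrix2 R n11 n12 n21 n22" by blast
  show ?case
    unfolding *(5) by (rule char_poly_matrix2_unique[OF assms(1-3) *(1-4) assms(4-7)])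
qed

section \<open>Quadratic algebras, pseudoregular modules and good frames\<close>

definition free_quadratic_algebra :: "'r ring \<Rightarrow> ('r, 's) module \<Rightarrow> bool" where
  "free_quadratic_algebra R S \<longleftrightarrow> algebra R S \<and> free_rank2 R S"

definition restrict_scalars ::
    "'r ring \<Rightarrow> ('r, 's) module \<Rightarrow> ('s, 'i) module \<Rightarrow> ('r, 'i) module" where
  "restrict_scalars R S I =
     \<lparr>carrier = carrier I, monoid.mult = monoid.mult I, monoid.one = monoid.one I,
      ring.zero = ring.zero I, ring.add = ring.add I,
      smult = (\<lambda>r x. (r \<odot>\<^bsub>S\<^esub> \<one>\<^bsub>S\<^esub>) \<odot>\<^bsub>I\<^esub> x)\<rparr>"

definition pseudoregular ::
    "'r ring \<Rightarrow> ('r, 's) module \<Rightarrow> ('s, 'i) module \<Rightarrow> bool" where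
  "pseudoregular R S I \<longleftrightarrow>
     module S I \<and> free_rank2 R (restrict_scalars R S I) \<and>
     (\<forall>\<gamma> \<in> carrier S.
        char_poly2 R S (\<lambda>x. \<gamma> \<otimes>\<^bsub>S\<^esub> x) =
        char_poly2 R (restrict_scalars R S I) (\<lambda>x. \<gamma> \<odot>\<^bsub>I\<^esub> x))"

definition good_frame ::
    "'r ring \<Rightarrow> ('r, 's) module \<Rightarrow> ('s, 'i) module \<Rightarrow> 's \<Rightarrow> 'i \<Rightarrow> 'i \<Rightarrow> bool" where
  "good_frame R S I \<alpha> e1 e2 \<longleftrightarrow>
     is_basis2 R S \<one>\<^bsub>S\<^esub> \<alpha> \<and> is_basis2 R (restrict_scalars R S I) e1 e2 \<and>
     (\<exists>c \<in> carrier R. \<alpha> \<odot>\<^bsub>I\<^esub> e2 = c \<odot>\<^bsub>restrict_scalars R S I\<^esub> e1)"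

section \<open>Tensor product and exterior square\<close>

text \<open>Both are quotients of a free abelian group on a set \<open>B\<close> of pairs by the subgroup
  generated by a set \<open>W\<close> of relations, with scalars acting through an action \<open>act\<close> on the
  generators. The fields \<open>mult\<close> and \<open>one\<close> of the record play no role for modules.\<close>

definition relation_subgroup ::
    "'x set \<Rightarrow> ('x \<Rightarrow>\<^sub>0 int) set \<Rightarrow> ('x \<Rightarrow>\<^sub>0 int) set" where
  "relation_subgroup B W = generate (free_Abelian_group B) W"

definition presented_elem ::
    "'x set \<Rightarrow> ('x \<Rightarrow>\<^sub>0 int) set \<Rightarrow> ('x \<Rightarrow>\<^sub>0 int) \<Rightarrow> ('x \<Rightarrow>\<^sub>0 int) set" where
  "presented_elem B W c = relation_subgroup B W #>\<^bsub>free_Abelian_group B\<^esub> c"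

definition presented_module ::
    "'x set \<Rightarrow> ('x \<Rightarrow>\<^sub>0 int) set \<Rightarrow> ('a \<Rightarrow> 'x \<Rightarrow> 'x) \<Rightarrow> ('a, ('x \<Rightarrow>\<^sub>0 int) set) module" where
  "presented_module B W act =
     (let Q = free_Abelian_group B Mod relation_subgroup B W in
      \<lparr>carrier = carrier Q, monoid.mult = undefined, monoid.one = undefined,
       ring.zero = \<one>\<^bsub>Q\<^esub>, ring.add = monoid.mult Q,
       smult = (\<lambda>a C. \<Union>c \<in> C. presented_elem B W (frag_extend (\<lambda>x. frag_of (act a x)) c))\<rparr>)"

definition tensor_relations ::
    "('a, 'k) ring_scheme \<Rightarrow> ('a, 'm) module \<Rightarrow> ('a, 'n) module \<Rightarrow> ('m \<times> 'n \<Rightarrow>\<^sub>0 int) set" where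
  "tensor_relations A M N =
     {frag_of (x \<oplus>\<^bsub>M\<^esub> x', y) - frag_of (x, y) - frag_of (x', y) | x x' y.
        x \<in> carrier M \<and> x' \<in> carrier M \<and> y \<in> carrier N} \<union>
     {frag_of (x, y \<oplus>\<^bsub>N\<^esub> y') - frag_of (x, y) - frag_of (x, y') | x y y'.
        x \<in> carrier M \<and> y \<in> carrier N \<and> y' \<in> carrier N} \<union>
     {frag_of (a \<odot>\<^bsub>M\<^esub> x, y) - frag_of (x, a \<odot>\<^bsub>N\<^esub> y) | a x y.
        a \<in> carrier A \<and> x \<in> carrier M \<and> y \<in> carrier N}"

definition tensor_product ::
    "('a, 'k) ring_scheme \<Rightarrow> ('a, 'm) module \<Rightarrow> ('a, 'n) module \<Rightarrow> ('a, ('m \<times> 'n \<Rightarrow>\<^sub>0 int) set) module" where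
  "tensor_product A M N =
     presented_module (carrier M \<times> carrier N) (tensor_relations A M N)
       (\<lambda>a (x, y). (a \<odot>\<^bsub>M\<^esub> x, y))"

definition tensor_elem ::
    "('a, 'k) ring_scheme \<Rightarrow> ('a, 'm) module \<Rightarrow> ('a, 'n) module \<Rightarrow> 'm \<Rightarrow> 'n \<Rightarrow> ('m \<times> 'n \<Rightarrow>\<^sub>0 int) set" where
  "tensor_elem A M N x y =
     presented_elem (carrier M \<times> carrier N) (tensor_relations A M N) (frag_of (x, y))"

text \<open>The submodule of \<open>M \<otimes> M\<close> generated by the \<open>x \<otimes> x\<close> is, as a
  group, generated by the \<open>a (x \<otimes> x) = (a x) \<otimes> x\<close>.\<close>

definition ext_square_relations ::
    "('a, 'k) ring_scheme \<Rightarrow> ('a, 'm) module \<Rightarrow> ('m \<times> 'm \<Rightarrow>\<^sub>0 int) set" where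
  "ext_square_relations A M =
     tensor_relations A M M \<union>
     {frag_of (a \<odot>\<^bsub>M\<^esub> x, x) | a x. a \<in> carrier A \<and> x \<in> carrier M}"

definition ext_square ::
    "('a, 'k) ring_scheme \<Rightarrow> ('a, 'm) module \<Rightarrow> ('a, ('m \<times> 'm \<Rightarrow>\<^sub>0 int) set) module" where
  "ext_square A M =
     presented_module (carrier M \<times> carrier M) (ext_square_relations A M)
       (\<lambda>a (x, y). (a \<odot>\<^bsub>M\<^esub> x, y))"

definition wedge ::
    "('a, 'k) ring_scheme \<Rightarrow> ('a, 'm) module \<Rightarrow> 'm \<Rightarrow> 'm \<Rightarrow> ('m \<times> 'm \<Rightarrow>\<^sub>0 int) set" where
  "wedge A M x y =
     presented_elem (carrier M \<times> carrier M) (ext_square_relations A M) (frag_of (x, y))"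

section \<open>Binary quadratic forms\<close>

definition binary_form :: "'r ring \<Rightarrow> 'r \<Rightarrow> 'r \<Rightarrow> 'r \<Rightarrow> 'r \<times> 'r \<Rightarrow> 'r" where
  "binary_form R a b c = (\<lambda>(x1, x2).
     (a \<otimes>\<^bsub>R\<^esub> (x1 \<otimes>\<^bsub>R\<^esub> x1)) \<oplus>\<^bsub>R\<^esub> (b \<otimes>\<^bsub>R\<^esub> (x1 \<otimes>\<^bsub>R\<^esub> x2))
       \<oplus>\<^bsub>R\<^esub> (c \<otimes>\<^bsub>R\<^esub> (x2 \<otimes>\<^bsub>R\<^esub> x2)))"

definition std_module2 :: "'r ring \<Rightarrow> ('r, 'r \<times> 'r) module" where
  "std_module2 R = ring.extend (RDirProd R R)
     (module.fields (\<lambda>r (x1, x2). (r \<otimes>\<^bsub>R\<^esub> x1, r \<otimes>\<^bsub>R\<^esub> x2)))"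

lemma std_module2_simps:
  "carrier (std_module2 R) = carrier R \<times> carrier R"
  "(x1,x2) \<oplus>\<^bsub>std_module2 R\<^esub> (y1,y2) = (x1 \<oplus>\<^bsub>R\<^esub> y1, x2 \<oplus>\<^bsub>R\<^esub> y2)"
  "r \<odot>\<^bsub>std_module2 R\<^esub> (y1,y2) = (r \<otimes>\<^bsub>R\<^esub> y1, r \<otimes>\<^bsub>R\<^esub> y2)"
  by (auto simp: std_module2_def ring.defs module.defs RDirProd_def monoid.defs DirProd_def)

definition module_iso ::
    "'r ring \<Rightarrow> ('r, 'm) module \<Rightarrow> ('r, 'n) module \<Rightarrow> ('m \<Rightarrow> 'n) set" where
  "module_iso R M N =
     {\<phi>. bij_betw \<phi> (carrier M) (carrier N) \<and>
         (\<forall>x \<in> carrier M. \<forall>y \<in> carrier M. \<phi> (x \<oplus>\<^bsub>M\<^esub> y) = \<phi> x \<oplus>\<^bsub>N\<^esub> \<phi> y) \<and>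
         (\<forall>r \<in> carrier R. \<forall>x \<in> carrier M. \<phi> (r \<odot>\<^bsub>M\<^esub> x) = r \<odot>\<^bsub>N\<^esub> \<phi> x)}"

text \<open>Similarity of the forms \<open>Q\<close> on \<open>M\<close> and \<open>Q'\<close> on \<open>N\<close>: isometry up to an
  automorphism of the value module \<open>R\<close>, that is, up to a unit.\<close>

definition similar_forms ::
    "'r ring \<Rightarrow> ('r, 'm) module \<Rightarrow> ('m \<Rightarrow> 'r) \<Rightarrow> ('r, 'n) module \<Rightarrow> ('n \<Rightarrow> 'r) \<Rightarrow> bool" where
  "similar_forms R M Q N Q' \<longleftrightarrow>
     (\<exists>\<phi> \<in> module_iso R M N. \<exists>u \<in> Units R. \<forall>x \<in> carrier M. Q' (\<phi> x) = u \<otimes>\<^bsub>R\<^esub> Q x)"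

definition form_in_frame ::
    "'r ring \<Rightarrow> ('r, 's) module \<Rightarrow> ('s, 'i) module \<Rightarrow> 's \<Rightarrow> 'i \<Rightarrow> 'i \<Rightarrow> ('i \<Rightarrow> 'r) \<Rightarrow> bool" where
  "form_in_frame R S I \<alpha> e1 e2 Q \<longleftrightarrow>
     (let M = restrict_scalars R S I in
      Q \<in> carrier I \<rightarrow> carrier R \<and>
      (\<forall>x \<in> carrier I. wedge R M (\<alpha> \<odot>\<^bsub>I\<^esub> x) x = Q x \<odot>\<^bsub>ext_square R M\<^esub> wedge R M e1 e2))"

definition associated_form ::
    "'r ring \<Rightarrow> ('r, 's) module \<Rightarrow> ('s, 'i) module \<Rightarrow> ('i \<Rightarrow> 'r) \<Rightarrow> bool" where
  "associated_form R S I Q \<longleftrightarrow>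
     pseudoregular R S I \<and>
     (\<exists>\<alpha> e1 e2. good_frame R S I \<alpha> e1 e2 \<and> form_in_frame R S I \<alpha> e1 e2 Q)"

end

theory Submission
  imports Defs
begin

text \<open>Put \<open>d = b + r\<close>, \<open>\<alpha> e1' = d e1' - a' e2'\<close> and \<open>\<alpha> e2' = c' e1' - r e2'\<close>. Moving \<open>\<alpha>\<close> across
  \<open>e1 \<otimes> e1'\<close>, \<open>e1 \<otimes> e2'\<close> and \<open>e2 \<otimes> e1'\<close> gives three relations between the four tensors
  \<open>e\<^sub>i \<otimes> e\<^sub>j'\<close>. Multiplied by suitable ones of \<open>\<plusminus>s\<close>, \<open>\<plusminus>s'\<close>, \<open>t\<close> and combined with \<open>s a + s' a' + t d = 1\<close>,
  they express the tensors \<open>e1 \<otimes> e1'\<close>, \<open>e1 \<otimes> e2'\<close>, \<open>e2 \<otimes> e1'\<close>, \<open>e2 \<otimes> e2'\<close> through \<open>f1\<close> and \<open>f2\<close>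
  with coordinates \<open>(1, 0)\<close>, \<open>(r s' + c' t, a)\<close>, \<open>(c t - r s, a')\<close> and \<open>(-(s c' + s' c), d)\<close>.
  The bilinear maps with these values are \<open>S\<close>-balanced, because pseudoregularity forces
  \<open>a' c' = a c + b r + r\<^sup>2\<close>; they therefore factor through the tensor product, where they separate
  \<open>f1\<close> and \<open>f2\<close>. The action of \<open>\<alpha>\<close> is read off from the coordinates. Two forms associated with the
  same module differ by a unit, because a change of the frame multiplies the form by the leading
  coefficient of the new generator of \<open>S\<close> and divides it by the determinant of the change of basis.\<close>

section \<open>Modules presented by generators and relations\<close>

text \<open>Write \<open>d\<close> for \<open>b + r\<close>. Up to multiples of
  \<open>e1 \<otimes> e1'\<close>, the three relations are the Koszul relations of the row (a, a',
  d) on the other three tensors. Because s a + s' a' + t d = 1, contraction with (s, s', t) splits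
  that Koszul complex: this is where the multipliers come from, and the first coordinates r s' + c'
  t, c t - r s and -(s c' + s' c) are what the multiples of \<open>e1 \<otimes> e1'\<close> leave
  behind. The second coordinates (0, a, a', d) are the Koszul map to R. The obstacle is that the
  tensor product and the exterior square are bare quotients of free abelian groups. Computing inside
  them yields equalities only; independence needs maps out of them, which the universal property
  supplies merely as additive maps. For the exterior square the determinant of coordinates is such a
  map, and it permits cancelling \<open>e1 \<and> e2\<close>. Pseudoregularity is reduced to the one
  equation \<alpha>^2 = b \<alpha> - a c. For the tensor product this leaves a trace identity and
  the norm identity \<open>norm_eq\<close>. The shift a (r s - c t) is minus the second coordinate
  of \<alpha> f2, so that the shifted generator sends f2 into R f1.\<close>

locale presentation = cring A for A (structure) +
  fixes B :: "'x set" and W :: "('x \<Rightarrow>\<^sub>0 int) set" and act :: "'a \<Rightarrow> 'x \<Rightarrow> 'x"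
  assumes keys_relation: "w \<in> W \<Longrightarrow> Poly_Mapping.keys w \<subseteq> B"
    and act_closed: "a \<in> carrier A \<Longrightarrow> x \<in> B \<Longrightarrow> act a x \<in> B"
    and act_relation: "a \<in> carrier A \<Longrightarrow> w \<in> W \<Longrightarrow>
      frag_extend (\<lambda>x. frag_of (act a x)) w \<in> relation_subgroup B W"
    and act_add: "a \<in> carrier A \<Longrightarrow> b \<in> carrier A \<Longrightarrow> x \<in> B \<Longrightarrow>
      frag_of (act (a \<oplus> b) x) - frag_of (act a x) - frag_of (act b x) \<in> relation_subgroup B W"
    and act_mult: "a \<in> carrier A \<Longrightarrow> b \<in> carrier A \<Longrightarrow> x \<in> B \<Longrightarrow> act (a \<otimes> b) x = act a (act b x)"
    and act_one: "x \<in> B \<Longrightarrow> act \<one> x = x"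
begin

abbreviation "F \<equiv> carrier (free_Abelian_group B)"
abbreviation "Rel \<equiv> relation_subgroup B W"
abbreviation "cls \<equiv> presented_elem B W"
abbreviation "P \<equiv> presented_module B W act"
abbreviation "ext a \<equiv> frag_extend (\<lambda>x. frag_of (act a x))"

lemma subgroup_relation: "subgroup Rel (free_Abelian_group B)"
  unfolding relation_subgroup_def
  by (rule group.generate_is_subgroup) (use keys_relation in auto)

lemma normal_relation: "Rel \<lhd> free_Abelian_group B"
  by (rule comm_group.normal_iff_subgroup[THEN iffD2, OF abelian_free_Abelian_group subgroup_relation])

lemma relation_keys: "c \<in> Rel \<Longrightarrow> Poly_Mapping.keys c \<subseteq> B"
  using subgroup.mem_carrier[OF subgroup_relation] by simp

lemma relation_zero: "0 \<in> Rel"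
  using subgroup.one_closed[OF subgroup_relation] by simp

lemma relation_uminus: "c \<in> Rel \<Longrightarrow> - c \<in> Rel"
  using subgroup.m_inv_closed[OF subgroup_relation] relation_keys by simp

lemma relation_plus: "c \<in> Rel \<Longrightarrow> d \<in> Rel \<Longrightarrow> c + d \<in> Rel"
  using subgroup.m_closed[OF subgroup_relation] by simp

lemma relation_diff: "c \<in> Rel \<Longrightarrow> d \<in> Rel \<Longrightarrow> c - d \<in> Rel"
  using relation_plus[OF _ relation_uminus] by fastforce

lemma relation_incl: "w \<in> W \<Longrightarrow> w \<in> Rel"
  by (simp add: relation_subgroup_def generate.incl)

lemma cls_iff:
  assumes "Poly_Mapping.keys c \<subseteq> B"
  shows "d \<in> cls c \<longleftrightarrow> Poly_Mapping.keys d \<subseteq> B \<and> d - c \<in> Rel"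
proof -
  have "d \<in> cls c \<Longrightarrow> Poly_Mapping.keys d \<subseteq> B"
    using subgroup.elemrcos_carrier[OF subgroup_relation group_free_Abelian_group, of c d] assms
    by (simp add: presented_elem_def)
  then show ?thesis
    using subgroup.rcos_module[OF subgroup_relation group_free_Abelian_group, of c d] assms
    by (auto simp: presented_elem_def)
qed

lemma cls_eq_iff:
  assumes "Poly_Mapping.keys c \<subseteq> B" "Poly_Mapping.keys d \<subseteq> B"
  shows "cls c = cls d \<longleftrightarrow> c - d \<in> Rel"
proof
  assume "cls c = cls d"
  then show "c - d \<in> Rel"
    using cls_iff[OF assms(1), of c] cls_iff[OF assms(2), of c] assms by (simp add: relation_zero)
next
  assume "c - d \<in> Rel"
  then have "c \<in> cls d" using assms cls_iff by simp
  then show "cls c = cls d"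
    using group.repr_independence[OF group_free_Abelian_group _ _ subgroup_relation, of c d] assms
    by (simp add: presented_elem_def)
qed

lemma carrier_P: "carrier P = cls ` F"
  by (auto simp: presented_module_def FactGroup_def RCOSETS_def presented_elem_def)

lemma cls_closed: "Poly_Mapping.keys c \<subseteq> B \<Longrightarrow> cls c \<in> carrier P"
  by (auto simp: carrier_P)

lemma cls_add:
  assumes "Poly_Mapping.keys c \<subseteq> B" "Poly_Mapping.keys d \<subseteq> B"
  shows "cls c \<oplus>\<^bsub>P\<^esub> cls d = cls (c + d)"
  using normal.rcos_sum[OF normal_relation, of c d] assms
  by (simp add: presented_module_def Let_def FactGroup_def presented_elem_def)

lemma cls_zero: "\<zero>\<^bsub>P\<^esub> = cls 0"
proof -
  have "Rel #>\<^bsub>free_Abelian_group B\<^esub> \<one>\<^bsub>free_Abelian_group B\<^esub> = Rel"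
    by (intro group.coset_mult_one) (auto dest: relation_keys)
  then show ?thesis
    by (simp add: presented_module_def FactGroup_def presented_elem_def)
qed

lemma keys_ext: "a \<in> carrier A \<Longrightarrow> Poly_Mapping.keys c \<subseteq> B \<Longrightarrow> Poly_Mapping.keys (ext a c) \<subseteq> B"
  using keys_frag_extend[of "\<lambda>x. frag_of (act a x)" c] act_closed by fastforce

lemma ext_relation:
  assumes "a \<in> carrier A" "c \<in> Rel"
  shows "ext a c \<in> Rel"
proof -
  have "c \<in> generate (free_Abelian_group B) W"
    using assms(2) by (simp add: relation_subgroup_def)
  then show ?thesis
  proof induction
    case one
    then show ?case by (simp add: relation_zero)
  next
    case (incl h)
    then show ?case by (rule act_relation[OF assms(1)])
  next
    case (inv h)
    then show ?case
      using relation_uminus[OF act_relation[OF assms(1)]] keys_relation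
      by (simp add: frag_extend_minus)
  next
    case (eng h1 h2)
    then show ?case by (simp add: frag_extend_add relation_plus)
  qed
qed

text \<open>The scalar action on a coset is defined as a union over all its representatives. By
  \<open>ext_relation\<close> they all yield the same coset, so the union is that coset.\<close>

lemma cls_smult:
  assumes "a \<in> carrier A" "Poly_Mapping.keys c \<subseteq> B"
  shows "a \<odot>\<^bsub>P\<^esub> cls c = cls (ext a c)"
proof -
  have "cls (ext a d) = cls (ext a c)" if "d \<in> cls c" for d
    using that assms ext_relation[OF assms(1), of "d - c"]
    by (simp add: cls_iff cls_eq_iff keys_ext frag_extend_diff)
  moreover have "c \<in> cls c"
    using assms by (simp add: cls_iff relation_zero)
  ultimately have "(\<Union>d \<in> cls c. cls (ext a d)) = cls (ext a c)"
    by blast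
  then show ?thesis by (simp add: presented_module_def Let_def)
qed

lemma cls_of_smult:
  "a \<in> carrier A \<Longrightarrow> x \<in> B \<Longrightarrow> a \<odot>\<^bsub>P\<^esub> cls (frag_of x) = cls (frag_of (act a x))"
  by (simp add: cls_smult)

lemma abelian_group_P: "abelian_group P"
proof (rule abelian_groupI)
  note k = order_trans[OF keys_add]
  show "\<zero>\<^bsub>P\<^esub> \<in> carrier P"
    by (simp add: cls_zero cls_closed)
  fix x assume "x \<in> carrier P"
  then obtain c where c: "Poly_Mapping.keys c \<subseteq> B" "x = cls c"
    by (auto simp: carrier_P)
  then show "\<zero>\<^bsub>P\<^esub> \<oplus>\<^bsub>P\<^esub> x = x"
    by (simp add: cls_zero cls_add)
  have "cls (- c) \<oplus>\<^bsub>P\<^esub> x = \<zero>\<^bsub>P\<^esub>"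
    using c by (simp add: cls_zero cls_add)
  then show "\<exists>y\<in>carrier P. y \<oplus>\<^bsub>P\<^esub> x = \<zero>\<^bsub>P\<^esub>"
    using c by (intro bexI[of _ "cls (- c)"]) (auto intro!: cls_closed)
qed (auto simp: carrier_P cls_add add_ac order_trans[OF keys_add] intro!: imageI dest!: subsetD[OF keys_add])

lemma presented_module_module: "module A P"
proof (rule moduleI)
  show "cring A" by (rule is_cring)
  show "abelian_group P" by (rule abelian_group_P)
next
  fix a x assume "a \<in> carrier A" "x \<in> carrier P"
  then show "a \<odot>\<^bsub>P\<^esub> x \<in> carrier P"
    by (auto simp: carrier_P cls_smult subsetD[OF keys_ext] intro!: imageI)
next
  fix a b x assume a: "a \<in> carrier A" "b \<in> carrier A" and "x \<in> carrier P"
  then obtain c where c: "Poly_Mapping.keys c \<subseteq> B" "x = cls c"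
    by (auto simp: carrier_P)
  \<comment> \<open>Additivity in the scalar holds only modulo \<open>Rel\<close>, because
    \<open>act\<close> sends a generator to a single generator and never to a sum. The
    multiplicative law further down already holds in the free group.\<close>
  from c(1) have "ext (a \<oplus> b) c - ext a c - ext b c \<in> Rel"
  proof (induction c rule: free_Abelian_group_induct[consumes 1, case_names zero diff generator])
    case (diff x y)
    have "ext (a \<oplus> b) (x - y) - ext a (x - y) - ext b (x - y)
        = (ext (a \<oplus> b) x - ext a x - ext b x) - (ext (a \<oplus> b) y - ext a y - ext b y)"
      by (simp add: frag_extend_diff)
    then show ?case using relation_diff[OF diff(3,4)] by simp
  qed (use a act_add in \<open>auto simp: relation_zero\<close>)
  then show "(a \<oplus> b) \<odot>\<^bsub>P\<^esub> x = (a \<odot>\<^bsub>P\<^esub> x) \<oplus>\<^bsub>P\<^esub> (b \<odot>\<^bsub>P\<^esub> x)"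
    using a c by (simp add: cls_smult cls_add cls_eq_iff keys_ext order_trans[OF keys_add] diff_diff_eq)
  from c(1) have "ext (a \<otimes> b) c = ext a (ext b c)"
  proof (induction c rule: free_Abelian_group_induct[consumes 1, case_names zero diff generator])
  qed (use a act_mult in \<open>auto simp: frag_extend_diff\<close>)
  then show "(a \<otimes> b) \<odot>\<^bsub>P\<^esub> x = a \<odot>\<^bsub>P\<^esub> (b \<odot>\<^bsub>P\<^esub> x)"
    using a c by (simp add: cls_smult keys_ext)
next
  fix a x y assume "a \<in> carrier A" "x \<in> carrier P" "y \<in> carrier P"
  then show "a \<odot>\<^bsub>P\<^esub> (x \<oplus>\<^bsub>P\<^esub> y) = (a \<odot>\<^bsub>P\<^esub> x) \<oplus>\<^bsub>P\<^esub> (a \<odot>\<^bsub>P\<^esub> y)"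
    by (auto simp: carrier_P cls_smult cls_add keys_ext order_trans[OF keys_add] frag_extend_add)
next
  fix x assume "x \<in> carrier P"
  then obtain c where c: "Poly_Mapping.keys c \<subseteq> B" "x = cls c"
    by (auto simp: carrier_P)
  from c(1) have "ext \<one> c = c"
  proof (induction c rule: free_Abelian_group_induct[consumes 1, case_names zero diff generator])
  qed (use act_one in \<open>auto simp: frag_extend_diff\<close>)
  then show "\<one> \<odot>\<^bsub>P\<^esub> x = x"
    using c by (simp add: cls_smult)
qed

text \<open>Elements of the free abelian group are integer combinations of generators; a step for
  differences covers sums and negatives at once.\<close>

lemma presented_module_induct [consumes 1, case_names diff generator zero]:
  assumes "z \<in> carrier P"
    and "\<And>z w. z \<in> carrier P \<Longrightarrow> w \<in> carrier P \<Longrightarrow> Q z \<Longrightarrow> Q w \<Longrightarrow> Q (z \<ominus>\<^bsub>P\<^esub> w)"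
    and "\<And>x. x \<in> B \<Longrightarrow> Q (cls (frag_of x))"
    and "Q \<zero>\<^bsub>P\<^esub>"
  shows "Q z"
proof -
  interpret abelian_group P by (rule abelian_group_P)
  obtain c where c: "Poly_Mapping.keys c \<subseteq> B" "z = cls c"
    using assms(1) by (auto simp: carrier_P)
  from c(1) have "Q (cls c)"
  proof (induction c rule: free_Abelian_group_induct[consumes 1, case_names zero diff generator])
    case (diff x y)
    have k: "Poly_Mapping.keys (x - y) \<subseteq> B"
      using diff(1,2) keys_diff[of x y] by blast
    have "cls (x - y) \<oplus>\<^bsub>P\<^esub> cls y = cls x"
      using cls_add[OF k diff(2)] by simp
    then have "cls (x - y) = cls x \<ominus>\<^bsub>P\<^esub> cls y"
      using diff(1,2) k by (metis a_minus_def cls_closed add.inv_solve_right)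
    then show ?case using diff by (simp add: assms(2) cls_closed)
  qed (use assms in \<open>auto simp: cls_zero[symmetric]\<close>)
  then show ?thesis using c by simp
qed

text \<open>The kernel of \<open>h\<close> is a subgroup containing \<open>W\<close>, hence contains
  \<open>Rel\<close>; so the value of \<open>h\<close> at a chosen representative depends on the
  coset alone. The result is additive only: the target carries no scalar action.\<close>

lemma presented_module_hom:
  assumes G: "abelian_group G" and h: "h \<in> hom (free_Abelian_group B) (add_monoid G)"
    and kill: "\<And>w. w \<in> W \<Longrightarrow> h w = \<zero>\<^bsub>G\<^esub>"
  obtains k where "\<And>c. Poly_Mapping.keys c \<subseteq> B \<Longrightarrow> k (cls c) = h c"
    "k \<in> carrier P \<rightarrow> carrier G"
    "\<And>z w. z \<in> carrier P \<Longrightarrow> w \<in> carrier P \<Longrightarrow> k (z \<oplus>\<^bsub>P\<^esub> w) = k z \<oplus>\<^bsub>G\<^esub> k w"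
proof -
  interpret G: abelian_group G by fact
  interpret h: group_hom "free_Abelian_group B" "add_monoid G" h
    by (intro group_hom.intro group_hom_axioms.intro h G.a_group) simp
  have W: "Rel \<subseteq> kernel (free_Abelian_group B) (add_monoid G) h"
    unfolding relation_subgroup_def
    using kill keys_relation
    by (intro group.generate_subgroup_incl h.subgroup_kernel) (auto simp: kernel_def)
  define k where "k C = h (SOME c. Poly_Mapping.keys c \<subseteq> B \<and> cls c = C)" for C
  have k: "k (cls c) = h c" if c: "Poly_Mapping.keys c \<subseteq> B" for c
  proof -
    let ?d = "SOME d. Poly_Mapping.keys d \<subseteq> B \<and> cls d = cls c"
    have d: "Poly_Mapping.keys ?d \<subseteq> B \<and> cls ?d = cls c"
      by (rule someI[of _ c]) (use c in simp)
    then have "?d - c \<in> Rel" using c cls_eq_iff by blast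
    then have *: "h (?d - c) = \<zero>\<^bsub>G\<^esub>" "Poly_Mapping.keys (?d - c) \<subseteq> B"
      using W relation_keys by (auto simp: kernel_def)
    then have "h ((?d - c) + c) = h (?d - c) \<oplus>\<^bsub>G\<^esub> h c"
      using h.hom_mult[of "?d - c" c] c by simp
    then show ?thesis
      using * c h.hom_closed[of c] by (simp add: k_def)
  qed
  show ?thesis
  proof (rule that[of k])
    show "k \<in> carrier P \<rightarrow> carrier G"
      using h.hom_closed by (auto simp: carrier_P k)
    fix z w assume "z \<in> carrier P" "w \<in> carrier P"
    then show "k (z \<oplus>\<^bsub>P\<^esub> w) = k z \<oplus>\<^bsub>G\<^esub> k w"
      using h.hom_mult
      by (auto simp: carrier_P k cls_add order_trans[OF keys_add])
  qed (rule k)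
qed

end

section \<open>Tensor products and exterior squares\<close>

text \<open>A common frame for both constructions: \<open>Z\<close> collects the pairs whose pure
  tensor is to vanish. It is empty for the tensor product and consists of the pairs
  \<open>(a x, x)\<close> for the exterior square. Stability under scaling the first entry is what
  lets the scalar action descend to the quotient.\<close>

locale bilinear_presentation = M?: module A M + N: module A N
  for A :: "('a, 'k) ring_scheme" (structure) and M :: "('a, 'm) module" and N :: "('a, 'n) module" +
  fixes Z :: "('m \<times> 'n) set"
  assumes Z_subset: "Z \<subseteq> carrier M \<times> carrier N"
    and Z_smult: "a \<in> carrier A \<Longrightarrow> (x, y) \<in> Z \<Longrightarrow> (a \<odot>\<^bsub>M\<^esub> x, y) \<in> Z"

sublocale bilinear_presentation \<subseteq> presentation A "carrier M \<times> carrier N"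
  "tensor_relations A M N \<union> frag_of ` Z" "\<lambda>a (x, y). (a \<odot>\<^bsub>M\<^esub> x, y)"
proof
  let ?W = "tensor_relations A M N \<union> frag_of ` Z"
  let ?G = "free_Abelian_group (carrier M \<times> carrier N)"
  let ?act = "\<lambda>a (x, y :: 'n). (a \<odot>\<^bsub>M\<^esub> x, y)"
  have incl: "w \<in> relation_subgroup (carrier M \<times> carrier N) ?W" if "w \<in> ?W" for w
    using that by (simp only: relation_subgroup_def generate.incl)
  fix w assume w: "w \<in> ?W"
  then show "Poly_Mapping.keys w \<subseteq> carrier M \<times> carrier N"
    using Z_subset unfolding tensor_relations_def by (auto dest!: subsetD[OF keys_diff])
  fix a assume a: "a \<in> carrier A"
  \<comment> \<open>Scaling the first slot turns each defining relation into another defining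
    relation of the same kind. For the balancing relation this uses that \<open>a\<close> and
    \<open>b\<close> commute in \<open>A\<close>.\<close>
  have "frag_extend (\<lambda>x. frag_of (?act a x)) w \<in> ?W"
    using w
  proof
    assume "w \<in> tensor_relations A M N"
    from this[unfolded tensor_relations_def] show ?thesis
    proof (elim UnE CollectE exE conjE)
      fix b x y
      assume "w = frag_of (b \<odot>\<^bsub>M\<^esub> x, y) - frag_of (x, b \<odot>\<^bsub>N\<^esub> y)"
        and c: "b \<in> carrier A" "x \<in> carrier M" "y \<in> carrier N"
      then have "frag_extend (\<lambda>x. frag_of (?act a x)) w
          = frag_of (b \<odot>\<^bsub>M\<^esub> (a \<odot>\<^bsub>M\<^esub> x), y) - frag_of (a \<odot>\<^bsub>M\<^esub> x, b \<odot>\<^bsub>N\<^esub> y)"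
        using a by (simp add: frag_extend_diff M.smult_assoc1[symmetric] m_comm)
      then show ?thesis using a c unfolding tensor_relations_def by blast
    next
      fix x x' y
      assume "w = frag_of (x \<oplus>\<^bsub>M\<^esub> x', y) - frag_of (x, y) - frag_of (x', y)"
        and c: "x \<in> carrier M" "x' \<in> carrier M" "y \<in> carrier N"
      then have "frag_extend (\<lambda>x. frag_of (?act a x)) w
          = frag_of (a \<odot>\<^bsub>M\<^esub> x \<oplus>\<^bsub>M\<^esub> a \<odot>\<^bsub>M\<^esub> x', y) - frag_of (a \<odot>\<^bsub>M\<^esub> x, y) - frag_of (a \<odot>\<^bsub>M\<^esub> x', y)"
        using a by (simp add: frag_extend_diff M.smult_r_distr)
      then show ?thesis
        using a c M.smult_closed[of a x] M.smult_closed[of a x'] unfolding tensor_relations_def by blast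
    next
      fix x y y'
      assume "w = frag_of (x, y \<oplus>\<^bsub>N\<^esub> y') - frag_of (x, y) - frag_of (x, y')"
        and c: "x \<in> carrier M" "y \<in> carrier N" "y' \<in> carrier N"
      then have "frag_extend (\<lambda>x. frag_of (?act a x)) w
          = frag_of (a \<odot>\<^bsub>M\<^esub> x, y \<oplus>\<^bsub>N\<^esub> y') - frag_of (a \<odot>\<^bsub>M\<^esub> x, y) - frag_of (a \<odot>\<^bsub>M\<^esub> x, y')"
        using a by (simp add: frag_extend_diff)
      then show ?thesis
        using a c M.smult_closed[of a x] unfolding tensor_relations_def by blast
    qed
  next
    assume "w \<in> frag_of ` Z"
    then show ?thesis using Z_smult[OF a] by auto
  qed
  then show "frag_extend (\<lambda>x. frag_of (?act a x)) w \<in> relation_subgroup (carrier M \<times> carrier N) ?W"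
    by (rule incl)
next
  let ?W = "tensor_relations A M N \<union> frag_of ` Z"
  let ?act = "\<lambda>a (x, y :: 'n). (a \<odot>\<^bsub>M\<^esub> x, y)"
  fix a z assume a: "a \<in> carrier A" and z: "z \<in> carrier M \<times> carrier N"
  then show "?act a z \<in> carrier M \<times> carrier N" by auto
  fix b assume b: "b \<in> carrier A"
  show "?act (a \<otimes> b) z = ?act a (?act b z)"
    using a b z by (auto simp: M.smult_assoc1)
  obtain x y where xy: "z = (x, y)" "x \<in> carrier M" "y \<in> carrier N"
    using z by auto
  have "frag_of (?act (a \<oplus> b) z) - frag_of (?act a z) - frag_of (?act b z)
      = frag_of (a \<odot>\<^bsub>M\<^esub> x \<oplus>\<^bsub>M\<^esub> b \<odot>\<^bsub>M\<^esub> x, y) - frag_of (a \<odot>\<^bsub>M\<^esub> x, y) - frag_of (b \<odot>\<^bsub>M\<^esub> x, y)"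
    using a b xy by (simp add: M.smult_l_distr)
  also have "\<dots> \<in> tensor_relations A M N"
    using a b xy M.smult_closed[of a x] M.smult_closed[of b x] unfolding tensor_relations_def by blast
  finally show "frag_of (?act (a \<oplus> b) z) - frag_of (?act a z) - frag_of (?act b z)
      \<in> relation_subgroup (carrier M \<times> carrier N) ?W"
    by (simp add: relation_subgroup_def generate.incl)
qed auto

context bilinear_presentation begin

abbreviation pure :: "'m \<Rightarrow> 'n \<Rightarrow> ('m \<times> 'n \<Rightarrow>\<^sub>0 int) set"
  where "pure x y \<equiv> cls (frag_of (x, y))"

lemma pure_closed: "x \<in> carrier M \<Longrightarrow> y \<in> carrier N \<Longrightarrow> pure x y \<in> carrier P"
  by (simp add: cls_closed)

lemma pure_add_left:
  assumes "x \<in> carrier M" "x' \<in> carrier M" "y \<in> carrier N"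
  shows "pure (x \<oplus>\<^bsub>M\<^esub> x') y = pure x y \<oplus>\<^bsub>P\<^esub> pure x' y"
proof -
  have "frag_of (x \<oplus>\<^bsub>M\<^esub> x', y) - frag_of (x, y) - frag_of (x', y) \<in> tensor_relations A M N"
    using assms unfolding tensor_relations_def by blast
  then have "frag_of (x \<oplus>\<^bsub>M\<^esub> x', y) - (frag_of (x, y) + frag_of (x', y)) \<in> Rel"
    by (simp add: relation_incl diff_diff_eq)
  then show ?thesis
    using assms by (simp add: cls_add cls_eq_iff order_trans[OF keys_add])
qed

lemma pure_add_right:
  assumes "x \<in> carrier M" "y \<in> carrier N" "y' \<in> carrier N"
  shows "pure x (y \<oplus>\<^bsub>N\<^esub> y') = pure x y \<oplus>\<^bsub>P\<^esub> pure x y'"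
proof -
  have "frag_of (x, y \<oplus>\<^bsub>N\<^esub> y') - frag_of (x, y) - frag_of (x, y') \<in> tensor_relations A M N"
    using assms unfolding tensor_relations_def by blast
  then have "frag_of (x, y \<oplus>\<^bsub>N\<^esub> y') - (frag_of (x, y) + frag_of (x, y')) \<in> Rel"
    by (simp add: relation_incl diff_diff_eq)
  then show ?thesis
    using assms by (simp add: cls_add cls_eq_iff order_trans[OF keys_add])
qed

lemma pure_smult_left:
  "a \<in> carrier A \<Longrightarrow> x \<in> carrier M \<Longrightarrow> y \<in> carrier N \<Longrightarrow> pure (a \<odot>\<^bsub>M\<^esub> x) y = a \<odot>\<^bsub>P\<^esub> pure x y"
  using cls_of_smult[of a "(x, y)"] by simp

lemma pure_smult_right:
  assumes "a \<in> carrier A" "x \<in> carrier M" "y \<in> carrier N"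
  shows "pure x (a \<odot>\<^bsub>N\<^esub> y) = a \<odot>\<^bsub>P\<^esub> pure x y"
proof -
  have "frag_of (a \<odot>\<^bsub>M\<^esub> x, y) - frag_of (x, a \<odot>\<^bsub>N\<^esub> y) \<in> tensor_relations A M N"
    using assms unfolding tensor_relations_def by blast
  then have "frag_of (a \<odot>\<^bsub>M\<^esub> x, y) - frag_of (x, a \<odot>\<^bsub>N\<^esub> y) \<in> Rel"
    by (simp add: relation_incl)
  then have "pure (a \<odot>\<^bsub>M\<^esub> x) y = pure x (a \<odot>\<^bsub>N\<^esub> y)"
    using assms by (simp add: cls_eq_iff)
  then show ?thesis using assms by (simp add: pure_smult_left)
qed

lemma pure_Z: "(x, y) \<in> Z \<Longrightarrow> pure x y = \<zero>\<^bsub>P\<^esub>"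
  using Z_subset relation_incl[of "frag_of (x, y)"] cls_eq_iff[of "frag_of (x, y)" 0]
  by (auto simp: cls_zero)

text \<open>The target is just an abelian group and \<open>f\<close> is required to be balanced
  rather than \<open>A\<close>-bilinear. This allows maps into \<open>R\<close> from a tensor
  product over \<open>S\<close>, where \<open>R\<close> has no \<open>S\<close>-module
  structure.\<close>

lemma bilinear_lift:
  assumes G: "abelian_group G"
    and f: "\<And>x y. x \<in> carrier M \<Longrightarrow> y \<in> carrier N \<Longrightarrow> f x y \<in> carrier G"
    and left: "\<And>x x' y. x \<in> carrier M \<Longrightarrow> x' \<in> carrier M \<Longrightarrow> y \<in> carrier N \<Longrightarrow>
      f (x \<oplus>\<^bsub>M\<^esub> x') y = f x y \<oplus>\<^bsub>G\<^esub> f x' y"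
    and right: "\<And>x y y'. x \<in> carrier M \<Longrightarrow> y \<in> carrier N \<Longrightarrow> y' \<in> carrier N \<Longrightarrow>
      f x (y \<oplus>\<^bsub>N\<^esub> y') = f x y \<oplus>\<^bsub>G\<^esub> f x y'"
    and balanced: "\<And>a x y. a \<in> carrier A \<Longrightarrow> x \<in> carrier M \<Longrightarrow> y \<in> carrier N \<Longrightarrow>
      f (a \<odot>\<^bsub>M\<^esub> x) y = f x (a \<odot>\<^bsub>N\<^esub> y)"
    and Z: "\<And>x y. (x, y) \<in> Z \<Longrightarrow> f x y = \<zero>\<^bsub>G\<^esub>"
  obtains k where "k \<in> carrier P \<rightarrow> carrier G"
    "\<And>z w. z \<in> carrier P \<Longrightarrow> w \<in> carrier P \<Longrightarrow> k (z \<oplus>\<^bsub>P\<^esub> w) = k z \<oplus>\<^bsub>G\<^esub> k w"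
    "\<And>x y. x \<in> carrier M \<Longrightarrow> y \<in> carrier N \<Longrightarrow> k (pure x y) = f x y"
proof -
  interpret G: abelian_group G by fact
  let ?F = "free_Abelian_group (carrier M \<times> carrier N)"
  obtain h where h: "h \<in> hom ?F (add_monoid G)"
      and hf: "\<And>z. z \<in> carrier M \<times> carrier N \<Longrightarrow> h (frag_of z) = case_prod f z"
    by (rule comm_group.free_Abelian_group_universal[OF G.a_comm_group, of "case_prod f" "carrier M \<times> carrier N"])
      (use f in auto)
  interpret h: group_hom ?F "add_monoid G" h
    by (intro group_hom.intro group_hom_axioms.intro h G.a_group) simp
  have hd: "h (c - d) = h c \<ominus>\<^bsub>G\<^esub> h d"
    if "Poly_Mapping.keys c \<subseteq> carrier M \<times> carrier N" "Poly_Mapping.keys d \<subseteq> carrier M \<times> carrier N" for c d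
    using h.hom_mult[of c "- d"] h.hom_inv[of d] that by (simp add: a_minus_def a_inv_def)
  have k: "Poly_Mapping.keys (frag_of z - frag_of w) \<subseteq> carrier M \<times> carrier N"
    if "z \<in> carrier M \<times> carrier N" "w \<in> carrier M \<times> carrier N" for z w
    using that keys_diff[of "frag_of z" "frag_of w"] by auto
  have cancel: "u \<oplus>\<^bsub>G\<^esub> v \<ominus>\<^bsub>G\<^esub> u \<ominus>\<^bsub>G\<^esub> v = \<zero>\<^bsub>G\<^esub>" "u \<ominus>\<^bsub>G\<^esub> u = \<zero>\<^bsub>G\<^esub>"
    if "u \<in> carrier G" "v \<in> carrier G" for u v
    using that G.a_comm[of u v] by (simp_all add: a_minus_def G.a_assoc G.r_neg)
  have "h w = \<zero>\<^bsub>G\<^esub>" if "w \<in> tensor_relations A M N \<union> frag_of ` Z" for w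
    using that
  proof
    assume "w \<in> tensor_relations A M N"
    then show ?thesis
      unfolding tensor_relations_def
      by (elim UnE CollectE exE conjE)
        (simp_all add: hd k hf left right balanced f cancel(1) cancel(2)[OF f f])
  next
    assume "w \<in> frag_of ` Z"
    then show ?thesis using Z_subset Z by (auto simp: hf)
  qed
  from presented_module_hom[OF G h this] obtain k where
    "\<And>c. Poly_Mapping.keys c \<subseteq> carrier M \<times> carrier N \<Longrightarrow> k (cls c) = h c"
    "k \<in> carrier P \<rightarrow> carrier G"
    "\<And>z w. z \<in> carrier P \<Longrightarrow> w \<in> carrier P \<Longrightarrow> k (z \<oplus>\<^bsub>P\<^esub> w) = k z \<oplus>\<^bsub>G\<^esub> k w"
    by blast
  then show ?thesis
    by (intro that[of k]) (simp_all add: hf)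
qed

end

locale tensor = M?: module A M + N: module A N
  for A :: "('a, 'k) ring_scheme" (structure) and M :: "('a, 'm) module" and N :: "('a, 'n) module"
begin

sublocale pres: bilinear_presentation A M N "{}"
  by unfold_locales auto

abbreviation "T \<equiv> tensor_product A M N"
abbreviation "te \<equiv> tensor_elem A M N"

lemma presentation_eq: "pres.P = T" "pres.pure x y = te x y"
  by (simp_all add: tensor_product_def tensor_elem_def fun_eq_iff)

lemmas tensor_product_module = pres.presented_module_module[unfolded presentation_eq]
  and tensor_elem_closed = pres.pure_closed[unfolded presentation_eq]
  and tensor_elem_add_left = pres.pure_add_left[unfolded presentation_eq]
  and tensor_elem_add_right = pres.pure_add_right[unfolded presentation_eq]
  and tensor_elem_smult_left = pres.pure_smult_left[unfolded presentation_eq]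
  and tensor_elem_smult_right = pres.pure_smult_right[unfolded presentation_eq]
  and tensor_lift = pres.bilinear_lift[unfolded presentation_eq, simplified]

lemma tensor_product_induct [consumes 1, case_names diff tensor zero]:
  assumes "z \<in> carrier T"
    and "\<And>z w. z \<in> carrier T \<Longrightarrow> w \<in> carrier T \<Longrightarrow> Q z \<Longrightarrow> Q w \<Longrightarrow> Q (z \<ominus>\<^bsub>T\<^esub> w)"
    and "\<And>x y. x \<in> carrier M \<Longrightarrow> y \<in> carrier N \<Longrightarrow> Q (te x y)"
    and "Q \<zero>\<^bsub>T\<^esub>"
  shows "Q z"
  using pres.presented_module_induct[unfolded presentation_eq, of z Q] assms
  by (auto simp: tensor_elem_def)

end

locale exterior_square = module A M
  for A :: "('a, 'k) ring_scheme" (structure) and M :: "('a, 'm) module"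
begin

sublocale pres: bilinear_presentation A M M "{(a \<odot>\<^bsub>M\<^esub> x, x) | a x. a \<in> carrier A \<and> x \<in> carrier M}"
proof
  fix a x y
  assume a: "a \<in> carrier A" and "(x, y) \<in> {(a \<odot>\<^bsub>M\<^esub> x, x) | a x. a \<in> carrier A \<and> x \<in> carrier M}"
  then obtain b where "b \<in> carrier A" "y \<in> carrier M" "x = b \<odot>\<^bsub>M\<^esub> y" by auto
  with a show "(a \<odot>\<^bsub>M\<^esub> x, y) \<in> {(a \<odot>\<^bsub>M\<^esub> x, x) | a x. a \<in> carrier A \<and> x \<in> carrier M}"
    using smult_assoc1[of a b y, symmetric] by blast
qed auto

abbreviation "L \<equiv> ext_square A M"
abbreviation "we \<equiv> wedge A M"

lemma relations_eq: "tensor_relations A M M \<union>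
    frag_of ` {(a \<odot>\<^bsub>M\<^esub> x, x) | a x. a \<in> carrier A \<and> x \<in> carrier M} = ext_square_relations A M"
  unfolding ext_square_relations_def by blast

lemma presentation_eq: "pres.P = L" "pres.pure x y = we x y"
  by (simp_all add: ext_square_def wedge_def fun_eq_iff relations_eq)

lemmas ext_square_module = pres.presented_module_module[unfolded presentation_eq]
  and wedge_closed = pres.pure_closed[unfolded presentation_eq]
  and wedge_add_left = pres.pure_add_left[unfolded presentation_eq]
  and wedge_add_right = pres.pure_add_right[unfolded presentation_eq]
  and wedge_smult_left = pres.pure_smult_left[unfolded presentation_eq]
  and wedge_smult_right = pres.pure_smult_right[unfolded presentation_eq]
  and wedge_lift = pres.bilinear_lift[unfolded presentation_eq]

lemma wedge_self: "x \<in> carrier M \<Longrightarrow> we x x = \<zero>\<^bsub>L\<^esub>"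
  using pres.pure_Z[of x x, unfolded presentation_eq] smult_one[of x] one_closed by force

lemma wedge_swap:
  assumes "x \<in> carrier M" "y \<in> carrier M"
  shows "we y x = \<ominus>\<^bsub>L\<^esub> we x y"
proof -
  interpret L: module A L by (rule ext_square_module)
  have "\<zero>\<^bsub>L\<^esub> = we (x \<oplus>\<^bsub>M\<^esub> y) (x \<oplus>\<^bsub>M\<^esub> y)"
    using assms by (simp add: wedge_self)
  also have "\<dots> = (we x x \<oplus>\<^bsub>L\<^esub> we y x) \<oplus>\<^bsub>L\<^esub> (we x y \<oplus>\<^bsub>L\<^esub> we y y)"
    using assms by (simp add: wedge_add_left wedge_add_right wedge_closed)
  also have "\<dots> = we y x \<oplus>\<^bsub>L\<^esub> we x y"
    using assms by (simp add: wedge_self wedge_closed)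
  finally show ?thesis
    using assms by (metis L.M.minus_equality wedge_closed)
qed

end

section \<open>Coordinates in a basis of two elements\<close>

locale module_basis2 = module R M
  for R :: "'r ring" (structure) and M :: "('r, 'm) module" and e1 e2 :: 'm +
  assumes basis: "is_basis2 R M e1 e2"
begin

definition coord1 :: "'m \<Rightarrow> 'r" where
  "coord1 x = fst (THE p. p \<in> carrier R \<times> carrier R \<and>
     x = (fst p \<odot>\<^bsub>M\<^esub> e1) \<oplus>\<^bsub>M\<^esub> (snd p \<odot>\<^bsub>M\<^esub> e2))"

definition coord2 :: "'m \<Rightarrow> 'r" where
  "coord2 x = snd (THE p. p \<in> carrier R \<times> carrier R \<and>
     x = (fst p \<odot>\<^bsub>M\<^esub> e1) \<oplus>\<^bsub>M\<^esub> (snd p \<odot>\<^bsub>M\<^esub> e2))"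

lemma basis_closed [simp, intro]: "e1 \<in> carrier M" "e2 \<in> carrier M"
  using basis by (auto simp: is_basis2_def)

lemma
  assumes "x \<in> carrier M"
  shows coord1_closed [simp, intro]: "coord1 x \<in> carrier R"
    and coord2_closed [simp, intro]: "coord2 x \<in> carrier R"
    and coord_decomp: "x = (coord1 x \<odot>\<^bsub>M\<^esub> e1) \<oplus>\<^bsub>M\<^esub> (coord2 x \<odot>\<^bsub>M\<^esub> e2)"
proof -
  have "\<exists>!p. p \<in> carrier R \<times> carrier R \<and> x = (fst p \<odot>\<^bsub>M\<^esub> e1) \<oplus>\<^bsub>M\<^esub> (snd p \<odot>\<^bsub>M\<^esub> e2)"
    using basis assms by (auto simp: is_basis2_def)
  from theI'[OF this] show "coord1 x \<in> carrier R" "coord2 x \<in> carrier R"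
    "x = (coord1 x \<odot>\<^bsub>M\<^esub> e1) \<oplus>\<^bsub>M\<^esub> (coord2 x \<odot>\<^bsub>M\<^esub> e2)"
    by (auto simp: coord1_def coord2_def)
qed

lemmas coords = coord1_closed coord2_closed

lemma coord_lincomb [simp]:
  assumes "u \<in> carrier R" "v \<in> carrier R"
  shows "coord1 ((u \<odot>\<^bsub>M\<^esub> e1) \<oplus>\<^bsub>M\<^esub> (v \<odot>\<^bsub>M\<^esub> e2)) = u"
    and "coord2 ((u \<odot>\<^bsub>M\<^esub> e1) \<oplus>\<^bsub>M\<^esub> (v \<odot>\<^bsub>M\<^esub> e2)) = v"
proof -
  let ?x = "(u \<odot>\<^bsub>M\<^esub> e1) \<oplus>\<^bsub>M\<^esub> (v \<odot>\<^bsub>M\<^esub> e2)"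
  have x: "?x \<in> carrier M" using assms by simp
  note * = is_basis2_unique[OF basis module_axioms assms coord1_closed[OF x] coord2_closed[OF x] coord_decomp[OF x]]
  show "coord1 ?x = u" "coord2 ?x = v" using * by simp_all
qed

lemma coord_e [simp]: "coord1 e1 = \<one>" "coord2 e1 = \<zero>" "coord1 e2 = \<zero>" "coord2 e2 = \<one>"
  using coord_lincomb[of \<one> \<zero>] coord_lincomb[of \<zero> \<one>] by simp_all

lemma coord_add [simp]:
  assumes "x \<in> carrier M" "y \<in> carrier M"
  shows "coord1 (x \<oplus>\<^bsub>M\<^esub> y) = coord1 x \<oplus> coord1 y" and "coord2 (x \<oplus>\<^bsub>M\<^esub> y) = coord2 x \<oplus> coord2 y"
proof -
  have "x \<oplus>\<^bsub>M\<^esub> y = ((coord1 x \<odot>\<^bsub>M\<^esub> e1) \<oplus>\<^bsub>M\<^esub> (coord2 x \<odot>\<^bsub>M\<^esub> e2)) \<oplus>\<^bsub>M\<^esub> ((coord1 y \<odot>\<^bsub>M\<^esub> e1) \<oplus>\<^bsub>M\<^esub> (coord2 y \<odot>\<^bsub>M\<^esub> e2))"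
    using assms coord_decomp by simp
  also have "\<dots> = ((coord1 x \<oplus> coord1 y) \<odot>\<^bsub>M\<^esub> e1) \<oplus>\<^bsub>M\<^esub> ((coord2 x \<oplus> coord2 y) \<odot>\<^bsub>M\<^esub> e2)"
    using assms by (simp add: smult_l_distr M.a_ac)
  finally have "x \<oplus>\<^bsub>M\<^esub> y = \<dots>" .
  then show "coord1 (x \<oplus>\<^bsub>M\<^esub> y) = coord1 x \<oplus> coord1 y" "coord2 (x \<oplus>\<^bsub>M\<^esub> y) = coord2 x \<oplus> coord2 y"
    using assms by simp_all
qed

lemma coord_smult [simp]:
  assumes "u \<in> carrier R" "x \<in> carrier M"
  shows "coord1 (u \<odot>\<^bsub>M\<^esub> x) = u \<otimes> coord1 x" and "coord2 (u \<odot>\<^bsub>M\<^esub> x) = u \<otimes> coord2 x"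
proof -
  have "u \<odot>\<^bsub>M\<^esub> x = u \<odot>\<^bsub>M\<^esub> ((coord1 x \<odot>\<^bsub>M\<^esub> e1) \<oplus>\<^bsub>M\<^esub> (coord2 x \<odot>\<^bsub>M\<^esub> e2))"
    using assms coord_decomp by simp
  also have "\<dots> = ((u \<otimes> coord1 x) \<odot>\<^bsub>M\<^esub> e1) \<oplus>\<^bsub>M\<^esub> ((u \<otimes> coord2 x) \<odot>\<^bsub>M\<^esub> e2)"
    using assms by (simp add: smult_r_distr smult_assoc1)
  finally have "u \<odot>\<^bsub>M\<^esub> x = \<dots>" .
  then show "coord1 (u \<odot>\<^bsub>M\<^esub> x) = u \<otimes> coord1 x" "coord2 (u \<odot>\<^bsub>M\<^esub> x) = u \<otimes> coord2 x"
    using assms by (simp_all del: coord_add)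
qed

lemma coord_minus [simp]:
  assumes "x \<in> carrier M"
  shows "coord1 (\<ominus>\<^bsub>M\<^esub> x) = \<ominus> coord1 x" and "coord2 (\<ominus>\<^bsub>M\<^esub> x) = \<ominus> coord2 x"
  using coord_smult[of "\<ominus> \<one>" x] assms by (simp_all add: smult_l_minus R.l_minus)

lemma coord_diff [simp]:
  assumes "x \<in> carrier M" "y \<in> carrier M"
  shows "coord1 (x \<ominus>\<^bsub>M\<^esub> y) = coord1 x \<ominus> coord1 y" and "coord2 (x \<ominus>\<^bsub>M\<^esub> y) = coord2 x \<ominus> coord2 y"
  using assms by (simp_all add: a_minus_def)

lemma coord_eqI:
  assumes "x \<in> carrier M" "y \<in> carrier M" "coord1 x = coord1 y" "coord2 x = coord2 y"
  shows "x = y"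
  using coord_decomp[OF assms(1)] coord_decomp[OF assms(2)] assms(3,4) by simp

end

section \<open>The exterior square of a free module of rank two\<close>

sublocale module_basis2 \<subseteq> ext: exterior_square R M ..

context module_basis2 begin

text \<open>The alternating form normalised by the value 1 on \<open>(e1, e2)\<close>. For a second
  basis it is the determinant of the change of basis.\<close>

definition coord_det :: "'m \<Rightarrow> 'm \<Rightarrow> 'r" where
  "coord_det x y = (coord1 x \<otimes> coord2 y) \<ominus> (coord2 x \<otimes> coord1 y)"

lemma coord_det_closed [simp]: "x \<in> carrier M \<Longrightarrow> y \<in> carrier M \<Longrightarrow> coord_det x y \<in> carrier R"
  by (simp add: coord_det_def)

lemma wedge_eq:
  assumes x: "x \<in> carrier M" and y: "y \<in> carrier M"
  shows "wedge R M x y = coord_det x y \<odot>\<^bsub>ext_square R M\<^esub> wedge R M e1 e2"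
proof -
  interpret L: module R ext.L by (rule ext.ext_square_module)
  let ?w = "wedge R M"
  note [simp] = ext.wedge_closed x y
  have "?w x y = ?w ((coord1 x \<odot>\<^bsub>M\<^esub> e1) \<oplus>\<^bsub>M\<^esub> (coord2 x \<odot>\<^bsub>M\<^esub> e2)) ((coord1 y \<odot>\<^bsub>M\<^esub> e1) \<oplus>\<^bsub>M\<^esub> (coord2 y \<odot>\<^bsub>M\<^esub> e2))"
    using coord_decomp[OF x] coord_decomp[OF y] by simp
  also have "\<dots> = (coord1 y \<odot>\<^bsub>ext.L\<^esub> (coord2 x \<odot>\<^bsub>ext.L\<^esub> ?w e2 e1)) \<oplus>\<^bsub>ext.L\<^esub> (coord2 y \<odot>\<^bsub>ext.L\<^esub> (coord1 x \<odot>\<^bsub>ext.L\<^esub> ?w e1 e2))"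
    by (simp add: ext.wedge_add_left ext.wedge_add_right ext.wedge_smult_left ext.wedge_smult_right ext.wedge_self)
  also have "\<dots> = (\<ominus> (coord1 y \<otimes> coord2 x) \<oplus> coord2 y \<otimes> coord1 x) \<odot>\<^bsub>ext.L\<^esub> ?w e1 e2"
    by (simp add: ext.wedge_swap[of e1 e2] L.smult_l_distr L.smult_l_minus L.smult_r_minus L.smult_assoc1)
  also have "\<ominus> (coord1 y \<otimes> coord2 x) \<oplus> coord2 y \<otimes> coord1 x = coord_det x y"
    using coords[OF x] coords[OF y] unfolding coord_det_def by algebra
  finally show ?thesis .
qed

text \<open>\<open>coord_det\<close> is biadditive, balanced and zero on the pairs
  \<open>(a y, y)\<close>, so it factors through the exterior square, and the induced map can be
  applied to both sides. In particular \<open>wedge R M e1 e2\<close> has zero annihilator, which is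
  how coefficients of wedges get compared.\<close>

lemma wedge_smult_coord_det:
  assumes "u \<in> carrier R" "v \<in> carrier R" "x \<in> carrier M" "y \<in> carrier M" "x' \<in> carrier M" "y' \<in> carrier M"
    and eq: "u \<odot>\<^bsub>ext_square R M\<^esub> wedge R M x y = v \<odot>\<^bsub>ext_square R M\<^esub> wedge R M x' y'"
  shows "u \<otimes> coord_det x y = v \<otimes> coord_det x' y'"
proof -
  obtain k where k: "\<And>x y. x \<in> carrier M \<Longrightarrow> y \<in> carrier M \<Longrightarrow> k (wedge R M x y) = coord_det x y"
  proof (rule ext.wedge_lift[of R coord_det])
    show "abelian_group R" by (rule R.is_abelian_group)
  next
    fix x x' y assume c: "x \<in> carrier M" "x' \<in> carrier M" "y \<in> carrier M"
    show "coord_det (x \<oplus>\<^bsub>M\<^esub> x') y = coord_det x y \<oplus> coord_det x' y"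
      unfolding coord_det_def coord_add[OF c(1,2)] using coords[OF c(1)] coords[OF c(2)] coords[OF c(3)] by algebra
    show "coord_det x (x' \<oplus>\<^bsub>M\<^esub> y) = coord_det x x' \<oplus> coord_det x y"
      unfolding coord_det_def coord_add[OF c(2,3)] using coords[OF c(1)] coords[OF c(2)] coords[OF c(3)] by algebra
  next
    fix a x y assume c: "a \<in> carrier R" "x \<in> carrier M" "y \<in> carrier M"
    show "coord_det (a \<odot>\<^bsub>M\<^esub> x) y = coord_det x (a \<odot>\<^bsub>M\<^esub> y)"
      unfolding coord_det_def coord_smult[OF c(1,2)] coord_smult[OF c(1,3)]
      using c(1) coords[OF c(2)] coords[OF c(3)] by algebra
  next
    fix x y assume "(x, y) \<in> {(a \<odot>\<^bsub>M\<^esub> x, x) |a x. a \<in> carrier R \<and> x \<in> carrier M}"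
    then obtain a where c: "a \<in> carrier R" "y \<in> carrier M" "x = a \<odot>\<^bsub>M\<^esub> y" by auto
    show "coord_det x y = \<zero>"
      unfolding coord_det_def c(3) coord_smult[OF c(1,2)] using c(1) coords[OF c(2)] by algebra
  qed auto
  \<comment> \<open>The values of \<open>k\<close> are known on pure wedges only, so a scalar is
    absorbed into the first argument before \<open>k\<close> is applied.\<close>
  have scale: "w \<otimes> coord_det z z' = coord_det (w \<odot>\<^bsub>M\<^esub> z) z'"
    if c: "w \<in> carrier R" "z \<in> carrier M" "z' \<in> carrier M" for w z z'
    unfolding coord_det_def coord_smult[OF c(1,2)] using c(1) coords[OF c(2)] coords[OF c(3)] by algebra
  have "coord_det (u \<odot>\<^bsub>M\<^esub> x) y = coord_det (v \<odot>\<^bsub>M\<^esub> x') y'"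
    using assms k[of "u \<odot>\<^bsub>M\<^esub> x" y] k[of "v \<odot>\<^bsub>M\<^esub> x'" y'] by (simp add: ext.wedge_smult_left)
  then show ?thesis using assms by (simp add: scale)
qed

text \<open>Expressing \<open>e1 \<and> e2\<close> through \<open>g1 \<and> g2\<close> and
  evaluating \<open>coord_det\<close> shows that the two determinants of change of basis multiply to
  1.\<close>

lemma coord_det_basis_unit:
  assumes g: "is_basis2 R M g1 g2"
  shows "coord_det g1 g2 \<in> Units R"
proof -
  interpret g: module_basis2 R M g1 g2 by unfold_locales (rule g)
  have c: "g1 \<in> carrier M" "g2 \<in> carrier M" by auto
  interpret L: module R ext.L by (rule ext.ext_square_module)
  have "\<one> \<odot>\<^bsub>ext.L\<^esub> wedge R M e1 e2 = g.coord_det e1 e2 \<odot>\<^bsub>ext.L\<^esub> wedge R M g1 g2"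
    using g.wedge_eq[of e1 e2] by (simp add: ext.wedge_closed)
  then have "\<one> \<otimes> coord_det e1 e2 = g.coord_det e1 e2 \<otimes> coord_det g1 g2"
    by (intro wedge_smult_coord_det) auto
  moreover have "coord_det e1 e2 = \<one>" by (simp add: coord_det_def a_minus_def)
  ultimately have "g.coord_det e1 e2 \<otimes> coord_det g1 g2 = \<one>" by simp
  then show ?thesis
    using c m_comm[of "coord_det g1 g2" "g.coord_det e1 e2"] by (auto simp: Units_def intro!: bexI[of _ "g.coord_det e1 e2"])
qed

lemma coord_iso_std: "(\<lambda>x. (coord1 x, coord2 x)) \<in> module_iso R M (std_module2 R)"
  unfolding module_iso_def
proof (intro CollectI conjI)
  show "bij_betw (\<lambda>x. (coord1 x, coord2 x)) (carrier M) (carrier (std_module2 R))"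
    unfolding std_module2_simps
  proof (rule bij_betwI[where g = "\<lambda>(u, v). (u \<odot>\<^bsub>M\<^esub> e1) \<oplus>\<^bsub>M\<^esub> (v \<odot>\<^bsub>M\<^esub> e2)"])
  qed (auto simp: coord_decomp[symmetric])
qed (simp_all add: std_module2_simps)

end

section \<open>Restriction of scalars from the algebra to the base ring\<close>

lemma restrict_scalars_carrier [simp]: "carrier (restrict_scalars R S I) = carrier I"
  by (simp add: restrict_scalars_def)

lemma restrict_scalars_ops:
  "x \<oplus>\<^bsub>restrict_scalars R S I\<^esub> y = x \<oplus>\<^bsub>I\<^esub> y"
  "\<zero>\<^bsub>restrict_scalars R S I\<^esub> = \<zero>\<^bsub>I\<^esub>"
  "\<ominus>\<^bsub>restrict_scalars R S I\<^esub> x = \<ominus>\<^bsub>I\<^esub> x"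
  "x \<ominus>\<^bsub>restrict_scalars R S I\<^esub> y = x \<ominus>\<^bsub>I\<^esub> y"
  "r \<odot>\<^bsub>restrict_scalars R S I\<^esub> x = (r \<odot>\<^bsub>S\<^esub> \<one>\<^bsub>S\<^esub>) \<odot>\<^bsub>I\<^esub> x"
  by (simp_all add: restrict_scalars_def a_inv_def a_minus_def m_inv_def)

lemma restrict_scalars_module:
  assumes "algebra R S" "module S I"
  shows "module R (restrict_scalars R S I)"
proof -
  interpret S: algebra R S by fact
  interpret I: module S I by fact
  show ?thesis
  proof (rule moduleI)
    show "abelian_group (restrict_scalars R S I)"
    proof (rule abelian_groupI)
      fix x assume "x \<in> carrier (restrict_scalars R S I)"
      then show "\<exists>y\<in>carrier (restrict_scalars R S I).
          y \<oplus>\<^bsub>restrict_scalars R S I\<^esub> x = \<zero>\<^bsub>restrict_scalars R S I\<^esub>"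
        by (auto intro!: bexI[of _ "\<ominus>\<^bsub>I\<^esub> x"] simp: restrict_scalars_ops I.M.l_neg)
    qed (auto simp: restrict_scalars_ops I.M.a_ac)
  qed (auto simp: restrict_scalars_ops S.R.is_cring I.smult_l_distr I.smult_r_distr S.smult_l_distr
      I.smult_assoc1[symmetric] S.smult_assoc1 S.smult_assoc2)
qed

section \<open>Modules over a quadratic algebra with a good frame\<close>

text \<open>The polynomial is X^2 - tr X + det, so the determinant is its coefficient in degree 0
  and minus the trace its coefficient in degree 1.\<close>

lemma char_poly_matrix2_eq_iff:
  assumes R: "cring R" and m: "{m11, m12, m21, m22} \<subseteq> carrier R" and n: "{n11, n12, n21, n22} \<subseteq> carrier R"
  shows "char_poly_matrix2 R m11 m12 m21 m22 = char_poly_matrix2 R n11 n12 n21 n22 \<longleftrightarrow>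
    m11 \<oplus>\<^bsub>R\<^esub> m22 = n11 \<oplus>\<^bsub>R\<^esub> n22 \<and> det2 R m11 m12 m21 m22 = det2 R n11 n12 n21 n22" (is "?l \<longleftrightarrow> ?r")
proof
  assume ?l
  interpret UP_cring R "UP R" by (intro UP_cring.intro R)
  let ?P = "UP R"
  let ?x = "up_ring.monom ?P \<one>\<^bsub>R\<^esub> 1"
  define p where "p tr d = ((?x \<otimes>\<^bsub>?P\<^esub> ?x) \<ominus>\<^bsub>?P\<^esub> (up_ring.monom ?P tr 0 \<otimes>\<^bsub>?P\<^esub> ?x)) \<oplus>\<^bsub>?P\<^esub> up_ring.monom ?P d 0"
    for tr d
  have cf: "up_ring.coeff ?P (p tr d) 0 = d" "up_ring.coeff ?P (p tr d) 1 = \<ominus>\<^bsub>R\<^esub> tr"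
    if "tr \<in> carrier R" "d \<in> carrier R" for tr d
  proof -
    have "?x \<otimes>\<^bsub>?P\<^esub> ?x = up_ring.monom ?P \<one>\<^bsub>R\<^esub> 2" "up_ring.monom ?P tr 0 \<otimes>\<^bsub>?P\<^esub> ?x = up_ring.monom ?P tr 1"
      using monom_mult[of "\<one>\<^bsub>R\<^esub>" "\<one>\<^bsub>R\<^esub>" 1 1] monom_mult[of tr "\<one>\<^bsub>R\<^esub>" 0 1] that
      by (simp_all add: numeral_2_eq_2)
    then show "up_ring.coeff ?P (p tr d) 0 = d" "up_ring.coeff ?P (p tr d) 1 = \<ominus>\<^bsub>R\<^esub> tr"
      using that by (simp_all add: p_def P.minus_eq R.minus_eq)
  qed
  have dc: "det2 R m11 m12 m21 m22 \<in> carrier R" "det2 R n11 n12 n21 n22 \<in> carrier R"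
    using m n by (simp_all add: det2_def)
  have tc: "m11 \<oplus>\<^bsub>R\<^esub> m22 \<in> carrier R" "n11 \<oplus>\<^bsub>R\<^esub> n22 \<in> carrier R"
    using m n by simp_all
  have "p (m11 \<oplus>\<^bsub>R\<^esub> m22) (det2 R m11 m12 m21 m22) = p (n11 \<oplus>\<^bsub>R\<^esub> n22) (det2 R n11 n12 n21 n22)"
    using \<open>?l\<close> by (simp add: char_poly_matrix2_alt[OF R m] char_poly_matrix2_alt[OF R n] p_def Let_def)
  then show ?r
    using cf[OF tc(1) dc(1)] cf[OF tc(2) dc(2)] tc by (metis R.minus_minus)
next
  assume ?r
  then show ?l by (simp add: char_poly_matrix2_alt[OF R m] char_poly_matrix2_alt[OF R n])
qed

locale algebra_module = S: algebra R S + J: module S J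
  for R :: "'r ring" and S :: "('r, 's) module" and J :: "('s, 'i) module"
begin

abbreviation "M \<equiv> restrict_scalars R S J"

sublocale M: module R M
  by (rule restrict_scalars_module) unfold_locales

lemma M_closed [simp]:
  "x \<in> carrier J \<Longrightarrow> y \<in> carrier J \<Longrightarrow> x \<oplus>\<^bsub>M\<^esub> y \<in> carrier J"
  "x \<in> carrier J \<Longrightarrow> y \<in> carrier J \<Longrightarrow> x \<ominus>\<^bsub>M\<^esub> y \<in> carrier J"
  "x \<in> carrier J \<Longrightarrow> \<ominus>\<^bsub>M\<^esub> x \<in> carrier J"
  "u \<in> carrier R \<Longrightarrow> x \<in> carrier J \<Longrightarrow> u \<odot>\<^bsub>M\<^esub> x \<in> carrier J"
  "\<zero>\<^bsub>M\<^esub> \<in> carrier J"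
  by (simp_all add: restrict_scalars_ops)

lemma act_add:
  "\<gamma> \<in> carrier S \<Longrightarrow> x \<in> carrier J \<Longrightarrow> y \<in> carrier J \<Longrightarrow> \<gamma> \<odot>\<^bsub>J\<^esub> (x \<oplus>\<^bsub>M\<^esub> y) = (\<gamma> \<odot>\<^bsub>J\<^esub> x) \<oplus>\<^bsub>M\<^esub> (\<gamma> \<odot>\<^bsub>J\<^esub> y)"
  by (simp add: restrict_scalars_ops J.smult_r_distr)

lemma act_plus:
  "\<gamma> \<in> carrier S \<Longrightarrow> \<delta> \<in> carrier S \<Longrightarrow> x \<in> carrier J \<Longrightarrow> (\<gamma> \<oplus>\<^bsub>S\<^esub> \<delta>) \<odot>\<^bsub>J\<^esub> x = (\<gamma> \<odot>\<^bsub>J\<^esub> x) \<oplus>\<^bsub>M\<^esub> (\<delta> \<odot>\<^bsub>J\<^esub> x)"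
  by (simp add: restrict_scalars_ops J.smult_l_distr)

lemma act_scalar:
  "u \<in> carrier R \<Longrightarrow> \<gamma> \<in> carrier S \<Longrightarrow> x \<in> carrier J \<Longrightarrow> (u \<odot>\<^bsub>S\<^esub> \<gamma>) \<odot>\<^bsub>J\<^esub> x = u \<odot>\<^bsub>M\<^esub> (\<gamma> \<odot>\<^bsub>J\<^esub> x)"
  by (simp add: restrict_scalars_ops J.smult_assoc1[symmetric] S.smult_assoc2)

lemma act_smult:
  assumes "u \<in> carrier R" "\<gamma> \<in> carrier S" "x \<in> carrier J"
  shows "\<gamma> \<odot>\<^bsub>J\<^esub> (u \<odot>\<^bsub>M\<^esub> x) = u \<odot>\<^bsub>M\<^esub> (\<gamma> \<odot>\<^bsub>J\<^esub> x)"
proof -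
  have "\<gamma> \<otimes>\<^bsub>S\<^esub> (u \<odot>\<^bsub>S\<^esub> \<one>\<^bsub>S\<^esub>) = (u \<odot>\<^bsub>S\<^esub> \<one>\<^bsub>S\<^esub>) \<otimes>\<^bsub>S\<^esub> \<gamma>"
    using assms by (simp add: S.m_comm)
  then show ?thesis
    using assms by (simp add: restrict_scalars_ops J.smult_assoc1[symmetric])
qed

end

text \<open>Pseudoregularity is left out of the assumptions: the locale is instantiated at the
  tensor product before that property is known there, and \<open>pseudoregular_iff\<close> then
  serves as the criterion for it.\<close>

locale framed_module = algebra_module R S J
  for R :: "'r ring" (structure) and S :: "('r, 's) module" and J :: "('s, 'i) module" +
  fixes \<alpha> :: 's and e1 e2 :: 'i and a b c :: 'r
  assumes basis_S: "is_basis2 R S \<one>\<^bsub>S\<^esub> \<alpha>"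
    and basis_J: "is_basis2 R (restrict_scalars R S J) e1 e2"
    and abc [simp]: "a \<in> carrier R" "b \<in> carrier R" "c \<in> carrier R"
    and act_e1: "\<alpha> \<odot>\<^bsub>J\<^esub> e1 = (b \<odot>\<^bsub>M\<^esub> e1) \<ominus>\<^bsub>M\<^esub> (a \<odot>\<^bsub>M\<^esub> e2)"
    and act_e2: "\<alpha> \<odot>\<^bsub>J\<^esub> e2 = c \<odot>\<^bsub>M\<^esub> e1"
begin

sublocale M: module_basis2 R M e1 e2
  by unfold_locales (rule basis_J)

sublocale B: module_basis2 R S "\<one>\<^bsub>S\<^esub>" \<alpha>
  by unfold_locales (rule basis_S)

lemma e_closed [simp]: "e1 \<in> carrier J" "e2 \<in> carrier J"
  using M.basis_closed by simp_all

lemma act_decomp: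
  assumes "\<gamma> \<in> carrier S" "x \<in> carrier J"
  shows "\<gamma> \<odot>\<^bsub>J\<^esub> x = (B.coord1 \<gamma> \<odot>\<^bsub>M\<^esub> x) \<oplus>\<^bsub>M\<^esub> (B.coord2 \<gamma> \<odot>\<^bsub>M\<^esub> (\<alpha> \<odot>\<^bsub>J\<^esub> x))"
proof -
  have "\<gamma> \<odot>\<^bsub>J\<^esub> x = ((B.coord1 \<gamma> \<odot>\<^bsub>S\<^esub> \<one>\<^bsub>S\<^esub>) \<oplus>\<^bsub>S\<^esub> (B.coord2 \<gamma> \<odot>\<^bsub>S\<^esub> \<alpha>)) \<odot>\<^bsub>J\<^esub> x"
    using assms B.coord_decomp by simp
  then show ?thesis
    using assms by (simp add: act_plus act_scalar)
qed

lemma coord_act: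
  assumes x: "x \<in> carrier J"
  shows "M.coord1 (\<alpha> \<odot>\<^bsub>J\<^esub> x) = (b \<otimes> M.coord1 x) \<oplus> (c \<otimes> M.coord2 x)"
    and "M.coord2 (\<alpha> \<odot>\<^bsub>J\<^esub> x) = \<ominus> (a \<otimes> M.coord1 x)"
proof -
  have c: "M.coord1 x \<in> carrier R" "M.coord2 x \<in> carrier R" using x by simp_all
  have "\<alpha> \<odot>\<^bsub>J\<^esub> x = \<alpha> \<odot>\<^bsub>J\<^esub> ((M.coord1 x \<odot>\<^bsub>M\<^esub> e1) \<oplus>\<^bsub>M\<^esub> (M.coord2 x \<odot>\<^bsub>M\<^esub> e2))"
    using x M.coord_decomp by simp
  also have "\<dots> = (M.coord1 x \<odot>\<^bsub>M\<^esub> ((b \<odot>\<^bsub>M\<^esub> e1) \<ominus>\<^bsub>M\<^esub> (a \<odot>\<^bsub>M\<^esub> e2))) \<oplus>\<^bsub>M\<^esub> (M.coord2 x \<odot>\<^bsub>M\<^esub> (c \<odot>\<^bsub>M\<^esub> e1))"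
    using c by (simp add: act_add act_smult act_e1 act_e2)
  finally have eq: "\<alpha> \<odot>\<^bsub>J\<^esub> x = \<dots>" .
  show "M.coord1 (\<alpha> \<odot>\<^bsub>J\<^esub> x) = (b \<otimes> M.coord1 x) \<oplus> (c \<otimes> M.coord2 x)"
    unfolding eq using c by (simp add: S.R.minus_eq S.R.m_comm)
  show "M.coord2 (\<alpha> \<odot>\<^bsub>J\<^esub> x) = \<ominus> (a \<otimes> M.coord1 x)"
    unfolding eq using c by (simp add: S.R.minus_eq S.R.l_minus S.R.r_minus S.R.m_comm)
qed

lemma char_poly_act:
  assumes g: "\<gamma> \<in> carrier S"
  defines "x \<equiv> B.coord1 \<gamma>" and "y \<equiv> B.coord2 \<gamma>"
  shows "char_poly2 R M (\<lambda>z. \<gamma> \<odot>\<^bsub>J\<^esub> z) = char_poly_matrix2 R (x \<oplus> y \<otimes> b) (y \<otimes> c) (\<ominus> (y \<otimes> a)) x"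
proof (rule char_poly2_eq[where ?e1.0 = e1 and ?e2.0 = e2])
  have [simp]: "x \<in> carrier R" "y \<in> carrier R" using g by (simp_all add: x_def y_def)
  note d = act_decomp[OF g, folded x_def y_def]
  show "{x \<oplus> y \<otimes> b, y \<otimes> c, \<ominus> (y \<otimes> a), x} \<subseteq> carrier R" by simp
  show "\<gamma> \<odot>\<^bsub>J\<^esub> e1 = ((x \<oplus> y \<otimes> b) \<odot>\<^bsub>M\<^esub> e1) \<oplus>\<^bsub>M\<^esub> ((\<ominus> (y \<otimes> a)) \<odot>\<^bsub>M\<^esub> e2)"
    by (rule M.coord_eqI) (simp_all add: g d act_e1 S.R.minus_eq S.R.r_minus)
  show "\<gamma> \<odot>\<^bsub>J\<^esub> e2 = ((y \<otimes> c) \<odot>\<^bsub>M\<^esub> e1) \<oplus>\<^bsub>M\<^esub> (x \<odot>\<^bsub>M\<^esub> e2)"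
    by (rule M.coord_eqI) (simp_all add: g d act_e2)
qed (simp_all add: g act_add act_smult basis_J M.module_axioms)

lemma char_poly_mult:
  assumes g: "\<gamma> \<in> carrier S"
  defines "x \<equiv> B.coord1 \<gamma>" and "y \<equiv> B.coord2 \<gamma>"
    and "u \<equiv> B.coord1 (\<alpha> \<otimes>\<^bsub>S\<^esub> \<alpha>)" and "v \<equiv> B.coord2 (\<alpha> \<otimes>\<^bsub>S\<^esub> \<alpha>)"
  shows "char_poly2 R S (\<lambda>z. \<gamma> \<otimes>\<^bsub>S\<^esub> z) = char_poly_matrix2 R x (y \<otimes> u) y (x \<oplus> y \<otimes> v)"
proof (rule char_poly2_eq[where ?e1.0 = "\<one>\<^bsub>S\<^esub>" and ?e2.0 = \<alpha>])
  have [simp]: "\<alpha> \<in> carrier S" by (rule B.basis_closed)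
  have [simp]: "x \<in> carrier R" "y \<in> carrier R" "u \<in> carrier R" "v \<in> carrier R"
    using g by (simp_all add: x_def y_def u_def v_def)
  have d: "\<gamma> = (x \<odot>\<^bsub>S\<^esub> \<one>\<^bsub>S\<^esub>) \<oplus>\<^bsub>S\<^esub> (y \<odot>\<^bsub>S\<^esub> \<alpha>)" using g B.coord_decomp by (simp add: x_def y_def)
  show "{x, y \<otimes> u, y, x \<oplus> y \<otimes> v} \<subseteq> carrier R" by simp
  show "\<gamma> \<otimes>\<^bsub>S\<^esub> \<one>\<^bsub>S\<^esub> = (x \<odot>\<^bsub>S\<^esub> \<one>\<^bsub>S\<^esub>) \<oplus>\<^bsub>S\<^esub> (y \<odot>\<^bsub>S\<^esub> \<alpha>)"
    using g d by simp
  have "\<gamma> \<otimes>\<^bsub>S\<^esub> \<alpha> = (x \<odot>\<^bsub>S\<^esub> \<alpha>) \<oplus>\<^bsub>S\<^esub> (y \<odot>\<^bsub>S\<^esub> (\<alpha> \<otimes>\<^bsub>S\<^esub> \<alpha>))"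
    unfolding d by (simp add: S.l_distr S.smult_assoc2)
  then show "\<gamma> \<otimes>\<^bsub>S\<^esub> \<alpha> = ((y \<otimes> u) \<odot>\<^bsub>S\<^esub> \<one>\<^bsub>S\<^esub>) \<oplus>\<^bsub>S\<^esub> ((x \<oplus> y \<otimes> v) \<odot>\<^bsub>S\<^esub> \<alpha>)"
    by (intro B.coord_eqI) (simp_all add: u_def[symmetric] v_def[symmetric])
  fix r z assume rz: "r \<in> carrier R" "z \<in> carrier S"
  then show "\<gamma> \<otimes>\<^bsub>S\<^esub> (r \<odot>\<^bsub>S\<^esub> z) = r \<odot>\<^bsub>S\<^esub> (\<gamma> \<otimes>\<^bsub>S\<^esub> z)"
    using g by (simp add: S.smult_assoc2 S.m_comm[of \<gamma>])
qed (simp_all add: g basis_S S.module_axioms S.r_distr)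

text \<open>At \<alpha> itself, with \<alpha>^2 = u + v \<alpha>, equality of traces says v = b and
  equality of determinants says -u = a c. Conversely every element of S has the form x + y \<alpha>,
  and these two equations make trace and determinant agree for all x and y. One direction extracts
  the equations of \<alpha> and \<alpha>' from \<open>I\<close> and \<open>I'\<close>; the other
  proves pseudoregularity of the tensor product.\<close>

lemma pseudoregular_iff:
  "pseudoregular R S J \<longleftrightarrow> \<alpha> \<otimes>\<^bsub>S\<^esub> \<alpha> = ((\<ominus> (a \<otimes> c)) \<odot>\<^bsub>S\<^esub> \<one>\<^bsub>S\<^esub>) \<oplus>\<^bsub>S\<^esub> (b \<odot>\<^bsub>S\<^esub> \<alpha>)" (is "_ \<longleftrightarrow> ?sq")
proof -
  have [simp]: "\<alpha> \<in> carrier S" by (rule B.basis_closed)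
  define u v where "u = B.coord1 (\<alpha> \<otimes>\<^bsub>S\<^esub> \<alpha>)" and "v = B.coord2 (\<alpha> \<otimes>\<^bsub>S\<^esub> \<alpha>)"
  have uv [simp]: "u \<in> carrier R" "v \<in> carrier R" by (simp_all add: u_def v_def)
  have iff: "char_poly2 R S (\<lambda>z. \<gamma> \<otimes>\<^bsub>S\<^esub> z) = char_poly2 R M (\<lambda>z. \<gamma> \<odot>\<^bsub>J\<^esub> z) \<longleftrightarrow>
      x \<oplus> (x \<oplus> y \<otimes> v) = (x \<oplus> y \<otimes> b) \<oplus> x \<and>
      det2 R x (y \<otimes> u) y (x \<oplus> y \<otimes> v) = det2 R (x \<oplus> y \<otimes> b) (y \<otimes> c) (\<ominus> (y \<otimes> a)) x"
    if "\<gamma> \<in> carrier S" "x = B.coord1 \<gamma>" "y = B.coord2 \<gamma>" for \<gamma> x y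
    unfolding char_poly_act[OF that(1)] char_poly_mult[OF that(1)] that(2,3) u_def v_def
    by (rule char_poly_matrix2_eq_iff[OF S.R.is_cring]) (use that(1) in simp_all)
  have sq: "?sq \<longleftrightarrow> u = \<ominus> (a \<otimes> c) \<and> v = b"
  proof
    assume ?sq
    then have "u = B.coord1 (((\<ominus> (a \<otimes> c)) \<odot>\<^bsub>S\<^esub> \<one>\<^bsub>S\<^esub>) \<oplus>\<^bsub>S\<^esub> (b \<odot>\<^bsub>S\<^esub> \<alpha>))"
      "v = B.coord2 (((\<ominus> (a \<otimes> c)) \<odot>\<^bsub>S\<^esub> \<one>\<^bsub>S\<^esub>) \<oplus>\<^bsub>S\<^esub> (b \<odot>\<^bsub>S\<^esub> \<alpha>))"
      by (simp_all only: u_def v_def)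
    then show "u = \<ominus> (a \<otimes> c) \<and> v = b" by simp
  next
    assume "u = \<ominus> (a \<otimes> c) \<and> v = b"
    then show ?sq by (intro B.coord_eqI) (simp_all add: u_def v_def)
  qed
  show ?thesis
  proof
    assume "pseudoregular R S J"
    then have "char_poly2 R S (\<lambda>z. \<alpha> \<otimes>\<^bsub>S\<^esub> z) = char_poly2 R M (\<lambda>z. \<alpha> \<odot>\<^bsub>J\<^esub> z)"
      by (simp add: pseudoregular_def)
    \<comment> \<open>The element \<alpha> has coordinates (0, 1) in the basis 1, \<alpha>, so x = 0
      and y = 1.\<close>
    from iff[OF \<open>\<alpha> \<in> carrier S\<close> B.coord_e(3)[symmetric] B.coord_e(4)[symmetric], THEN iffD1, OF this]
    have "v = b \<and> det2 R \<zero> u \<one> v = det2 R b c (\<ominus> a) \<zero>"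
      by auto
    then have "v = b" and "det2 R \<zero> u \<one> v = det2 R b c (\<ominus> a) \<zero>" by blast+
    then have "\<ominus> u = a \<otimes> c"
      by (simp add: det2_def S.R.minus_eq S.R.r_minus S.R.m_comm)
    then have "u = \<ominus> (a \<otimes> c)" using uv(1) by (metis S.R.minus_minus)
    with \<open>v = b\<close> show ?sq by (simp add: sq)
  next
    assume ?sq
    then have uv': "u = \<ominus> (a \<otimes> c)" "v = b" by (simp_all add: sq)
    show "pseudoregular R S J"
      unfolding pseudoregular_def
    proof (intro conjI ballI)
      show "module S J" by (rule J.module_axioms)
      show "free_rank2 R M"
        unfolding free_rank2_def using M.module_axioms basis_J by blast
      fix \<gamma> assume g: "\<gamma> \<in> carrier S"
      define x y where "x = B.coord1 \<gamma>" and "y = B.coord2 \<gamma>"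
      have xy: "x \<in> carrier R" "y \<in> carrier R" using g by (simp_all add: x_def y_def)
      show "char_poly2 R S (\<lambda>z. \<gamma> \<otimes>\<^bsub>S\<^esub> z) = char_poly2 R M (\<lambda>z. \<gamma> \<odot>\<^bsub>J\<^esub> z)"
        unfolding iff[OF g x_def y_def] det2_def uv'
      proof
        show "x \<oplus> (x \<oplus> y \<otimes> b) = x \<oplus> y \<otimes> b \<oplus> x"
          using xy abc by algebra
        show "x \<otimes> (x \<oplus> y \<otimes> b) \<ominus> y \<otimes> (\<ominus> (a \<otimes> c)) \<otimes> y = (x \<oplus> y \<otimes> b) \<otimes> x \<ominus> y \<otimes> c \<otimes> (\<ominus> (y \<otimes> a))"
          using xy abc by algebra
      qed
    qed
  qed
qed

text \<open>The determinant of \<alpha> x against x is (b x1 + c x2) x2 + a x1 x1. The sign in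
  \<alpha> e1 = b e1 - a e2 is what makes the leading coefficient \<open>a\<close>.\<close>

lemma coord_det_act:
  assumes x: "x \<in> carrier J"
  shows "M.coord_det (\<alpha> \<odot>\<^bsub>J\<^esub> x) x = binary_form R a b c (M.coord1 x, M.coord2 x)"
proof -
  have "M.coord1 x \<in> carrier R" "M.coord2 x \<in> carrier R" using x by simp_all
  with abc show ?thesis
    unfolding M.coord_det_def coord_act[OF x] binary_form_def prod.case by algebra
qed

lemma good_frame: "good_frame R S J \<alpha> e1 e2"
  unfolding good_frame_def using basis_S basis_J abc(3) act_e2 by blast

lemma form_in_frame:
  "form_in_frame R S J \<alpha> e1 e2 (\<lambda>x. binary_form R a b c (M.coord1 x, M.coord2 x))"
  unfolding form_in_frame_def Let_def
proof (intro conjI ballI funcsetI)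
  fix x assume x: "x \<in> carrier J"
  then show "binary_form R a b c (M.coord1 x, M.coord2 x) \<in> carrier R"
    by (simp add: binary_form_def)
  show "wedge R M (\<alpha> \<odot>\<^bsub>J\<^esub> x) x = binary_form R a b c (M.coord1 x, M.coord2 x) \<odot>\<^bsub>ext_square R M\<^esub> wedge R M e1 e2"
    using M.wedge_eq[of "\<alpha> \<odot>\<^bsub>J\<^esub> x" x] x by (simp add: coord_det_act)
qed

lemma associated_form_similar:
  assumes "associated_form R S J Q"
  shows "similar_forms R M Q (std_module2 R) (binary_form R a b c)"
proof -
  obtain \<beta> g1 g2 where bg: "good_frame R S J \<beta> g1 g2" "form_in_frame R S J \<beta> g1 g2 Q"
    using assms by (auto simp: associated_form_def)
  have b: "is_basis2 R S \<one>\<^bsub>S\<^esub> \<beta>" and g: "is_basis2 R M g1 g2"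
    using bg(1) by (auto simp: good_frame_def)
  have Q: "x \<in> carrier J \<Longrightarrow> Q x \<in> carrier R"
      "x \<in> carrier J \<Longrightarrow> wedge R M (\<beta> \<odot>\<^bsub>J\<^esub> x) x = Q x \<odot>\<^bsub>ext_square R M\<^esub> wedge R M g1 g2" for x
    using bg(2) by (auto simp: form_in_frame_def Let_def)
  have [simp]: "\<beta> \<in> carrier S" "g1 \<in> carrier J" "g2 \<in> carrier J"
    using b g by (simp_all add: is_basis2_def)
  let ?w = "B.coord2 \<beta>" and ?d = "M.coord_det g1 g2"
  \<comment> \<open>The coefficient of \<alpha> in \<beta> is the determinant of the change from 1,
    \<alpha> to 1, \<beta>, hence a unit.\<close>
  have "B.coord_det \<one>\<^bsub>S\<^esub> \<beta> = ?w" by (simp add: B.coord_det_def S.R.minus_eq)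
  then have w: "?w \<in> Units R" using B.coord_det_basis_unit[OF b] by simp
  have d: "?d \<in> Units R" by (rule M.coord_det_basis_unit[OF g])
  have "binary_form R a b c (M.coord1 x, M.coord2 x) = (inv ?w \<otimes> ?d) \<otimes> Q x" if x: "x \<in> carrier J" for x
  proof -
    let ?q = "binary_form R a b c (M.coord1 x, M.coord2 x)"
    have q: "?q \<in> carrier R" using x by (simp add: binary_form_def)
    have cc: "M.coord1 x \<in> carrier R" "M.coord2 x \<in> carrier R" "M.coord1 (\<alpha> \<odot>\<^bsub>J\<^esub> x) \<in> carrier R"
      "M.coord2 (\<alpha> \<odot>\<^bsub>J\<^esub> x) \<in> carrier R" "B.coord1 \<beta> \<in> carrier R" "B.coord2 \<beta> \<in> carrier R"
      using x by simp_all
    interpret L: module R "ext_square R M" by (rule M.ext.ext_square_module)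
    \<comment> \<open>The component of \<beta> along 1 contributes a multiple of the determinant of
      x against itself, which is zero.\<close>
    have "M.coord_det (\<beta> \<odot>\<^bsub>J\<^esub> x) x = ?w \<otimes> M.coord_det (\<alpha> \<odot>\<^bsub>J\<^esub> x) x"
    proof -
      have "M.coord1 (\<beta> \<odot>\<^bsub>J\<^esub> x) = B.coord1 \<beta> \<otimes> M.coord1 x \<oplus> ?w \<otimes> M.coord1 (\<alpha> \<odot>\<^bsub>J\<^esub> x)"
        "M.coord2 (\<beta> \<odot>\<^bsub>J\<^esub> x) = B.coord1 \<beta> \<otimes> M.coord2 x \<oplus> ?w \<otimes> M.coord2 (\<alpha> \<odot>\<^bsub>J\<^esub> x)"
        using x by (simp_all add: act_decomp[of \<beta>])
      then show ?thesis
        unfolding M.coord_det_def using cc by (simp only:) algebra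
    qed
    also have "M.coord_det (\<beta> \<odot>\<^bsub>J\<^esub> x) x = Q x \<otimes> ?d"
      using M.wedge_smult_coord_det[of \<one> "Q x" "\<beta> \<odot>\<^bsub>J\<^esub> x" x g1 g2] Q[OF x] x
      by (simp add: M.ext.wedge_closed)
    finally have eq: "Q x \<otimes> ?d = ?w \<otimes> ?q" by (simp add: coord_det_act x)
    have "?q = inv ?w \<otimes> (?w \<otimes> ?q)"
      using w q S.R.Units_closed by (simp add: S.R.m_assoc[symmetric] S.R.Units_l_inv)
    also have "\<dots> = (inv ?w \<otimes> ?d) \<otimes> Q x"
      using w d Q(1)[OF x] by (simp add: eq[symmetric] S.R.m_ac S.R.Units_closed)
    finally show ?thesis .
  qed
  moreover have "inv ?w \<otimes> ?d \<in> Units R" using w d by simp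
  ultimately show ?thesis
    \<comment> \<open>The required isomorphism is the coordinate map of the frame \<open>e1\<close>,
      \<open>e2\<close>; the frame belonging to Q enters only through the unit.\<close>
    unfolding similar_forms_def restrict_scalars_carrier
    by (intro bexI[OF _ M.coord_iso_std] bexI[of _ "inv ?w \<otimes> ?d"] ballI)
qed

end

section \<open>Two framed modules and functionals on their tensor product\<close>

text \<open>Uniqueness of coefficients follows from any two functions that read them off; no
  linearity is asked of \<open>k1\<close> and \<open>k2\<close>.\<close>

lemma is_basis2I:
  assumes "e1 \<in> carrier M" "e2 \<in> carrier M"
    and "\<And>x. x \<in> carrier M \<Longrightarrow> \<exists>u \<in> carrier R. \<exists>v \<in> carrier R. x = (u \<odot>\<^bsub>M\<^esub> e1) \<oplus>\<^bsub>M\<^esub> (v \<odot>\<^bsub>M\<^esub> e2)"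
    and "\<And>u v. u \<in> carrier R \<Longrightarrow> v \<in> carrier R \<Longrightarrow> k1 ((u \<odot>\<^bsub>M\<^esub> e1) \<oplus>\<^bsub>M\<^esub> (v \<odot>\<^bsub>M\<^esub> e2)) = u"
    and "\<And>u v. u \<in> carrier R \<Longrightarrow> v \<in> carrier R \<Longrightarrow> k2 ((u \<odot>\<^bsub>M\<^esub> e1) \<oplus>\<^bsub>M\<^esub> (v \<odot>\<^bsub>M\<^esub> e2)) = v"
  shows "is_basis2 R M e1 e2"
  unfolding is_basis2_def
proof (intro conjI ballI assms(1,2))
  fix x assume "x \<in> carrier M"
  then obtain u v where uv: "u \<in> carrier R" "v \<in> carrier R" "x = (u \<odot>\<^bsub>M\<^esub> e1) \<oplus>\<^bsub>M\<^esub> (v \<odot>\<^bsub>M\<^esub> e2)"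
    using assms(3) by blast
  show "\<exists>!p. p \<in> carrier R \<times> carrier R \<and> x = (fst p \<odot>\<^bsub>M\<^esub> e1) \<oplus>\<^bsub>M\<^esub> (snd p \<odot>\<^bsub>M\<^esub> e2)"
  proof (rule ex1I[of _ "(u, v)"])
    fix p assume p: "p \<in> carrier R \<times> carrier R \<and> x = (fst p \<odot>\<^bsub>M\<^esub> e1) \<oplus>\<^bsub>M\<^esub> (snd p \<odot>\<^bsub>M\<^esub> e2)"
    then have "fst p = u" "snd p = v"
      using assms(4,5)[of "fst p" "snd p"] assms(4,5)[OF uv(1,2)] uv(3) by auto
    then show "p = (u, v)" by auto
  qed (use uv in simp)
qed

context framed_module begin

lemma basis_shift:
  assumes k: "k \<in> carrier R"
  shows "is_basis2 R S \<one>\<^bsub>S\<^esub> (\<alpha> \<oplus>\<^bsub>S\<^esub> (k \<odot>\<^bsub>S\<^esub> \<one>\<^bsub>S\<^esub>))"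
\<comment> \<open>Substituting \<alpha> = \<beta> - k turns x1 + x2 \<alpha> into (x1 - k x2) + x2
  \<beta>.\<close>
proof (rule is_basis2I[where ?k1.0 = "\<lambda>x. B.coord1 x \<ominus> k \<otimes> B.coord2 x" and ?k2.0 = B.coord2])
  have [simp]: "\<alpha> \<in> carrier S" by (rule B.basis_closed)
  show "\<one>\<^bsub>S\<^esub> \<in> carrier S" "\<alpha> \<oplus>\<^bsub>S\<^esub> (k \<odot>\<^bsub>S\<^esub> \<one>\<^bsub>S\<^esub>) \<in> carrier S"
    using k by simp_all
  have cancel: "u \<oplus> v \<otimes> k \<ominus> k \<otimes> v = u" "(u \<ominus> k \<otimes> v) \<oplus> v \<otimes> k = u"
    if "u \<in> carrier R" "v \<in> carrier R" for u v
    using that k by algebra+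
  fix x assume x: "x \<in> carrier S"
  show "\<exists>u\<in>carrier R. \<exists>v\<in>carrier R. x = (u \<odot>\<^bsub>S\<^esub> \<one>\<^bsub>S\<^esub>) \<oplus>\<^bsub>S\<^esub> (v \<odot>\<^bsub>S\<^esub> (\<alpha> \<oplus>\<^bsub>S\<^esub> (k \<odot>\<^bsub>S\<^esub> \<one>\<^bsub>S\<^esub>)))"
  proof (intro bexI)
    show "x = ((B.coord1 x \<ominus> k \<otimes> B.coord2 x) \<odot>\<^bsub>S\<^esub> \<one>\<^bsub>S\<^esub>) \<oplus>\<^bsub>S\<^esub> (B.coord2 x \<odot>\<^bsub>S\<^esub> (\<alpha> \<oplus>\<^bsub>S\<^esub> (k \<odot>\<^bsub>S\<^esub> \<one>\<^bsub>S\<^esub>)))"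
      by (rule B.coord_eqI) (use x k in \<open>simp_all add: cancel\<close>)
  qed (use x k in simp_all)
next
  have [simp]: "\<alpha> \<in> carrier S" by (rule B.basis_closed)
  fix u v assume uv: "u \<in> carrier R" "v \<in> carrier R"
  let ?x = "(u \<odot>\<^bsub>S\<^esub> \<one>\<^bsub>S\<^esub>) \<oplus>\<^bsub>S\<^esub> (v \<odot>\<^bsub>S\<^esub> (\<alpha> \<oplus>\<^bsub>S\<^esub> (k \<odot>\<^bsub>S\<^esub> \<one>\<^bsub>S\<^esub>)))"
  have c: "B.coord1 ?x = u \<oplus> v \<otimes> k" "B.coord2 ?x = v"
    using uv k by simp_all
  show "B.coord1 ?x \<ominus> k \<otimes> B.coord2 ?x = u"
    unfolding c using uv k by algebra
  show "B.coord2 ?x = v" by (rule c)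
qed

lemma shift_square:
  assumes "k \<in> carrier R" "n \<in> carrier R" and sq: "\<alpha> \<otimes>\<^bsub>S\<^esub> \<alpha> = (n \<odot>\<^bsub>S\<^esub> \<one>\<^bsub>S\<^esub>) \<oplus>\<^bsub>S\<^esub> (b \<odot>\<^bsub>S\<^esub> \<alpha>)"
  defines "\<beta> \<equiv> \<alpha> \<oplus>\<^bsub>S\<^esub> (k \<odot>\<^bsub>S\<^esub> \<one>\<^bsub>S\<^esub>)"
  shows "B.coord1 (\<beta> \<otimes>\<^bsub>S\<^esub> \<beta>) = n \<oplus> k \<otimes> k" and "B.coord2 (\<beta> \<otimes>\<^bsub>S\<^esub> \<beta>) = b \<oplus> (k \<oplus> k)"
proof -
  have [simp]: "\<alpha> \<in> carrier S" by (rule B.basis_closed)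
  have "\<beta> \<otimes>\<^bsub>S\<^esub> \<beta> = (\<alpha> \<otimes>\<^bsub>S\<^esub> \<alpha> \<oplus>\<^bsub>S\<^esub> (k \<odot>\<^bsub>S\<^esub> \<alpha>)) \<oplus>\<^bsub>S\<^esub> ((k \<odot>\<^bsub>S\<^esub> \<alpha>) \<oplus>\<^bsub>S\<^esub> (k \<odot>\<^bsub>S\<^esub> (k \<odot>\<^bsub>S\<^esub> \<one>\<^bsub>S\<^esub>)))"
    using assms(1) S.smult_assoc2[of k "\<one>\<^bsub>S\<^esub>"] S.m_comm[of \<alpha> "k \<odot>\<^bsub>S\<^esub> \<one>\<^bsub>S\<^esub>"]
    by (simp add: \<beta>_def S.l_distr S.r_distr)
  then show "B.coord1 (\<beta> \<otimes>\<^bsub>S\<^esub> \<beta>) = n \<oplus> k \<otimes> k" "B.coord2 (\<beta> \<otimes>\<^bsub>S\<^esub> \<beta>) = b \<oplus> (k \<oplus> k)"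
    using assms by (simp_all add: S.R.a_assoc)
qed

end

section \<open>Bilinear forms with a given 2 by 2 Gram matrix, in bare coordinates\<close>

definition bilin2 :: "('a, 'k) ring_scheme \<Rightarrow> 'a \<Rightarrow> 'a \<Rightarrow> 'a \<Rightarrow> 'a \<Rightarrow> 'a \<Rightarrow> 'a \<Rightarrow> 'a \<Rightarrow> 'a \<Rightarrow> 'a" where
  "bilin2 R p11 p12 p21 p22 x1 x2 y1 y2 =
     x1 \<otimes>\<^bsub>R\<^esub> (y1 \<otimes>\<^bsub>R\<^esub> p11 \<oplus>\<^bsub>R\<^esub> y2 \<otimes>\<^bsub>R\<^esub> p12) \<oplus>\<^bsub>R\<^esub> x2 \<otimes>\<^bsub>R\<^esub> (y1 \<otimes>\<^bsub>R\<^esub> p21 \<oplus>\<^bsub>R\<^esub> y2 \<otimes>\<^bsub>R\<^esub> p22)"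

context cring begin

context
  fixes p11 p12 p21 p22
  assumes p: "p11 \<in> carrier R" "p12 \<in> carrier R" "p21 \<in> carrier R" "p22 \<in> carrier R"
begin

lemma bilin2_closed:
  assumes "x1 \<in> carrier R" "x2 \<in> carrier R" "y1 \<in> carrier R" "y2 \<in> carrier R"
  shows "bilin2 R p11 p12 p21 p22 x1 x2 y1 y2 \<in> carrier R"
  using assms p by (simp add: bilin2_def)

lemma bilin2_add:
  assumes "x1 \<in> carrier R" "x2 \<in> carrier R" "y1 \<in> carrier R" "y2 \<in> carrier R" "z1 \<in> carrier R" "z2 \<in> carrier R"
  shows "bilin2 R p11 p12 p21 p22 (x1 \<oplus> z1) (x2 \<oplus> z2) y1 y2
      = bilin2 R p11 p12 p21 p22 x1 x2 y1 y2 \<oplus> bilin2 R p11 p12 p21 p22 z1 z2 y1 y2"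
    and "bilin2 R p11 p12 p21 p22 x1 x2 (y1 \<oplus> z1) (y2 \<oplus> z2)
      = bilin2 R p11 p12 p21 p22 x1 x2 y1 y2 \<oplus> bilin2 R p11 p12 p21 p22 x1 x2 z1 z2"
  unfolding bilin2_def using assms p by algebra+

lemma bilin2_smult:
  assumes "u \<in> carrier R" "x1 \<in> carrier R" "x2 \<in> carrier R" "y1 \<in> carrier R" "y2 \<in> carrier R"
  shows "bilin2 R p11 p12 p21 p22 (u \<otimes> x1) (u \<otimes> x2) y1 y2 = u \<otimes> bilin2 R p11 p12 p21 p22 x1 x2 y1 y2"
    and "bilin2 R p11 p12 p21 p22 x1 x2 (u \<otimes> y1) (u \<otimes> y2) = u \<otimes> bilin2 R p11 p12 p21 p22 x1 x2 y1 y2"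
  unfolding bilin2_def using assms p by algebra+

text \<open>The four equations say that \<open>\<alpha> e\<^sub>i\<close> paired with \<open>e\<^sub>j'\<close> equals \<open>e\<^sub>i\<close> paired with \<open>\<alpha> e\<^sub>j'\<close>,
  for the form with the values \<open>p\<^sub>i\<^sub>j\<close> on the frames.\<close>

lemma bilin2_balanced:
  assumes "x1 \<in> carrier R" "x2 \<in> carrier R" "y1 \<in> carrier R" "y2 \<in> carrier R"
    and "a \<in> carrier R" "b \<in> carrier R" "c \<in> carrier R" "a' \<in> carrier R" "c' \<in> carrier R" "d \<in> carrier R" "r \<in> carrier R"
    and rels: "b \<otimes> p11 \<ominus> a \<otimes> p21 = d \<otimes> p11 \<ominus> a' \<otimes> p12"
      "b \<otimes> p12 \<ominus> a \<otimes> p22 = c' \<otimes> p11 \<ominus> r \<otimes> p12"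
      "c \<otimes> p11 = d \<otimes> p21 \<ominus> a' \<otimes> p22"
      "c \<otimes> p12 = c' \<otimes> p21 \<ominus> r \<otimes> p22"
  shows "bilin2 R p11 p12 p21 p22 (b \<otimes> x1 \<oplus> c \<otimes> x2) (\<ominus> (a \<otimes> x1)) y1 y2
      = bilin2 R p11 p12 p21 p22 x1 x2 (d \<otimes> y1 \<oplus> c' \<otimes> y2) (\<ominus> (a' \<otimes> y1) \<ominus> r \<otimes> y2)"
proof -
  \<comment> \<open>The terms are grouped by the monomials x_i y_j so that the left-hand sides of
    \<open>rels\<close> appear verbatim and can be rewritten.\<close>
  have "bilin2 R p11 p12 p21 p22 (b \<otimes> x1 \<oplus> c \<otimes> x2) (\<ominus> (a \<otimes> x1)) y1 y2
      = (x1 \<otimes> y1 \<otimes> (b \<otimes> p11 \<ominus> a \<otimes> p21) \<oplus> x1 \<otimes> y2 \<otimes> (b \<otimes> p12 \<ominus> a \<otimes> p22))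
        \<oplus> (x2 \<otimes> y1 \<otimes> (c \<otimes> p11) \<oplus> x2 \<otimes> y2 \<otimes> (c \<otimes> p12))"
    unfolding bilin2_def using assms(1-7) p by algebra
  also have "\<dots> = bilin2 R p11 p12 p21 p22 x1 x2 (d \<otimes> y1 \<oplus> c' \<otimes> y2) (\<ominus> (a' \<otimes> y1) \<ominus> r \<otimes> y2)"
    unfolding bilin2_def rels using assms(1-4,8-11) p by algebra
  finally show ?thesis .
qed

end

end

locale framed_pair = I: framed_module R S I \<alpha> e1 e2 a b c + I': framed_module R S I' \<alpha>' e1' e2' a' b' c'
  for R :: "'r ring" (structure) and S :: "('r, 's) module" and I :: "('s, 'i) module" and I' :: "('s, 'j) module"
    and \<alpha> e1 e2 a b c \<alpha>' e1' e2' a' b' c' +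
  fixes r :: 'r
  assumes r [simp]: "r \<in> carrier R"
    and shift: "\<alpha>' = \<alpha> \<oplus>\<^bsub>S\<^esub> (r \<odot>\<^bsub>S\<^esub> \<one>\<^bsub>S\<^esub>)"
    and pseudoregular: "pseudoregular R S I" "pseudoregular R S I'"
begin

sublocale tensor S I I'
  by (intro tensor.intro I.J.module_axioms I'.J.module_axioms)

sublocale T: algebra_module R S T
  by (intro algebra_module.intro I.S.algebra_axioms tensor_product_module)

lemma alpha_closed [simp]: "\<alpha> \<in> carrier S" "\<alpha>' \<in> carrier S"
  using I.B.basis_closed I'.B.basis_closed by simp_all

text \<open>The square of \<alpha>' is computed in the basis 1, \<alpha> in two ways: by squaring
  \<alpha> + r with the quadratic equation belonging to \<open>I\<close>, and from the quadratic
  equation belonging to \<open>I'\<close>. Comparing coordinates gives both identities.\<close>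

lemma compat: "b' = b \<oplus> (r \<oplus> r)" "a' \<otimes> c' = (a \<otimes> c \<oplus> b \<otimes> r) \<oplus> r \<otimes> r"
proof -
  have sq: "\<alpha> \<otimes>\<^bsub>S\<^esub> \<alpha> = ((\<ominus> (a \<otimes> c)) \<odot>\<^bsub>S\<^esub> \<one>\<^bsub>S\<^esub>) \<oplus>\<^bsub>S\<^esub> (b \<odot>\<^bsub>S\<^esub> \<alpha>)"
    using I.pseudoregular_iff pseudoregular(1) by simp
  have sq': "\<alpha>' \<otimes>\<^bsub>S\<^esub> \<alpha>' = ((\<ominus> (a' \<otimes> c')) \<odot>\<^bsub>S\<^esub> \<one>\<^bsub>S\<^esub>) \<oplus>\<^bsub>S\<^esub> (b' \<odot>\<^bsub>S\<^esub> \<alpha>')"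
    using I'.pseudoregular_iff pseudoregular(2) by simp
  have l: "I.B.coord1 (\<alpha>' \<otimes>\<^bsub>S\<^esub> \<alpha>') = \<ominus> (a \<otimes> c) \<oplus> r \<otimes> r" "I.B.coord2 (\<alpha>' \<otimes>\<^bsub>S\<^esub> \<alpha>') = b \<oplus> (r \<oplus> r)"
    using I.shift_square[OF r _ sq] by (simp_all add: shift)
  have "I.B.coord1 (\<alpha>' \<otimes>\<^bsub>S\<^esub> \<alpha>') = \<ominus> (a' \<otimes> c') \<oplus> b' \<otimes> r" "I.B.coord2 (\<alpha>' \<otimes>\<^bsub>S\<^esub> \<alpha>') = b'"
    unfolding sq' by (simp_all add: shift)
  with l show b': "b' = b \<oplus> (r \<oplus> r)" by simp
  have n: "\<ominus> (a' \<otimes> c') \<oplus> b' \<otimes> r = \<ominus> (a \<otimes> c) \<oplus> r \<otimes> r"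
    using l \<open>I.B.coord1 (\<alpha>' \<otimes>\<^bsub>S\<^esub> \<alpha>') = \<ominus> (a' \<otimes> c') \<oplus> b' \<otimes> r\<close> by simp
  have "a' \<otimes> c' = b' \<otimes> r \<ominus> (\<ominus> (a' \<otimes> c') \<oplus> b' \<otimes> r)"
    using I'.abc r by algebra
  also have "\<dots> = (a \<otimes> c \<oplus> b \<otimes> r) \<oplus> r \<otimes> r"
    unfolding n unfolding b' using I.abc r by algebra
  finally show "a' \<otimes> c' = (a \<otimes> c \<oplus> b \<otimes> r) \<oplus> r \<otimes> r" .
qed

text \<open>Acting by \<alpha> is acting by \<alpha>' minus r, and b' - r equals b + r because b' =
  b + 2 r. This is the origin of the third entry of the row (a, a', b + r).\<close>

lemma coord_act':
  assumes y: "y \<in> carrier I'"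
  shows "I'.M.coord1 (\<alpha> \<odot>\<^bsub>I'\<^esub> y) = (b \<oplus> r) \<otimes> I'.M.coord1 y \<oplus> c' \<otimes> I'.M.coord2 y"
    and "I'.M.coord2 (\<alpha> \<odot>\<^bsub>I'\<^esub> y) = \<ominus> (a' \<otimes> I'.M.coord1 y) \<ominus> r \<otimes> I'.M.coord2 y"
proof -
  have cc: "I'.M.coord1 y \<in> carrier R" "I'.M.coord2 y \<in> carrier R" using y by simp_all
  have "\<alpha>' \<odot>\<^bsub>I'\<^esub> y = (\<alpha> \<odot>\<^bsub>I'\<^esub> y) \<oplus>\<^bsub>I'.M\<^esub> (r \<odot>\<^bsub>I'.M\<^esub> y)"
    using y by (simp add: shift I'.act_plus I'.act_scalar)
  then have "I'.M.coord1 (\<alpha>' \<odot>\<^bsub>I'\<^esub> y) = I'.M.coord1 (\<alpha> \<odot>\<^bsub>I'\<^esub> y) \<oplus> r \<otimes> I'.M.coord1 y"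
    "I'.M.coord2 (\<alpha>' \<odot>\<^bsub>I'\<^esub> y) = I'.M.coord2 (\<alpha> \<odot>\<^bsub>I'\<^esub> y) \<oplus> r \<otimes> I'.M.coord2 y"
    using y by simp_all
  note eq = this[unfolded I'.coord_act[OF y] compat(1)]
  have z: "I'.M.coord1 (\<alpha> \<odot>\<^bsub>I'\<^esub> y) \<in> carrier R" "I'.M.coord2 (\<alpha> \<odot>\<^bsub>I'\<^esub> y) \<in> carrier R"
    using y by simp_all
  have "I'.M.coord1 (\<alpha> \<odot>\<^bsub>I'\<^esub> y) = (I'.M.coord1 (\<alpha> \<odot>\<^bsub>I'\<^esub> y) \<oplus> r \<otimes> I'.M.coord1 y) \<ominus> r \<otimes> I'.M.coord1 y"
    "I'.M.coord2 (\<alpha> \<odot>\<^bsub>I'\<^esub> y) = (I'.M.coord2 (\<alpha> \<odot>\<^bsub>I'\<^esub> y) \<oplus> r \<otimes> I'.M.coord2 y) \<ominus> r \<otimes> I'.M.coord2 y"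
    using cc z r by algebra+
  note eq' = this[folded eq]
  show "I'.M.coord1 (\<alpha> \<odot>\<^bsub>I'\<^esub> y) = (b \<oplus> r) \<otimes> I'.M.coord1 y \<oplus> c' \<otimes> I'.M.coord2 y"
    unfolding eq'(1) using cc r I.abc I'.abc by algebra
  show "I'.M.coord2 (\<alpha> \<odot>\<^bsub>I'\<^esub> y) = \<ominus> (a' \<otimes> I'.M.coord1 y) \<ominus> r \<otimes> I'.M.coord2 y"
    by (rule eq'(2))
qed

text \<open>The hypotheses say that the bilinear map with the values \<open>p11\<close>, ...,
  \<open>p22\<close> on the frames is balanced for \<alpha>; it therefore lifts to the tensor
  product over \<open>S\<close>. The lemma is applied twice, once for each coordinate with respect
  to \<open>f1\<close>, \<open>f2\<close>.\<close>

lemma tensor_functional: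
  assumes p: "p11 \<in> carrier R" "p12 \<in> carrier R" "p21 \<in> carrier R" "p22 \<in> carrier R"
    and rel11: "b \<otimes> p11 \<ominus> a \<otimes> p21 = (b \<oplus> r) \<otimes> p11 \<ominus> a' \<otimes> p12"
    and rel12: "b \<otimes> p12 \<ominus> a \<otimes> p22 = c' \<otimes> p11 \<ominus> r \<otimes> p12"
    and rel21: "c \<otimes> p11 = (b \<oplus> r) \<otimes> p21 \<ominus> a' \<otimes> p22"
    and rel22: "c \<otimes> p12 = c' \<otimes> p21 \<ominus> r \<otimes> p22"
  obtains k where "k \<in> carrier T \<rightarrow> carrier R"
    "\<And>z w. z \<in> carrier T \<Longrightarrow> w \<in> carrier T \<Longrightarrow> k (z \<oplus>\<^bsub>T.M\<^esub> w) = k z \<oplus> k w"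
    "\<And>u z. u \<in> carrier R \<Longrightarrow> z \<in> carrier T \<Longrightarrow> k (u \<odot>\<^bsub>T.M\<^esub> z) = u \<otimes> k z"
    "k (te e1 e1') = p11" "k (te e1 e2') = p12" "k (te e2 e1') = p21" "k (te e2 e2') = p22"
proof -
  let ?x1 = I.M.coord1 and ?x2 = I.M.coord2 and ?y1 = I'.M.coord1 and ?y2 = I'.M.coord2
  define f where "f x y = bilin2 R p11 p12 p21 p22 (?x1 x) (?x2 x) (?y1 y) (?y2 y)" for x y
  note f = f_def I.S.R.bilin2_closed[OF p] I.S.R.bilin2_add[OF p] I.S.R.bilin2_smult[OF p]
  have fc: "f x y \<in> carrier R" if "x \<in> carrier I" "y \<in> carrier I'" for x y
    using that by (simp add: f)
  have fl: "f (x \<oplus>\<^bsub>I.M\<^esub> x') y = f x y \<oplus> f x' y"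
    if "x \<in> carrier I" "x' \<in> carrier I" "y \<in> carrier I'" for x x' y
    using that by (simp add: f)
  have fr: "f x (y \<oplus>\<^bsub>I'.M\<^esub> y') = f x y \<oplus> f x y'"
    if "x \<in> carrier I" "y \<in> carrier I'" "y' \<in> carrier I'" for x y y'
    using that by (simp add: f)
  have fsl: "f (u \<odot>\<^bsub>I.M\<^esub> x) y = u \<otimes> f x y"
    if "u \<in> carrier R" "x \<in> carrier I" "y \<in> carrier I'" for u x y
    using that by (simp add: f)
  have fsr: "f x (u \<odot>\<^bsub>I'.M\<^esub> y) = u \<otimes> f x y"
    if "u \<in> carrier R" "x \<in> carrier I" "y \<in> carrier I'" for u x y
    using that by (simp add: f)
  have fb: "f (\<alpha> \<odot>\<^bsub>I\<^esub> x) y = f x (\<alpha> \<odot>\<^bsub>I'\<^esub> y)" if "x \<in> carrier I" "y \<in> carrier I'" for x y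
    unfolding f_def I.coord_act[OF that(1)] coord_act'[OF that(2)]
    by (rule I.S.R.bilin2_balanced[OF p]) (use that rel11 rel12 rel21 rel22 in simp_all)
  \<comment> \<open>Since S = R + R \<alpha> and \<open>f\<close> is \<open>R\<close>-bilinear,
    being balanced for \<alpha> is enough.\<close>
  have bal: "f (\<gamma> \<odot>\<^bsub>I\<^esub> x) y = f x (\<gamma> \<odot>\<^bsub>I'\<^esub> y)" if c: "\<gamma> \<in> carrier S" "x \<in> carrier I" "y \<in> carrier I'" for \<gamma> x y
  proof -
    let ?u = "I.B.coord1 \<gamma>" and ?v = "I.B.coord2 \<gamma>"
    have uv: "?u \<in> carrier R" "?v \<in> carrier R" using c by simp_all
    have "\<gamma> \<odot>\<^bsub>I'\<^esub> y = ((?u \<odot>\<^bsub>S\<^esub> \<one>\<^bsub>S\<^esub>) \<oplus>\<^bsub>S\<^esub> (?v \<odot>\<^bsub>S\<^esub> \<alpha>)) \<odot>\<^bsub>I'\<^esub> y"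
      using c I.B.coord_decomp by simp
    then have "\<gamma> \<odot>\<^bsub>I'\<^esub> y = (?u \<odot>\<^bsub>I'.M\<^esub> y) \<oplus>\<^bsub>I'.M\<^esub> (?v \<odot>\<^bsub>I'.M\<^esub> (\<alpha> \<odot>\<^bsub>I'\<^esub> y))"
      using c uv by (simp add: I'.act_plus I'.act_scalar)
    then show ?thesis
      using c uv by (simp add: I.act_decomp[of \<gamma> x] fl fr fsl fsr fb)
  qed
  obtain k where k: "k \<in> carrier T \<rightarrow> carrier R"
    "\<And>z w. z \<in> carrier T \<Longrightarrow> w \<in> carrier T \<Longrightarrow> k (z \<oplus>\<^bsub>T\<^esub> w) = k z \<oplus> k w"
    "\<And>x y. x \<in> carrier I \<Longrightarrow> y \<in> carrier I' \<Longrightarrow> k (te x y) = f x y"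
    by (rule tensor_lift[of R f]) (use fc fl fr bal I.S.R.is_abelian_group in \<open>auto simp: restrict_scalars_ops\<close>)
  note add = k(2)[folded restrict_scalars_ops(1)[of R S]]
  have kz: "k \<zero>\<^bsub>T.M\<^esub> = \<zero>"
  proof -
    have "k \<zero>\<^bsub>T.M\<^esub> \<oplus> k \<zero>\<^bsub>T.M\<^esub> = k \<zero>\<^bsub>T.M\<^esub>"
      using add[of "\<zero>\<^bsub>T.M\<^esub>" "\<zero>\<^bsub>T.M\<^esub>"] T.M.M.zero_closed by simp
    moreover have "k \<zero>\<^bsub>T.M\<^esub> \<in> carrier R" using k(1) T.M.M.zero_closed by auto
    ultimately show ?thesis by simp
  qed
  have kd: "k (z \<ominus>\<^bsub>T.M\<^esub> w) = k z \<ominus> k w" if "z \<in> carrier T" "w \<in> carrier T" for z w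
  proof -
    have "k w \<in> carrier R" "k (\<ominus>\<^bsub>T.M\<^esub> w) \<in> carrier R" using k(1) that by auto
    moreover have "k w \<oplus> k (\<ominus>\<^bsub>T.M\<^esub> w) = \<zero>"
      using add[of w "\<ominus>\<^bsub>T.M\<^esub> w"] that kz by (simp add: T.M.M.r_neg)
    ultimately have "k (\<ominus>\<^bsub>T.M\<^esub> w) = \<ominus> k w"
      using I.S.R.minus_equality I.S.R.a_comm by metis
    then show ?thesis
      using add[of z "\<ominus>\<^bsub>T.M\<^esub> w"] that by (simp add: T.M.M.minus_eq I.S.R.minus_eq)
  qed
  \<comment> \<open>The lift is only additive. Homogeneity holds on pure tensors, where the scalar
    moves into the first factor, and passes to all elements through differences.\<close>
  have ks: "k (u \<odot>\<^bsub>T.M\<^esub> z) = u \<otimes> k z" if u: "u \<in> carrier R" and z: "z \<in> carrier T" for u z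
    using z
  proof (induction z rule: tensor_product_induct)
    case (diff z w)
    have kc: "k z \<in> carrier R" "k w \<in> carrier R" using diff k(1) by auto
    have "u \<odot>\<^bsub>T.M\<^esub> (z \<ominus>\<^bsub>T.M\<^esub> w) = (u \<odot>\<^bsub>T.M\<^esub> z) \<ominus>\<^bsub>T.M\<^esub> (u \<odot>\<^bsub>T.M\<^esub> w)"
      using diff u by (simp add: T.M.M.minus_eq T.M.smult_r_distr T.M.smult_r_minus)
    then have "k (u \<odot>\<^bsub>T.M\<^esub> (z \<ominus>\<^bsub>T.M\<^esub> w)) = u \<otimes> k (z \<ominus>\<^bsub>T.M\<^esub> w)"
      using diff u kc by (simp add: kd I.S.R.minus_eq I.S.R.r_distr I.S.R.r_minus)
    then show ?case by (simp add: restrict_scalars_ops)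
  next
    case (tensor x y)
    have "u \<odot>\<^bsub>T.M\<^esub> te x y = te (u \<odot>\<^bsub>I.M\<^esub> x) y"
      using tensor u by (simp add: restrict_scalars_ops tensor_elem_smult_left)
    then show ?case using tensor u by (simp add: k(3) fsl)
  next
    case zero
    show ?case using u kz T.M.smult_r_null[OF u] by (simp add: restrict_scalars_ops(2))
  qed
  show ?thesis
    by (rule that[OF k(1) add ks]) (use p in \<open>simp_all add: k(3) f_def bilin2_def\<close>)
qed

end

section \<open>Ring identities\<close>

locale composition_coeffs = cring R for R :: "'r ring" (structure) +
  fixes a b c a' c' r s s' t :: 'r
  assumes carr: "a \<in> carrier R" "b \<in> carrier R" "c \<in> carrier R" "a' \<in> carrier R" "c' \<in> carrier R"
      "r \<in> carrier R" "s \<in> carrier R" "s' \<in> carrier R" "t \<in> carrier R"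
    and unimodular: "s \<otimes> a \<oplus> s' \<otimes> a' \<oplus> t \<otimes> (b \<oplus> r) = \<one>"
    and compatible: "a' \<otimes> c' = (a \<otimes> c \<oplus> b \<otimes> r) \<oplus> r \<otimes> r"
begin

text \<open>The first coordinates of \<open>e\<^sub>i \<otimes> e\<^sub>j'\<close> with respect to \<open>f1\<close>, \<open>f2\<close>, then the shift from \<open>\<alpha>\<close> to
  \<open>\<alpha>''\<close> and the last two coefficients of the composed form.\<close>

definition "p12 = r \<otimes> s' \<oplus> c' \<otimes> t"
definition "p21 = c \<otimes> t \<ominus> r \<otimes> s"
definition "p22 = \<ominus> (s \<otimes> c' \<oplus> s' \<otimes> c)"
definition "frame_shift = a \<otimes> (r \<otimes> s \<ominus> c \<otimes> t)"
definition "mid_coeff = b \<ominus> [(2::nat)] \<cdot> (a \<otimes> (c \<otimes> t \<ominus> r \<otimes> s))"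
definition "last_coeff = c \<otimes> s' \<oplus> (s \<otimes> b \<oplus> c \<otimes> t) \<otimes> (c' \<otimes> t \<oplus> r \<otimes> s') \<oplus> (a \<otimes> s) \<otimes> (c \<otimes> s' \<oplus> c' \<otimes> s)"

lemmas coeff_defs = p12_def p21_def p22_def frame_shift_def last_coeff_def

lemma coeff_closed [simp]:
  "p12 \<in> carrier R" "p21 \<in> carrier R" "p22 \<in> carrier R" "frame_shift \<in> carrier R" "mid_coeff \<in> carrier R" "last_coeff \<in> carrier R"
  using carr by (simp_all add: coeff_defs mid_coeff_def)

lemma mid_coeff_eq: "mid_coeff = b \<oplus> (frame_shift \<oplus> frame_shift)"
proof -
  have "[(2::nat)] \<cdot> x = x \<oplus> x" if "x \<in> carrier R" for x
    using that by (simp add: numeral_2_eq_2)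
  then have "mid_coeff = b \<ominus> (a \<otimes> (c \<otimes> t \<ominus> r \<otimes> s) \<oplus> a \<otimes> (c \<otimes> t \<ominus> r \<otimes> s))"
    using carr by (simp add: mid_coeff_def)
  also have "\<dots> = b \<oplus> (frame_shift \<oplus> frame_shift)"
    unfolding frame_shift_def using carr by algebra
  finally show ?thesis .
qed

lemma p_rel11: "b \<otimes> \<one> \<ominus> a \<otimes> p21 = (b \<oplus> r) \<otimes> \<one> \<ominus> a' \<otimes> p12"
proof -
  \<comment> \<open>The two sides differ by an explicit combination of \<open>unimodular\<close> and
    \<open>compatible\<close>, each written as left side minus right side. This makes the first step
    an unconditional ring identity, and the second step sets both differences to zero. The same
    device proves \<open>p_rel12\<close> and \<open>p_rel21\<close>.\<close>
  have "b \<otimes> \<one> \<ominus> a \<otimes> p21 = ((b \<oplus> r) \<otimes> \<one> \<ominus> a' \<otimes> p12)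
      \<oplus> (r \<otimes> ((s \<otimes> a \<oplus> s' \<otimes> a' \<oplus> t \<otimes> (b \<oplus> r)) \<ominus> \<one>) \<oplus> t \<otimes> (a' \<otimes> c' \<ominus> ((a \<otimes> c \<oplus> b \<otimes> r) \<oplus> r \<otimes> r)))"
    unfolding p12_def p21_def using carr by algebra
  also have "\<dots> = (b \<oplus> r) \<otimes> \<one> \<ominus> a' \<otimes> p12"
    unfolding unimodular compatible using carr by (simp add: minus_eq r_neg)
  finally show ?thesis .
qed

lemma p_rel12: "b \<otimes> p12 \<ominus> a \<otimes> p22 = c' \<otimes> \<one> \<ominus> r \<otimes> p12"
proof -
  have "b \<otimes> p12 \<ominus> a \<otimes> p22 = (c' \<otimes> \<one> \<ominus> r \<otimes> p12)
      \<oplus> (c' \<otimes> ((s \<otimes> a \<oplus> s' \<otimes> a' \<oplus> t \<otimes> (b \<oplus> r)) \<ominus> \<one>) \<ominus> s' \<otimes> (a' \<otimes> c' \<ominus> ((a \<otimes> c \<oplus> b \<otimes> r) \<oplus> r \<otimes> r)))"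
    unfolding p12_def p22_def using carr by algebra
  also have "\<dots> = c' \<otimes> \<one> \<ominus> r \<otimes> p12"
    unfolding unimodular compatible using carr by (simp add: minus_eq r_neg)
  finally show ?thesis .
qed

lemma p_rel21: "c \<otimes> \<one> = (b \<oplus> r) \<otimes> p21 \<ominus> a' \<otimes> p22"
proof -
  have "c \<otimes> \<one> = ((b \<oplus> r) \<otimes> p21 \<ominus> a' \<otimes> p22)
      \<ominus> (c \<otimes> ((s \<otimes> a \<oplus> s' \<otimes> a' \<oplus> t \<otimes> (b \<oplus> r)) \<ominus> \<one>) \<oplus> s \<otimes> (a' \<otimes> c' \<ominus> ((a \<otimes> c \<oplus> b \<otimes> r) \<oplus> r \<otimes> r)))"
    unfolding p21_def p22_def using carr by algebra
  also have "\<dots> = (b \<oplus> r) \<otimes> p21 \<ominus> a' \<otimes> p22"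
    unfolding unimodular compatible using carr by (simp add: minus_eq r_neg)
  finally show ?thesis .
qed

lemma p_rel22: "c \<otimes> p12 = c' \<otimes> p21 \<ominus> r \<otimes> p22"
  unfolding p12_def p21_def p22_def using carr by algebra

text \<open>This is the value of the first coordinate functional at \<open>f2\<close>.\<close>

lemma p_sum: "s \<otimes> p12 \<oplus> s' \<otimes> p21 \<oplus> t \<otimes> p22 = \<zero>"
  unfolding p12_def p21_def p22_def using carr by algebra

text \<open>These are the balancing equations for the second coordinates 0, a, a', b + r. The first
  three are formal consequences of commutativity; the fourth is the compatibility a' c' = a c + b r
  + r^2.\<close>

lemma q_rels:
  "b \<otimes> \<zero> \<ominus> a \<otimes> a' = (b \<oplus> r) \<otimes> \<zero> \<ominus> a' \<otimes> a"
  "b \<otimes> a \<ominus> a \<otimes> (b \<oplus> r) = c' \<otimes> \<zero> \<ominus> r \<otimes> a"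
  "c \<otimes> \<zero> = (b \<oplus> r) \<otimes> a' \<ominus> a' \<otimes> (b \<oplus> r)"
  "c \<otimes> a = c' \<otimes> a' \<ominus> r \<otimes> (b \<oplus> r)"
proof -
  have "c' \<otimes> a' \<ominus> r \<otimes> (b \<oplus> r) = (a \<otimes> c \<oplus> b \<otimes> r \<oplus> r \<otimes> r) \<ominus> r \<otimes> (b \<oplus> r)"
    unfolding compatible[symmetric] using carr by (simp add: m_comm)
  also have "\<dots> = c \<otimes> a"
    using carr by algebra
  finally show "c \<otimes> a = c' \<otimes> a' \<ominus> r \<otimes> (b \<oplus> r)" by simp
  show "b \<otimes> \<zero> \<ominus> a \<otimes> a' = (b \<oplus> r) \<otimes> \<zero> \<ominus> a' \<otimes> a"
    "b \<otimes> a \<ominus> a \<otimes> (b \<oplus> r) = c' \<otimes> \<zero> \<ominus> r \<otimes> a"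
    "c \<otimes> \<zero> = (b \<oplus> r) \<otimes> a' \<ominus> a' \<otimes> (b \<oplus> r)"
    using carr by algebra+
qed

text \<open>The next three lemmas compare coefficients on the four tensors in
  \<open>e\<^sub>i \<otimes> e\<^sub>j' = p f1 + q f2 + v \<rho> + w \<rho>'\<close>, where \<open>\<rho>\<close> and \<open>\<rho>'\<close> are two of the three relations.\<close>

lemma expand12:
  "p12 \<oplus> (s' \<otimes> (\<ominus> r) \<oplus> t \<otimes> (\<ominus> c')) = \<zero>" "a \<otimes> s \<oplus> (s' \<otimes> a' \<oplus> t \<otimes> (b \<oplus> r)) = \<one>"
  "a \<otimes> s' \<oplus> (s' \<otimes> (\<ominus> a) \<oplus> t \<otimes> \<zero>) = \<zero>" "a \<otimes> t \<oplus> (s' \<otimes> \<zero> \<oplus> t \<otimes> (\<ominus> a)) = \<zero>"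
  unfolding unimodular[symmetric] p12_def using carr by algebra+

lemma expand21:
  "p21 \<oplus> ((\<ominus> s) \<otimes> (\<ominus> r) \<oplus> t \<otimes> (\<ominus> c)) = \<zero>" "a' \<otimes> s \<oplus> ((\<ominus> s) \<otimes> a' \<oplus> t \<otimes> \<zero>) = \<zero>"
  "a' \<otimes> s' \<oplus> ((\<ominus> s) \<otimes> (\<ominus> a) \<oplus> t \<otimes> (b \<oplus> r)) = \<one>" "a' \<otimes> t \<oplus> ((\<ominus> s) \<otimes> \<zero> \<oplus> t \<otimes> (\<ominus> a')) = \<zero>"
  unfolding unimodular[symmetric] p21_def using carr by algebra+

lemma expand22:
  "p22 \<oplus> ((\<ominus> s) \<otimes> (\<ominus> c') \<oplus> (\<ominus> s') \<otimes> (\<ominus> c)) = \<zero>"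
  "(b \<oplus> r) \<otimes> s \<oplus> ((\<ominus> s) \<otimes> (b \<oplus> r) \<oplus> (\<ominus> s') \<otimes> \<zero>) = \<zero>"
  "(b \<oplus> r) \<otimes> s' \<oplus> ((\<ominus> s) \<otimes> \<zero> \<oplus> (\<ominus> s') \<otimes> (b \<oplus> r)) = \<zero>"
  "(b \<oplus> r) \<otimes> t \<oplus> ((\<ominus> s) \<otimes> (\<ominus> a) \<oplus> (\<ominus> s') \<otimes> (\<ominus> a')) = \<one>"
  unfolding unimodular[symmetric] p22_def using carr by algebra+

text \<open>The two coordinates of \<alpha>'' f1, obtained from \<alpha> f1 = b f1 - a (e2 \<otimes>
  e1').\<close>

lemma action1:
  "(b \<oplus> (\<ominus> a) \<otimes> p21) \<oplus> frame_shift = mid_coeff" "(\<ominus> a) \<otimes> a' = \<ominus> (a \<otimes> a')"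
  unfolding mid_coeff_eq unfolding p21_def frame_shift_def using carr by algebra+

text \<open>The two coordinates of \<alpha>'' f2. Since \<open>f2\<close> has coordinates (0, 1),
  adding \<open>frame_shift\<close> to \<alpha> changes only the second one; its vanishing is what
  determines \<open>frame_shift\<close>.\<close>

lemma action2:
  "s \<otimes> (b \<otimes> p12 \<oplus> (\<ominus> a) \<otimes> p22) \<oplus> s' \<otimes> c \<oplus> t \<otimes> (c \<otimes> p12) = last_coeff"
  "(s \<otimes> (b \<otimes> a \<oplus> (\<ominus> a) \<otimes> (b \<oplus> r)) \<oplus> t \<otimes> (c \<otimes> a)) \<oplus> frame_shift = \<zero>"
  unfolding coeff_defs using carr by algebra+

text \<open>The analogue for \<alpha>'' of \<open>compatible\<close>, with
  \<open>frame_shift\<close> in place of r: both sides are the norm of \<alpha>''. The factor a' is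
  distributed onto \<open>p12\<close> and \<open>p22\<close>, where \<open>p_rel11\<close> and
  \<open>p_rel21\<close> eliminate it.\<close>

lemma norm_eq: "(a \<otimes> a') \<otimes> last_coeff = (a \<otimes> c \<oplus> b \<otimes> frame_shift) \<oplus> frame_shift \<otimes> frame_shift"
proof -
  note cl = carr coeff_closed
  have 1: "a' \<otimes> p12 = r \<oplus> a \<otimes> p21"
  proof -
    have "a' \<otimes> p12 = (b \<oplus> r) \<ominus> ((b \<oplus> r) \<otimes> \<one> \<ominus> a' \<otimes> p12)" using cl by algebra
    also have "\<dots> = r \<oplus> a \<otimes> p21" unfolding p_rel11[symmetric] using cl by algebra
    finally show ?thesis .
  qed
  have 2: "a' \<otimes> p22 = (b \<oplus> r) \<otimes> p21 \<ominus> c"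
  proof -
    have "a' \<otimes> p22 = (b \<oplus> r) \<otimes> p21 \<ominus> ((b \<oplus> r) \<otimes> p21 \<ominus> a' \<otimes> p22)" using cl by algebra
    also have "\<dots> = (b \<oplus> r) \<otimes> p21 \<ominus> c" unfolding p_rel21[symmetric] using cl by simp
    finally show ?thesis .
  qed
  have "(a \<otimes> a') \<otimes> last_coeff = a \<otimes> (c \<otimes> (a' \<otimes> s') \<oplus> (s \<otimes> b \<oplus> c \<otimes> t) \<otimes> (a' \<otimes> p12) \<ominus> (a \<otimes> s) \<otimes> (a' \<otimes> p22))"
    unfolding last_coeff_def p12_def p22_def using carr by algebra
  also have "\<dots> = a \<otimes> ((c \<ominus> b \<otimes> p21) \<oplus> a \<otimes> (p21 \<otimes> p21))"
  proof -
    \<comment> \<open>Trading c t for \<open>p21\<close> cancels the mixed terms. Trading it back in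
      one place supplies the summand t (b + r) that completes the \<open>unimodular\<close>
      sum.\<close>
    have ct: "c \<otimes> t = p21 \<oplus> r \<otimes> s" unfolding p21_def using carr by algebra
    have "c \<otimes> (a' \<otimes> s') \<oplus> (s \<otimes> b \<oplus> (p21 \<oplus> r \<otimes> s)) \<otimes> (r \<oplus> a \<otimes> p21) \<ominus> (a \<otimes> s) \<otimes> ((b \<oplus> r) \<otimes> p21 \<ominus> c)
      = (c \<otimes> (s \<otimes> a \<oplus> s' \<otimes> a') \<oplus> (p21 \<oplus> r \<otimes> s) \<otimes> (b \<oplus> r) \<ominus> b \<otimes> p21) \<oplus> a \<otimes> (p21 \<otimes> p21)"
      using cl by algebra
    also have "c \<otimes> (s \<otimes> a \<oplus> s' \<otimes> a') \<oplus> (p21 \<oplus> r \<otimes> s) \<otimes> (b \<oplus> r) = c \<otimes> (s \<otimes> a \<oplus> s' \<otimes> a' \<oplus> t \<otimes> (b \<oplus> r))"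
      unfolding ct[symmetric] using carr by algebra
    finally show ?thesis
      unfolding 1 2 ct unimodular using carr by simp
  qed
  also have "\<dots> = (a \<otimes> c \<oplus> b \<otimes> frame_shift) \<oplus> frame_shift \<otimes> frame_shift"
  proof -
    have frame_shift: "frame_shift = \<ominus> (a \<otimes> p21)" unfolding p21_def frame_shift_def using carr by algebra
    show ?thesis unfolding frame_shift using cl by algebra
  qed
  finally show ?thesis .
qed

end

lemma (in module) lincomb4_add:
  assumes "{u1, u2, u3, u4, v1, v2, v3, v4} \<subseteq> carrier R" "{g1, g2, g3, g4} \<subseteq> carrier M"
  shows "((u1 \<odot>\<^bsub>M\<^esub> g1 \<oplus>\<^bsub>M\<^esub> u2 \<odot>\<^bsub>M\<^esub> g2) \<oplus>\<^bsub>M\<^esub> (u3 \<odot>\<^bsub>M\<^esub> g3 \<oplus>\<^bsub>M\<^esub> u4 \<odot>\<^bsub>M\<^esub> g4))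
      \<oplus>\<^bsub>M\<^esub> ((v1 \<odot>\<^bsub>M\<^esub> g1 \<oplus>\<^bsub>M\<^esub> v2 \<odot>\<^bsub>M\<^esub> g2) \<oplus>\<^bsub>M\<^esub> (v3 \<odot>\<^bsub>M\<^esub> g3 \<oplus>\<^bsub>M\<^esub> v4 \<odot>\<^bsub>M\<^esub> g4))
    = ((u1 \<oplus> v1) \<odot>\<^bsub>M\<^esub> g1 \<oplus>\<^bsub>M\<^esub> (u2 \<oplus> v2) \<odot>\<^bsub>M\<^esub> g2) \<oplus>\<^bsub>M\<^esub> ((u3 \<oplus> v3) \<odot>\<^bsub>M\<^esub> g3 \<oplus>\<^bsub>M\<^esub> (u4 \<oplus> v4) \<odot>\<^bsub>M\<^esub> g4)"
  using assms by (simp add: smult_l_distr M.a_ac)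

lemma (in module) lincomb4_smult:
  assumes "{w, u1, u2, u3, u4} \<subseteq> carrier R" "{g1, g2, g3, g4} \<subseteq> carrier M"
  shows "w \<odot>\<^bsub>M\<^esub> ((u1 \<odot>\<^bsub>M\<^esub> g1 \<oplus>\<^bsub>M\<^esub> u2 \<odot>\<^bsub>M\<^esub> g2) \<oplus>\<^bsub>M\<^esub> (u3 \<odot>\<^bsub>M\<^esub> g3 \<oplus>\<^bsub>M\<^esub> u4 \<odot>\<^bsub>M\<^esub> g4))
    = ((w \<otimes> u1) \<odot>\<^bsub>M\<^esub> g1 \<oplus>\<^bsub>M\<^esub> (w \<otimes> u2) \<odot>\<^bsub>M\<^esub> g2) \<oplus>\<^bsub>M\<^esub> ((w \<otimes> u3) \<odot>\<^bsub>M\<^esub> g3 \<oplus>\<^bsub>M\<^esub> (w \<otimes> u4) \<odot>\<^bsub>M\<^esub> g4)"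
  using assms by (simp add: smult_r_distr smult_assoc1)

section \<open>The good frame of the tensor product\<close>

locale composition = framed_pair R S I I' \<alpha> e1 e2 a b c \<alpha>' e1' e2' a' b' c' r
  for R :: "'r ring" (structure) and S :: "('r, 's) module" and I :: "('s, 'i) module" and I' :: "('s, 'j) module"
    and \<alpha> e1 e2 a b c \<alpha>' e1' e2' a' b' c' r +
  fixes s s' t :: 'r
  assumes stc [simp]: "s \<in> carrier R" "s' \<in> carrier R" "t \<in> carrier R"
    and unimodular: "s \<otimes> a \<oplus> s' \<otimes> a' \<oplus> t \<otimes> (b \<oplus> r) = \<one>"
begin

sublocale coeffs: composition_coeffs R a b c a' c' r s s' t
  by unfold_locales (simp_all add: unimodular compat(2))

abbreviation "g11 \<equiv> te e1 e1'"
abbreviation "g12 \<equiv> te e1 e2'"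
abbreviation "g21 \<equiv> te e2 e1'"
abbreviation "g22 \<equiv> te e2 e2'"
definition "f2 = (s \<odot>\<^bsub>T.M\<^esub> g12) \<oplus>\<^bsub>T.M\<^esub> (s' \<odot>\<^bsub>T.M\<^esub> g21) \<oplus>\<^bsub>T.M\<^esub> (t \<odot>\<^bsub>T.M\<^esub> g22)"

lemma tensor_closed [simp]: "x \<in> carrier I \<Longrightarrow> y \<in> carrier I' \<Longrightarrow> te x y \<in> carrier T"
  by (rule tensor_elem_closed)

lemma tensor_add:
  "x \<in> carrier I \<Longrightarrow> x' \<in> carrier I \<Longrightarrow> y \<in> carrier I' \<Longrightarrow> te (x \<oplus>\<^bsub>I.M\<^esub> x') y = te x y \<oplus>\<^bsub>T.M\<^esub> te x' y"
  "x \<in> carrier I \<Longrightarrow> y \<in> carrier I' \<Longrightarrow> y' \<in> carrier I' \<Longrightarrow> te x (y \<oplus>\<^bsub>I'.M\<^esub> y') = te x y \<oplus>\<^bsub>T.M\<^esub> te x y'"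
  by (simp_all add: restrict_scalars_ops tensor_elem_add_left tensor_elem_add_right)

lemma tensor_smult:
  "u \<in> carrier R \<Longrightarrow> x \<in> carrier I \<Longrightarrow> y \<in> carrier I' \<Longrightarrow> te (u \<odot>\<^bsub>I.M\<^esub> x) y = u \<odot>\<^bsub>T.M\<^esub> te x y"
  "u \<in> carrier R \<Longrightarrow> x \<in> carrier I \<Longrightarrow> y \<in> carrier I' \<Longrightarrow> te x (u \<odot>\<^bsub>I'.M\<^esub> y) = u \<odot>\<^bsub>T.M\<^esub> te x y"
  by (simp_all add: restrict_scalars_ops tensor_elem_smult_left tensor_elem_smult_right)

lemma tensor_act:
  assumes "x \<in> carrier I" "y \<in> carrier I'"
  shows "\<alpha> \<odot>\<^bsub>T\<^esub> te x y = te (\<alpha> \<odot>\<^bsub>I\<^esub> x) y" and "te (\<alpha> \<odot>\<^bsub>I\<^esub> x) y = te x (\<alpha> \<odot>\<^bsub>I'\<^esub> y)"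
  using assms by (simp_all add: tensor_elem_smult_left tensor_elem_smult_right)

lemma act_frame:
  "\<alpha> \<odot>\<^bsub>I\<^esub> e1 = (b \<odot>\<^bsub>I.M\<^esub> e1) \<oplus>\<^bsub>I.M\<^esub> ((\<ominus> a) \<odot>\<^bsub>I.M\<^esub> e2)"
  "\<alpha> \<odot>\<^bsub>I'\<^esub> e1' = ((b \<oplus> r) \<odot>\<^bsub>I'.M\<^esub> e1') \<oplus>\<^bsub>I'.M\<^esub> ((\<ominus> a') \<odot>\<^bsub>I'.M\<^esub> e2')"
  "\<alpha> \<odot>\<^bsub>I'\<^esub> e2' = (c' \<odot>\<^bsub>I'.M\<^esub> e1') \<oplus>\<^bsub>I'.M\<^esub> ((\<ominus> r) \<odot>\<^bsub>I'.M\<^esub> e2')"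
proof -
  show "\<alpha> \<odot>\<^bsub>I\<^esub> e1 = (b \<odot>\<^bsub>I.M\<^esub> e1) \<oplus>\<^bsub>I.M\<^esub> ((\<ominus> a) \<odot>\<^bsub>I.M\<^esub> e2)"
    by (rule I.M.coord_eqI) (simp_all add: I.coord_act)
  show "\<alpha> \<odot>\<^bsub>I'\<^esub> e1' = ((b \<oplus> r) \<odot>\<^bsub>I'.M\<^esub> e1') \<oplus>\<^bsub>I'.M\<^esub> ((\<ominus> a') \<odot>\<^bsub>I'.M\<^esub> e2')"
    by (rule I'.M.coord_eqI) (simp_all add: coord_act' I.S.R.minus_eq)
  show "\<alpha> \<odot>\<^bsub>I'\<^esub> e2' = (c' \<odot>\<^bsub>I'.M\<^esub> e1') \<oplus>\<^bsub>I'.M\<^esub> ((\<ominus> r) \<odot>\<^bsub>I'.M\<^esub> e2')"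
    by (rule I'.M.coord_eqI) (simp_all add: coord_act' I.S.R.minus_eq)
qed

lemma act_tensor:
  "\<alpha> \<odot>\<^bsub>T\<^esub> g11 = (b \<odot>\<^bsub>T.M\<^esub> g11) \<oplus>\<^bsub>T.M\<^esub> ((\<ominus> a) \<odot>\<^bsub>T.M\<^esub> g21)"
  "\<alpha> \<odot>\<^bsub>T\<^esub> g12 = (b \<odot>\<^bsub>T.M\<^esub> g12) \<oplus>\<^bsub>T.M\<^esub> ((\<ominus> a) \<odot>\<^bsub>T.M\<^esub> g22)"
  "\<alpha> \<odot>\<^bsub>T\<^esub> g21 = c \<odot>\<^bsub>T.M\<^esub> g11"
  "\<alpha> \<odot>\<^bsub>T\<^esub> g22 = c \<odot>\<^bsub>T.M\<^esub> g12"
  by (simp_all add: tensor_act(1) act_frame(1) I.act_e2 tensor_add tensor_smult)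

text \<open>Here \<alpha> acts through the right factor, in \<open>act_tensor\<close> through the
  left one; equating the two gives \<open>relations\<close>.\<close>

lemma act_tensor':
  "\<alpha> \<odot>\<^bsub>T\<^esub> g11 = ((b \<oplus> r) \<odot>\<^bsub>T.M\<^esub> g11) \<oplus>\<^bsub>T.M\<^esub> ((\<ominus> a') \<odot>\<^bsub>T.M\<^esub> g12)"
  "\<alpha> \<odot>\<^bsub>T\<^esub> g12 = (c' \<odot>\<^bsub>T.M\<^esub> g11) \<oplus>\<^bsub>T.M\<^esub> ((\<ominus> r) \<odot>\<^bsub>T.M\<^esub> g12)"
  "\<alpha> \<odot>\<^bsub>T\<^esub> g21 = ((b \<oplus> r) \<odot>\<^bsub>T.M\<^esub> g21) \<oplus>\<^bsub>T.M\<^esub> ((\<ominus> a') \<odot>\<^bsub>T.M\<^esub> g22)"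
  by (simp_all add: tensor_act act_frame(2,3) tensor_add tensor_smult)

definition lin :: "'r \<Rightarrow> 'r \<Rightarrow> 'r \<Rightarrow> 'r \<Rightarrow> _" where
  "lin u1 u2 u3 u4 = (u1 \<odot>\<^bsub>T.M\<^esub> g11 \<oplus>\<^bsub>T.M\<^esub> u2 \<odot>\<^bsub>T.M\<^esub> g12) \<oplus>\<^bsub>T.M\<^esub> (u3 \<odot>\<^bsub>T.M\<^esub> g21 \<oplus>\<^bsub>T.M\<^esub> u4 \<odot>\<^bsub>T.M\<^esub> g22)"

lemma lin_closed: "{u1, u2, u3, u4} \<subseteq> carrier R \<Longrightarrow> lin u1 u2 u3 u4 \<in> carrier T"
  by (simp add: lin_def)

lemma lin_add:
  "{u1, u2, u3, u4, v1, v2, v3, v4} \<subseteq> carrier R \<Longrightarrow>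
    lin u1 u2 u3 u4 \<oplus>\<^bsub>T.M\<^esub> lin v1 v2 v3 v4 = lin (u1 \<oplus> v1) (u2 \<oplus> v2) (u3 \<oplus> v3) (u4 \<oplus> v4)"
  unfolding lin_def by (rule T.M.lincomb4_add) simp_all

lemma lin_smult:
  "{w, u1, u2, u3, u4} \<subseteq> carrier R \<Longrightarrow>
    w \<odot>\<^bsub>T.M\<^esub> lin u1 u2 u3 u4 = lin (w \<otimes> u1) (w \<otimes> u2) (w \<otimes> u3) (w \<otimes> u4)"
  unfolding lin_def by (rule T.M.lincomb4_smult) simp_all

lemma lin_relation:
  assumes u: "{u1, u2, u3, u4, v1, v2, v3, v4} \<subseteq> carrier R" and eq: "lin u1 u2 u3 u4 = lin v1 v2 v3 v4"
    and w: "w1 = u1 \<ominus> v1" "w2 = u2 \<ominus> v2" "w3 = u3 \<ominus> v3" "w4 = u4 \<ominus> v4"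
  shows "lin w1 w2 w3 w4 = \<zero>\<^bsub>T.M\<^esub>"
proof -
  have c: "lin v1 v2 v3 v4 \<in> carrier T" using u by (simp add: lin_closed)
  have "lin w1 w2 w3 w4 = lin u1 u2 u3 u4 \<oplus>\<^bsub>T.M\<^esub> ((\<ominus> \<one>) \<odot>\<^bsub>T.M\<^esub> lin v1 v2 v3 v4)"
    using u by (simp add: lin_smult lin_add w I.S.R.minus_eq I.S.R.l_minus)
  also have "\<dots> = \<zero>\<^bsub>T.M\<^esub>"
    using c by (simp add: eq T.M.smult_l_minus T.M.M.r_neg)
  finally show ?thesis .
qed

lemma relations:
  "lin (\<ominus> r) a' (\<ominus> a) \<zero> = \<zero>\<^bsub>T.M\<^esub>"
  "lin (\<ominus> c') (b \<oplus> r) \<zero> (\<ominus> a) = \<zero>\<^bsub>T.M\<^esub>"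
  "lin (\<ominus> c) \<zero> (b \<oplus> r) (\<ominus> a') = \<zero>\<^bsub>T.M\<^esub>"
proof -
  have m: "b \<oplus> \<ominus> (b \<oplus> r) = \<ominus> r"
    using I.abc r by algebra
  show "lin (\<ominus> r) a' (\<ominus> a) \<zero> = \<zero>\<^bsub>T.M\<^esub>"
  proof (rule lin_relation[of b \<zero> "\<ominus> a" \<zero> "b \<oplus> r" "\<ominus> a'" \<zero> \<zero>])
    show "lin b \<zero> (\<ominus> a) \<zero> = lin (b \<oplus> r) (\<ominus> a') \<zero> \<zero>"
      using act_tensor(1) act_tensor'(1) by (simp add: lin_def)
  qed (simp_all add: m I.S.R.minus_eq)
  show "lin (\<ominus> c') (b \<oplus> r) \<zero> (\<ominus> a) = \<zero>\<^bsub>T.M\<^esub>"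
  proof (rule lin_relation[of \<zero> b \<zero> "\<ominus> a" c' "\<ominus> r" \<zero> \<zero>])
    show "lin \<zero> b \<zero> (\<ominus> a) = lin c' (\<ominus> r) \<zero> \<zero>"
      using act_tensor(2) act_tensor'(2) by (simp add: lin_def)
  qed (simp_all add: I.S.R.minus_eq)
  show "lin (\<ominus> c) \<zero> (b \<oplus> r) (\<ominus> a') = \<zero>\<^bsub>T.M\<^esub>"
  proof (rule lin_relation[of \<zero> \<zero> "b \<oplus> r" "\<ominus> a'" c \<zero> \<zero> \<zero>])
    show "lin \<zero> \<zero> (b \<oplus> r) (\<ominus> a') = lin c \<zero> \<zero> \<zero>"
      using act_tensor(3) act_tensor'(3) by (simp add: lin_def)
  qed (simp_all add: I.S.R.minus_eq)
qed

lemma f2_closed [simp]: "f2 \<in> carrier T"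
  by (simp add: f2_def)

lemma lin_f:
  assumes "p \<in> carrier R" "q \<in> carrier R"
  shows "(p \<odot>\<^bsub>T.M\<^esub> g11) \<oplus>\<^bsub>T.M\<^esub> (q \<odot>\<^bsub>T.M\<^esub> f2) = lin p (q \<otimes> s) (q \<otimes> s') (q \<otimes> t)"
  using assms by (simp add: lin_def f2_def T.M.smult_r_distr T.M.smult_assoc1 T.M.M.a_ac)

text \<open>Multiples of two vanishing combinations are added at no cost. The coefficients stay
  unsimplified so that they match \<open>expand12\<close>, \<open>expand21\<close> and
  \<open>expand22\<close> literally.\<close>

lemma lin_reduce:
  assumes "{p, q, v, w, u1, u2, u3, u4, w1, w2, w3, w4} \<subseteq> carrier R"
    and "lin u1 u2 u3 u4 = \<zero>\<^bsub>T.M\<^esub>" "lin w1 w2 w3 w4 = \<zero>\<^bsub>T.M\<^esub>"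
  shows "(p \<odot>\<^bsub>T.M\<^esub> g11) \<oplus>\<^bsub>T.M\<^esub> (q \<odot>\<^bsub>T.M\<^esub> f2)
    = lin (p \<oplus> (v \<otimes> u1 \<oplus> w \<otimes> w1)) (q \<otimes> s \<oplus> (v \<otimes> u2 \<oplus> w \<otimes> w2))
        (q \<otimes> s' \<oplus> (v \<otimes> u3 \<oplus> w \<otimes> w3)) (q \<otimes> t \<oplus> (v \<otimes> u4 \<oplus> w \<otimes> w4))"
proof -
  have "lin p (q \<otimes> s) (q \<otimes> s') (q \<otimes> t) \<oplus>\<^bsub>T.M\<^esub> (v \<odot>\<^bsub>T.M\<^esub> lin u1 u2 u3 u4 \<oplus>\<^bsub>T.M\<^esub> w \<odot>\<^bsub>T.M\<^esub> lin w1 w2 w3 w4)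
    = lin p (q \<otimes> s) (q \<otimes> s') (q \<otimes> t)"
    unfolding assms(2,3) using assms(1) lin_closed[of p "q \<otimes> s" "q \<otimes> s'" "q \<otimes> t"] by simp
  then show ?thesis
    using assms(1) by (simp add: lin_f lin_smult lin_add)
qed

lemma tensor_expand:
  "g12 = (coeffs.p12 \<odot>\<^bsub>T.M\<^esub> g11) \<oplus>\<^bsub>T.M\<^esub> (a \<odot>\<^bsub>T.M\<^esub> f2)"
  "g21 = (coeffs.p21 \<odot>\<^bsub>T.M\<^esub> g11) \<oplus>\<^bsub>T.M\<^esub> (a' \<odot>\<^bsub>T.M\<^esub> f2)"
  "g22 = (coeffs.p22 \<odot>\<^bsub>T.M\<^esub> g11) \<oplus>\<^bsub>T.M\<^esub> ((b \<oplus> r) \<odot>\<^bsub>T.M\<^esub> f2)"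
proof -
  have "(coeffs.p12 \<odot>\<^bsub>T.M\<^esub> g11) \<oplus>\<^bsub>T.M\<^esub> (a \<odot>\<^bsub>T.M\<^esub> f2) = lin \<zero> \<one> \<zero> \<zero>"
    by (subst lin_reduce[where v = s' and w = t, OF _ relations(1,2)]) (simp_all only: coeffs.expand12, simp_all)
  then show "g12 = (coeffs.p12 \<odot>\<^bsub>T.M\<^esub> g11) \<oplus>\<^bsub>T.M\<^esub> (a \<odot>\<^bsub>T.M\<^esub> f2)" by (simp add: lin_def)
  have "(coeffs.p21 \<odot>\<^bsub>T.M\<^esub> g11) \<oplus>\<^bsub>T.M\<^esub> (a' \<odot>\<^bsub>T.M\<^esub> f2) = lin \<zero> \<zero> \<one> \<zero>"
    by (subst lin_reduce[where v = "\<ominus> s" and w = t, OF _ relations(1,3)]) (simp_all only: coeffs.expand21, simp_all)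
  then show "g21 = (coeffs.p21 \<odot>\<^bsub>T.M\<^esub> g11) \<oplus>\<^bsub>T.M\<^esub> (a' \<odot>\<^bsub>T.M\<^esub> f2)" by (simp add: lin_def)
  have "(coeffs.p22 \<odot>\<^bsub>T.M\<^esub> g11) \<oplus>\<^bsub>T.M\<^esub> ((b \<oplus> r) \<odot>\<^bsub>T.M\<^esub> f2) = lin \<zero> \<zero> \<zero> \<one>"
    by (subst lin_reduce[where v = "\<ominus> s" and w = "\<ominus> s'", OF _ relations(2,3)]) (simp_all only: coeffs.expand22, simp_all)
  then show "g22 = (coeffs.p22 \<odot>\<^bsub>T.M\<^esub> g11) \<oplus>\<^bsub>T.M\<^esub> ((b \<oplus> r) \<odot>\<^bsub>T.M\<^esub> f2)" by (simp add: lin_def)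
qed

text \<open>The span contains the four frame tensors by \<open>tensor_expand\<close>, hence every
  pure tensor by bilinearity over \<open>R\<close>, hence everything.\<close>

lemma span_f1_f2:
  assumes "z \<in> carrier T"
  shows "\<exists>u \<in> carrier R. \<exists>v \<in> carrier R. z = (u \<odot>\<^bsub>T.M\<^esub> g11) \<oplus>\<^bsub>T.M\<^esub> (v \<odot>\<^bsub>T.M\<^esub> f2)"
proof -
  define Sp where "Sp = {(u \<odot>\<^bsub>T.M\<^esub> g11) \<oplus>\<^bsub>T.M\<^esub> (v \<odot>\<^bsub>T.M\<^esub> f2) | u v. u \<in> carrier R \<and> v \<in> carrier R}"
  have SpI: "z \<in> Sp" if "z = (u \<odot>\<^bsub>T.M\<^esub> g11) \<oplus>\<^bsub>T.M\<^esub> (v \<odot>\<^bsub>T.M\<^esub> f2)" "u \<in> carrier R" "v \<in> carrier R" for z u v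
    using that unfolding Sp_def by blast
  have add: "z \<oplus>\<^bsub>T.M\<^esub> w \<in> Sp" if "z \<in> Sp" "w \<in> Sp" for z w
  proof -
    from that obtain u v where z: "u \<in> carrier R" "v \<in> carrier R"
      "z = (u \<odot>\<^bsub>T.M\<^esub> g11) \<oplus>\<^bsub>T.M\<^esub> (v \<odot>\<^bsub>T.M\<^esub> f2)"
      by (auto simp: Sp_def)
    from that obtain u' v' where w: "u' \<in> carrier R" "v' \<in> carrier R"
      "w = (u' \<odot>\<^bsub>T.M\<^esub> g11) \<oplus>\<^bsub>T.M\<^esub> (v' \<odot>\<^bsub>T.M\<^esub> f2)"
      by (auto simp: Sp_def)
    have "z \<oplus>\<^bsub>T.M\<^esub> w = ((u \<oplus> u') \<odot>\<^bsub>T.M\<^esub> g11) \<oplus>\<^bsub>T.M\<^esub> ((v \<oplus> v') \<odot>\<^bsub>T.M\<^esub> f2)"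
      unfolding z(3) w(3) using z(1,2) w(1,2) by (simp add: T.M.smult_l_distr T.M.M.a_ac)
    from SpI[OF this] show ?thesis using z(1,2) w(1,2) by simp
  qed
  have smult: "k \<odot>\<^bsub>T.M\<^esub> z \<in> Sp" if z: "z \<in> Sp" and k: "k \<in> carrier R" for k z
  proof -
    from z obtain u v where c: "u \<in> carrier R" "v \<in> carrier R"
      "z = (u \<odot>\<^bsub>T.M\<^esub> g11) \<oplus>\<^bsub>T.M\<^esub> (v \<odot>\<^bsub>T.M\<^esub> f2)"
      by (auto simp: Sp_def)
    have "k \<odot>\<^bsub>T.M\<^esub> z = ((k \<otimes> u) \<odot>\<^bsub>T.M\<^esub> g11) \<oplus>\<^bsub>T.M\<^esub> ((k \<otimes> v) \<odot>\<^bsub>T.M\<^esub> f2)"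
      unfolding c(3) using c(1,2) k by (simp add: T.M.smult_r_distr T.M.smult_assoc1)
    from SpI[OF this] show ?thesis using c(1,2) k by simp
  qed
  have g: "g11 \<in> Sp" "g12 \<in> Sp" "g21 \<in> Sp" "g22 \<in> Sp"
    using SpI[OF tensor_expand(1)] SpI[OF tensor_expand(2)] SpI[OF tensor_expand(3)]
    by (simp_all add: SpI[of g11 \<one> \<zero>])
  have "z \<in> Sp"
    using assms
  proof (induction z rule: tensor_product_induct)
    case (diff z w)
    have "z \<oplus>\<^bsub>T.M\<^esub> ((\<ominus> \<one>) \<odot>\<^bsub>T.M\<^esub> w) \<in> Sp"
      by (intro add smult diff) simp
    also have "z \<oplus>\<^bsub>T.M\<^esub> ((\<ominus> \<one>) \<odot>\<^bsub>T.M\<^esub> w) = z \<ominus>\<^bsub>T\<^esub> w"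
      using diff(1,2) by (simp add: T.M.smult_l_minus T.M.M.minus_eq flip: restrict_scalars_ops(4)[of R S])
    finally show ?case .
  next
    case (tensor x y)
    define x1 x2 y1 y2 where xy: "x1 = I.M.coord1 x" "x2 = I.M.coord2 x" "y1 = I'.M.coord1 y" "y2 = I'.M.coord2 y"
    have c: "x1 \<in> carrier R" "x2 \<in> carrier R" "y1 \<in> carrier R" "y2 \<in> carrier R"
      using tensor by (simp_all add: xy)
    have "te x y = te ((x1 \<odot>\<^bsub>I.M\<^esub> e1) \<oplus>\<^bsub>I.M\<^esub> (x2 \<odot>\<^bsub>I.M\<^esub> e2)) ((y1 \<odot>\<^bsub>I'.M\<^esub> e1') \<oplus>\<^bsub>I'.M\<^esub> (y2 \<odot>\<^bsub>I'.M\<^esub> e2'))"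
      using I.M.coord_decomp[of x] I'.M.coord_decomp[of y] tensor by (simp add: xy)
    also have "\<dots> \<in> Sp"
      using c g by (simp add: tensor_add tensor_smult add smult)
    finally show ?case .
  next
    case zero
    show ?case
      using smult[OF g(1), of \<zero>] by (simp flip: restrict_scalars_ops(2)[of R S])
  qed
  then show ?thesis unfolding Sp_def by blast
qed

lemma basis_f: "is_basis2 R T.M g11 f2"
proof -
  obtain k1 where k1: "k1 \<in> carrier T \<rightarrow> carrier R"
    "\<And>z w. z \<in> carrier T \<Longrightarrow> w \<in> carrier T \<Longrightarrow> k1 (z \<oplus>\<^bsub>T.M\<^esub> w) = k1 z \<oplus> k1 w"
    "\<And>u z. u \<in> carrier R \<Longrightarrow> z \<in> carrier T \<Longrightarrow> k1 (u \<odot>\<^bsub>T.M\<^esub> z) = u \<otimes> k1 z"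
    "k1 g11 = \<one>" "k1 g12 = coeffs.p12" "k1 g21 = coeffs.p21" "k1 g22 = coeffs.p22"
    by (rule tensor_functional[OF _ _ _ _ coeffs.p_rel11 coeffs.p_rel12 coeffs.p_rel21 coeffs.p_rel22]) simp_all
  obtain k2 where k2: "k2 \<in> carrier T \<rightarrow> carrier R"
    "\<And>z w. z \<in> carrier T \<Longrightarrow> w \<in> carrier T \<Longrightarrow> k2 (z \<oplus>\<^bsub>T.M\<^esub> w) = k2 z \<oplus> k2 w"
    "\<And>u z. u \<in> carrier R \<Longrightarrow> z \<in> carrier T \<Longrightarrow> k2 (u \<odot>\<^bsub>T.M\<^esub> z) = u \<otimes> k2 z"
    "k2 g11 = \<zero>" "k2 g12 = a" "k2 g21 = a'" "k2 g22 = b \<oplus> r"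
    by (rule tensor_functional[OF _ _ _ _ coeffs.q_rels]) simp_all
  \<comment> \<open>The first value is \<open>p_sum\<close> and the second is the hypothesis
    \<open>unimodular\<close>; with the values at \<open>g11\<close> this makes \<open>k1\<close>,
    \<open>k2\<close> the dual basis of \<open>g11\<close>, \<open>f2\<close>.\<close>
  have f2: "k1 f2 = \<zero>" "k2 f2 = \<one>"
    using coeffs.p_sum unimodular by (simp_all add: f2_def k1(2-7) k2(2-7))
  show ?thesis
    using span_f1_f2
    by (intro is_basis2I[where ?k1.0 = k1 and ?k2.0 = k2])
      (simp_all add: k1(2-4) k2(2-4) f2)
qed

sublocale F: module_basis2 R T.M g11 f2
  by unfold_locales (rule basis_f)

lemma coord_tensor [simp]:
  "F.coord1 g12 = coeffs.p12" "F.coord2 g12 = a" "F.coord1 g21 = coeffs.p21" "F.coord2 g21 = a'"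
  "F.coord1 g22 = coeffs.p22" "F.coord2 g22 = b \<oplus> r"
  using arg_cong[OF tensor_expand(1), of F.coord1] arg_cong[OF tensor_expand(1), of F.coord2]
    arg_cong[OF tensor_expand(2), of F.coord1] arg_cong[OF tensor_expand(2), of F.coord2]
    arg_cong[OF tensor_expand(3), of F.coord1] arg_cong[OF tensor_expand(3), of F.coord2]
  by (simp_all only: F.coord_lincomb coeffs.coeff_closed I.abc I'.abc r I.S.R.a_closed)

text \<open>With this instance, everything proved for one framed module becomes available for the
  tensor product: the good frame, its form, similarity of associated forms and the criterion for
  pseudoregularity.\<close>

sublocale T: framed_module R S T "\<alpha> \<oplus>\<^bsub>S\<^esub> (coeffs.frame_shift \<odot>\<^bsub>S\<^esub> \<one>\<^bsub>S\<^esub>)" g11 f2 "a \<otimes> a'" coeffs.mid_coeff coeffs.last_coeff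
proof
  let ?\<alpha> = "\<alpha> \<oplus>\<^bsub>S\<^esub> (coeffs.frame_shift \<odot>\<^bsub>S\<^esub> \<one>\<^bsub>S\<^esub>)"
  show "is_basis2 R S \<one>\<^bsub>S\<^esub> ?\<alpha>" by (rule I.basis_shift) simp
  show "is_basis2 R T.M g11 f2" by (rule basis_f)
  have act: "?\<alpha> \<odot>\<^bsub>T\<^esub> z = (\<alpha> \<odot>\<^bsub>T\<^esub> z) \<oplus>\<^bsub>T.M\<^esub> (coeffs.frame_shift \<odot>\<^bsub>T.M\<^esub> z)" if "z \<in> carrier T" for z
    using that by (simp add: T.act_plus T.act_scalar)
  show "?\<alpha> \<odot>\<^bsub>T\<^esub> g11 = (coeffs.mid_coeff \<odot>\<^bsub>T.M\<^esub> g11) \<ominus>\<^bsub>T.M\<^esub> ((a \<otimes> a') \<odot>\<^bsub>T.M\<^esub> f2)"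
  proof (rule F.coord_eqI)
    show "F.coord1 (?\<alpha> \<odot>\<^bsub>T\<^esub> g11) = F.coord1 ((coeffs.mid_coeff \<odot>\<^bsub>T.M\<^esub> g11) \<ominus>\<^bsub>T.M\<^esub> ((a \<otimes> a') \<odot>\<^bsub>T.M\<^esub> f2))"
      using coeffs.action1(1) by (simp add: act act_tensor I.S.R.minus_eq)
    show "F.coord2 (?\<alpha> \<odot>\<^bsub>T\<^esub> g11) = F.coord2 ((coeffs.mid_coeff \<odot>\<^bsub>T.M\<^esub> g11) \<ominus>\<^bsub>T.M\<^esub> ((a \<otimes> a') \<odot>\<^bsub>T.M\<^esub> f2))"
      using coeffs.action1(2) by (simp add: act act_tensor I.S.R.minus_eq)
  qed simp_all
  have f: "\<alpha> \<odot>\<^bsub>T\<^esub> f2 = (s \<odot>\<^bsub>T.M\<^esub> (\<alpha> \<odot>\<^bsub>T\<^esub> g12)) \<oplus>\<^bsub>T.M\<^esub> (s' \<odot>\<^bsub>T.M\<^esub> (\<alpha> \<odot>\<^bsub>T\<^esub> g21)) \<oplus>\<^bsub>T.M\<^esub> (t \<odot>\<^bsub>T.M\<^esub> (\<alpha> \<odot>\<^bsub>T\<^esub> g22))"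
    by (simp add: f2_def T.act_add T.act_smult)
  show "?\<alpha> \<odot>\<^bsub>T\<^esub> f2 = coeffs.last_coeff \<odot>\<^bsub>T.M\<^esub> g11"
  proof (rule F.coord_eqI)
    show "F.coord1 (?\<alpha> \<odot>\<^bsub>T\<^esub> f2) = F.coord1 (coeffs.last_coeff \<odot>\<^bsub>T.M\<^esub> g11)"
      using coeffs.action2(1) F.coord_e(3) by (simp add: act f act_tensor)
    show "F.coord2 (?\<alpha> \<odot>\<^bsub>T\<^esub> f2) = F.coord2 (coeffs.last_coeff \<odot>\<^bsub>T.M\<^esub> g11)"
      using coeffs.action2(2) F.coord_e(4) by (simp add: act f act_tensor)
  qed simp_all
qed simp_all

end

text \<open>By \<open>pseudoregular_iff\<close> it suffices that \<alpha>'' satisfies the quadratic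
  equation read off from the new frame. In the basis 1, \<alpha> the coefficient of \<alpha> is
  settled by \<open>mid_coeff_eq\<close> and the constant one by \<open>norm_eq\<close>.\<close>

lemma (in composition) pseudoregular_tensor: "pseudoregular R S T"
proof -
  let ?\<beta> = "\<alpha> \<oplus>\<^bsub>S\<^esub> (coeffs.frame_shift \<odot>\<^bsub>S\<^esub> \<one>\<^bsub>S\<^esub>)"
  have sq: "\<alpha> \<otimes>\<^bsub>S\<^esub> \<alpha> = ((\<ominus> (a \<otimes> c)) \<odot>\<^bsub>S\<^esub> \<one>\<^bsub>S\<^esub>) \<oplus>\<^bsub>S\<^esub> (b \<odot>\<^bsub>S\<^esub> \<alpha>)"
    using I.pseudoregular_iff pseudoregular(1) by simp
  \<comment> \<open>Here \<open>frame_shift\<close> is a bound variable: the identity holds for an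
    arbitrary shift and is specialised afterwards.\<close>
  have "(\<ominus> (((a \<otimes> c) \<oplus> b \<otimes> frame_shift) \<oplus> frame_shift \<otimes> frame_shift)) \<oplus> (b \<oplus> (frame_shift \<oplus> frame_shift)) \<otimes> frame_shift = \<ominus> (a \<otimes> c) \<oplus> frame_shift \<otimes> frame_shift"
    if "frame_shift \<in> carrier R" for frame_shift
    using that I.abc by algebra
  then have n: "\<ominus> ((a \<otimes> a') \<otimes> coeffs.last_coeff) \<oplus> coeffs.mid_coeff \<otimes> coeffs.frame_shift = \<ominus> (a \<otimes> c) \<oplus> coeffs.frame_shift \<otimes> coeffs.frame_shift"
    unfolding coeffs.norm_eq coeffs.mid_coeff_eq by simp
  have "?\<beta> \<otimes>\<^bsub>S\<^esub> ?\<beta> = ((\<ominus> ((a \<otimes> a') \<otimes> coeffs.last_coeff)) \<odot>\<^bsub>S\<^esub> \<one>\<^bsub>S\<^esub>) \<oplus>\<^bsub>S\<^esub> (coeffs.mid_coeff \<odot>\<^bsub>S\<^esub> ?\<beta>)"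
  proof (rule I.B.coord_eqI)
    show "I.B.coord1 (?\<beta> \<otimes>\<^bsub>S\<^esub> ?\<beta>) = I.B.coord1 (((\<ominus> ((a \<otimes> a') \<otimes> coeffs.last_coeff)) \<odot>\<^bsub>S\<^esub> \<one>\<^bsub>S\<^esub>) \<oplus>\<^bsub>S\<^esub> (coeffs.mid_coeff \<odot>\<^bsub>S\<^esub> ?\<beta>))"
      using I.shift_square(1)[OF _ _ sq, of coeffs.frame_shift] by (simp add: n)
    show "I.B.coord2 (?\<beta> \<otimes>\<^bsub>S\<^esub> ?\<beta>) = I.B.coord2 (((\<ominus> ((a \<otimes> a') \<otimes> coeffs.last_coeff)) \<odot>\<^bsub>S\<^esub> \<one>\<^bsub>S\<^esub>) \<oplus>\<^bsub>S\<^esub> (coeffs.mid_coeff \<odot>\<^bsub>S\<^esub> ?\<beta>))"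
      using I.shift_square(2)[OF _ _ sq, of coeffs.frame_shift] by (simp add: coeffs.mid_coeff_eq)
  qed simp_all
  then show ?thesis by (rule T.pseudoregular_iff[THEN iffD2])
qed

theorem corollary6p2p8:
  fixes R :: "'r ring" (structure)
    and S :: "('r, 's) module"
    and I :: "('s, 'i) module"
    and I' :: "('s, 'j) module"
  assumes "cring R"
    and "free_quadratic_algebra R S"
    and "pseudoregular R S I"
    and "pseudoregular R S I'"
    and "good_frame R S I \<alpha> e1 e2"
    and "good_frame R S I' \<alpha>' e1' e2'"
    and "r \<in> carrier R"
    and "\<alpha>' = \<alpha> \<oplus>\<^bsub>S\<^esub> (r \<odot>\<^bsub>S\<^esub> \<one>\<^bsub>S\<^esub>)"
    and "M = restrict_scalars R S I"
    and "M' = restrict_scalars R S I'"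
    and "a \<in> carrier R" "b \<in> carrier R" "c \<in> carrier R"
    and "a' \<in> carrier R" "b' \<in> carrier R" "c' \<in> carrier R"
    and "\<alpha> \<odot>\<^bsub>I\<^esub> e1 = (b \<odot>\<^bsub>M\<^esub> e1) \<ominus>\<^bsub>M\<^esub> (a \<odot>\<^bsub>M\<^esub> e2)"
    and "\<alpha> \<odot>\<^bsub>I\<^esub> e2 = c \<odot>\<^bsub>M\<^esub> e1"
    and "\<alpha>' \<odot>\<^bsub>I'\<^esub> e1' = (b' \<odot>\<^bsub>M'\<^esub> e1') \<ominus>\<^bsub>M'\<^esub> (a' \<odot>\<^bsub>M'\<^esub> e2')"
    and "\<alpha>' \<odot>\<^bsub>I'\<^esub> e2' = c' \<odot>\<^bsub>M'\<^esub> e1'"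
    and "Idl\<^bsub>R\<^esub> {a, a', b \<oplus> r} = carrier R"
    and "s \<in> carrier R" "s' \<in> carrier R" "t \<in> carrier R"
    and "s \<otimes> a \<oplus> s' \<otimes> a' \<oplus> t \<otimes> (b \<oplus> r) = \<one>"
    and "T = tensor_product S I I'"
    and "T\<^sub>R = restrict_scalars R S T"
    and "f1 = tensor_elem S I I' e1 e1'"
    and "f2 = (s \<odot>\<^bsub>T\<^sub>R\<^esub> tensor_elem S I I' e1 e2')
              \<oplus>\<^bsub>T\<^sub>R\<^esub> (s' \<odot>\<^bsub>T\<^sub>R\<^esub> tensor_elem S I I' e2 e1')
              \<oplus>\<^bsub>T\<^sub>R\<^esub> (t \<odot>\<^bsub>T\<^sub>R\<^esub> tensor_elem S I I' e2 e2')"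
    and "\<alpha>'' = \<alpha> \<oplus>\<^bsub>S\<^esub> ((a \<otimes> (r \<otimes> s \<ominus> c \<otimes> t)) \<odot>\<^bsub>S\<^esub> \<one>\<^bsub>S\<^esub>)"
    and "q = binary_form R
               (a \<otimes> a')
               (b \<ominus> [(2::nat)] \<cdot> (a \<otimes> (c \<otimes> t \<ominus> r \<otimes> s)))
               (c \<otimes> s'
                \<oplus> (s \<otimes> b \<oplus> c \<otimes> t) \<otimes> (c' \<otimes> t \<oplus> r \<otimes> s')
                \<oplus> (a \<otimes> s) \<otimes> (c \<otimes> s' \<oplus> c' \<otimes> s))"
  shows "is_basis2 R T\<^sub>R f1 f2 \<and>
    good_frame R S T \<alpha>'' f1 f2 \<and>
    pseudoregular R S T \<and>
    (\<exists>Q. form_in_frame R S T \<alpha>'' f1 f2 Q \<and>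
             (\<forall>x1 \<in> carrier R. \<forall>x2 \<in> carrier R.
                Q ((x1 \<odot>\<^bsub>T\<^sub>R\<^esub> f1) \<oplus>\<^bsub>T\<^sub>R\<^esub> (x2 \<odot>\<^bsub>T\<^sub>R\<^esub> f2)) = q (x1, x2))) \<and>
    (\<forall>Q''. associated_form R S T Q'' \<longrightarrow> similar_forms R T\<^sub>R Q'' (std_module2 R) q)"
proof -
  note hyps = assms
  have alg: "algebra R S"
    using hyps(2) by (simp add: free_quadratic_algebra_def)
  have mods: "module S I" "module S I'"
    using hyps(3,4) by (simp_all add: pseudoregular_def)
  have bases: "is_basis2 R S \<one>\<^bsub>S\<^esub> \<alpha>" "is_basis2 R (restrict_scalars R S I) e1 e2"
      "is_basis2 R S \<one>\<^bsub>S\<^esub> \<alpha>'" "is_basis2 R (restrict_scalars R S I') e1' e2'"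
    using hyps(5,6) by (simp_all add: good_frame_def)
  note action = hyps(17-20)[unfolded hyps(9,10)]
  interpret composition R S I I' \<alpha> e1 e2 a b c \<alpha>' e1' e2' a' b' c' r s s' t
    by (intro composition.intro composition_axioms.intro framed_pair.intro framed_pair_axioms.intro
        framed_module.intro framed_module_axioms.intro algebra_module.intro alg mods bases action
        hyps(3,4,7,8,11-16,22-25))
  have T: "T = tensor_product S I I'" and TR: "T\<^sub>R = restrict_scalars R S (tensor_product S I I')"
    using hyps(26,27) by simp_all
  have f1: "f1 = tensor_elem S I I' e1 e1'" and f2': "f2 = composition.f2 R S I I' e1 e2 e1' e2' s s' t"
    using hyps(28,29) by (simp_all add: f2_def TR)
  have q: "q = binary_form R (a \<otimes> a') coeffs.mid_coeff coeffs.last_coeff"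
    and \<alpha>'': "\<alpha>'' = \<alpha> \<oplus>\<^bsub>S\<^esub> (coeffs.frame_shift \<odot>\<^bsub>S\<^esub> \<one>\<^bsub>S\<^esub>)"
    using hyps(30,31) by (simp_all only: coeffs.mid_coeff_def coeffs.last_coeff_def coeffs.frame_shift_def)
  show ?thesis
    unfolding T TR f1 f2' \<alpha>'' q
  \<comment> \<open>The witness for Q is the coordinate form of \<open>T.form_in_frame\<close>; its
    value at x1 f1 + x2 f2 is read off from the coordinates.\<close>
  proof (intro conjI allI impI exI)
    show "associated_form R S (tensor_product S I I') Q'' \<Longrightarrow> similar_forms R (restrict_scalars R S (tensor_product S I I')) Q''
        (std_module2 R) (binary_form R (a \<otimes> a') coeffs.mid_coeff coeffs.last_coeff)" for Q''
      by (rule T.associated_form_similar)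
  qed (use basis_f T.good_frame pseudoregular_tensor T.form_in_frame in auto)
qed

end
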